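(* Let $d\geq 2$, $N\geq 1$, let $A,B\in\mathbb{C}^{N,N}$ be simultaneously diagonalizable (over $\mathbb{C}$) with transformation matrix $Y\in\mathbb{C}^{N,N}$, let every eigenvalue of $A$ have positive real part, and let $S\in\mathbb{R}^{d,d}$ be skew-symmetric. Let $0<\vartheta<1$, $\omega_{\mathrm b}=-b_0$, $\lambda\in\mathbb{C}$ with $\mathrm{Re}\,\lambda>\omega_{\mathrm b}$, and let $\theta\in C(\mathbb{R}^d,\mathbb{R})$ be a radial weight function of exponential growth rate $\eta\geq0$ (with constant $C_\theta$) such that $$0\leq\eta^2\leq\vartheta\,\frac{a_0(\mathrm{Re}\,\lambda-\omega_{\mathrm b})}{a_{\max}^2}$$ and such that for some constant $C>0$, $\theta(x)\geq C$ for all $x\in\mathbb{R}^d$. Let $g\in C_{\mathrm{rub}}(\mathbb{R}^d,\mathbb{C}^N)$ and let $v_\star\in\mathcal{D}(A_{\mathrm b})$ be the unique solution of $(\lambda I-A_{\mathrm b})v=g$ in $C_{\mathrm{rub}}(\mathbb{R}^d,\mathbb{C}^N)$, where $A_{\mathrm b}$ is the generator of the semigroup $(T(t))_{t\geq0}$ on $C_{\mathrm{rub}}(\mathbb{R}^d,\mathbb{C}^N)$ defined in the context. Then $v_\star\in C_{\mathrm{rub}}(\mathbb{R}^d,\mathbb{C}^N)\cap C^1_{\mathrm{ub}}(\mathbb{R}^d,\mathbb{C}^N)$. If in addition $g\in C_{\mathrm b,\theta}(\mathbb{R}^d,\mathbb{C}^N)$, then $$v_\star\in C_{\mathrm{rub}}(\mathbb{R}^d,\mathbb{C}^N)\cap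 C^1_{\mathrm{ub}}(\mathbb{R}^d,\mathbb{C}^N)\cap C^1_{\mathrm b,\theta}(\mathbb{R}^d,\mathbb{C}^N),$$ and $$\|v_\star\|_{C_{\mathrm b,\theta}}\leq\frac{C_7}{\mathrm{Re}\,\lambda-\omega_{\mathrm b}}\|g\|_{C_{\mathrm b,\theta}},\qquad\|D_iv_\star\|_{C_{\mathrm b,\theta}}\leq\frac{C_8}{(\mathrm{Re}\,\lambda-\omega_{\mathrm b})^{1/2}}\|g\|_{C_{\mathrm b,\theta}},\quad i=1,\dots,d,$$ where, with ${}_2F_1$ the hypergeometric function, the $\lambda$-independent constants are $$C_7=C_\theta\kappa a_1^{\frac d2}\,\tfrac1{1-\vartheta}\left({}_2F_1\left(-\tfrac{d-1}2,1;\tfrac12;-\tfrac\vartheta{1-\vartheta}\right)+\pi^{\frac12}\tfrac{\Gamma(\frac{d+1}2)}{\Gamma(\frac d2)}\left(\tfrac\vartheta{1-\vartheta}\right)^{\frac12}{}_2F_1\left(-\tfrac{d-2}2,\tfrac32;\tfrac32;-\tfrac\vartheta{1-\vartheta}\right)\right),$$ $$C_8=C_\theta\kappa a_1^{\frac{d+1}2}\tfrac{\Gamma(\frac12)}{a_{\min}^{1/2}}\left(\tfrac1{1-\vartheta}\right)^{\frac12}\left(\tfrac{\Gamma(\frac{d+1}2)}{\Gamma(\frac d2)}\,{}_2F_1\left(-\tfrac d2,\tfrac12;\tfrac12;-\tfrac\vartheta{1-\vartheta}\right)+2\tfrac{\Gamma(\frac{d+2}2)}{\Gamma(\frac12)\Gamma(\frac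 d2)}\left(\tfrac\vartheta{1-\vartheta}\right)^{\frac12}{}_2F_1\left(-\tfrac{d-1}2,1;\tfrac32;-\tfrac\vartheta{1-\vartheta}\right)\right).$$ Moreover, (for such $g$) for every $x\in\mathbb{R}^d$, $$|v_\star(x)|\leq\frac{C_7}{\mathrm{Re}\,\lambda-\omega_{\mathrm b}}\frac1{\theta(x)}\|g\|_{C_{\mathrm b,\theta}},\qquad|D_iv_\star(x)|\leq\frac{C_8}{(\mathrm{Re}\,\lambda-\omega_{\mathrm b})^{1/2}}\frac1{\theta(x)}\|g\|_{C_{\mathrm b,\theta}},\quad i=1,\dots,d.$$
   Context: Weight functions: $\theta\in C(\mathbb{R}^d,\mathbb{R})$ is a weight function of exponential growth rate $\eta\geq0$ if $\theta>0$ and there is $C_\theta>0$ with $\theta(x+y)\leq C_\theta\theta(x)e^{\eta|y|}$ for all $x,y$; it is radial if $\theta(x)=\phi(|x|)$ for some $\phi:[0,\infty)\to\mathbb{R}$. Spaces (functions $\mathbb{R}^d\to\mathbb{C}^N$): $C_{\mathrm b}$ is the space of bounded continuous functions with the sup-norm; $C_{\mathrm{ub}}$ its subspace of uniformly continuous functions; $C^1_{\mathrm{ub}}$ the functions in $C_{\mathrm{ub}}$ whose first-order partial derivatives exist and lie in $C_{\mathrm{ub}}$; $C_{\mathrm{rub}}=\{v\in C_{\mathrm{ub}}:\lim_{t\to0}\sup_x|v(e^{-tS}x)-v(x)|=0\}$ with the sup-norm; $C_{\mathrm b,\theta}=\{v\text{ continuous}:\|v\|_{C_{\mathrm b,\theta}}:=\sup_x|\theta(x)v(x)|<\infty\}$;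 $C^1_{\mathrm b,\theta}=\{v\in C_{\mathrm b,\theta}:D_iv\in C_{\mathrm b,\theta},\ i=1,\dots,d\}$. Semigroup: $T(0)=I$ and $[T(t)v](x)=\int_{\mathbb{R}^d}H(x,\xi,t)v(\xi)\,d\xi$ for $t>0$, where $H(x,\xi,t)=(4\pi tA)^{-d/2}\exp(-Bt-(4tA)^{-1}|e^{tS}x-\xi|^2)$. Matrix powers: if $A=Y\,\mathrm{diag}(\lambda_k)\,Y^{-1}$ then $(4\pi tA)^{-d/2}=Y\,\mathrm{diag}((4\pi t\lambda_k)^{-d/2})\,Y^{-1}$, with $z^{-d/2}=\exp(-\frac d2\mathrm{Log}\,z)$, $\mathrm{Log}$ the principal logarithm. This is a $C_0$-semigroup on $C_{\mathrm{rub}}(\mathbb{R}^d,\mathbb{C}^N)$ with generator $A_{\mathrm b}v=\lim_{t\downarrow0}\frac{T(t)v-v}{t}$ on the domain $\mathcal{D}(A_{\mathrm b})$ of all $v\in C_{\mathrm{rub}}$ for which the limit exists in $C_{\mathrm{rub}}$. For $\mathrm{Re}\,\lambda>\omega_{\mathrm b}$ and $g\in C_{\mathrm{rub}}$ the equation $(\lambda I-A_{\mathrm b})v=g$ has a unique solution $v_\star=\int_0^\infty e^{-\lambda t}T(t)g\,dt\in\mathcal{D}(A_{\mathrm b})$. Constants: $a_{\min}=\min_{\lambda\in\sigma(A)}|\lambda|$, $a_{\max}=\max_{\lambda\in\sigma(A)}|\lambda|$, $a_0=\min_{\lambda\in\sigma(A)}\mathrm{Re}\,\lambda$, $b_0=\min_{\mu\in\sigma(B)}\mathrm{Re}\,\mu$,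 $a_1=\frac{a_{\max}^2}{a_{\min}a_0}$, $\kappa=|Y||Y^{-1}|$ (spectral norm), where $Y^{-1}AY$ and $Y^{-1}BY$ are diagonal. *)

theory Defs
  imports "HOL-Complex_Analysis.Complex_Analysis"
begin

definition spectrum :: "complex^'n^'n \<Rightarrow> complex set" where
  "spectrum M = {\<mu>. \<exists>v. v \<noteq> 0 \<and> M *v v = \<mu> *s v}"

definition diagonal_matrix :: "'a::zero^'n^'n \<Rightarrow> bool" where
  "diagonal_matrix M \<longleftrightarrow> (\<forall>i j. i \<noteq> j \<longrightarrow> M $ i $ j = 0)"

definition simultaneously_diagonalizable_with ::
  "complex^'n^'n \<Rightarrow> complex^'n^'n \<Rightarrow> complex^'n^'n \<Rightarrow> bool" where
  "simultaneously_diagonalizable_with Y A B \<longleftrightarrow>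
     invertible Y \<and> diagonal_matrix (matrix_inv Y ** A ** Y)
       \<and> diagonal_matrix (matrix_inv Y ** B ** Y)"

definition spectral_norm :: "complex^'n^'n \<Rightarrow> real" where
  "spectral_norm M = onorm (\<lambda>v. M *v v)"

text \<open>
  The library multiplication and power on \<^typ>\<open>'a^'n^'n\<close> are componentwise, so neither
  \<open>M ^ k\<close> nor \<open>exp M\<close> is the matrix operation.
\<close>

definition matrix_power :: "'a::semiring_1^'n^'n \<Rightarrow> nat \<Rightarrow> 'a^'n^'n" where
  "matrix_power M k = (((**) M) ^^ k) (mat 1)"

definition matrix_exp :: "'a::real_normed_field^'n^'n \<Rightarrow> 'a^'n^'n" where
  "matrix_exp M = (\<Sum>k. (1 / fact k) *\<^sub>R matrix_power M k)"

text \<open>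
  \<open>Y diag(\<mu>\<^sub>k powr s) Y\<^sup>-\<^sup>1\<close> for \<open>M = Y diag(\<mu>\<^sub>k) Y\<^sup>-\<^sup>1\<close>; on nonzero complex numbers the library's
  \<open>z powr s\<close> is \<open>exp (s * Ln z)\<close> with the principal logarithm.
\<close>

definition matrix_powr :: "complex^'n^'n \<Rightarrow> complex^'n^'n \<Rightarrow> complex \<Rightarrow> complex^'n^'n" where
  "matrix_powr Y M s =
     Y ** (\<chi> i j. if i = j then (matrix_inv Y ** M ** Y) $ i $ i powr s else 0) ** matrix_inv Y"

definition a_min :: "complex^'n^'n \<Rightarrow> real" where
  "a_min A = Min (cmod ` spectrum A)"

definition a_max :: "complex^'n^'n \<Rightarrow> real" where
  "a_max A = Max (cmod ` spectrum A)"

text \<open>This is \<open>a\<^sub>0\<close> for \<open>A\<close> and \<open>b\<^sub>0\<close> for \<open>B\<close>.\<close>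

definition min_Re_spectrum :: "complex^'n^'n \<Rightarrow> real" where
  "min_Re_spectrum M = Min (Re ` spectrum M)"

definition a_one :: "complex^'n^'n \<Rightarrow> real" where
  "a_one A = (a_max A)\<^sup>2 / (a_min A * min_Re_spectrum A)"

definition omega_b :: "complex^'n^'n \<Rightarrow> real" where
  "omega_b B = - min_Re_spectrum B"

definition kappa :: "complex^'n^'n \<Rightarrow> real" where
  "kappa Y = spectral_norm Y * spectral_norm (matrix_inv Y)"

definition weight_function :: "(real^'d \<Rightarrow> real) \<Rightarrow> real \<Rightarrow> real \<Rightarrow> bool" where
  "weight_function \<theta> \<eta> C\<theta> \<longleftrightarrow>
     continuous_on UNIV \<theta> \<and> \<eta> \<ge> 0 \<and> C\<theta> > 0 \<and> (\<forall>x. \<theta> x > 0) \<and>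
     (\<forall>x y. \<theta> (x + y) \<le> C\<theta> * \<theta> x * exp (\<eta> * norm y))"

definition radial :: "(real^'d \<Rightarrow> real) \<Rightarrow> bool" where
  "radial \<theta> \<longleftrightarrow> (\<exists>\<phi>::real \<Rightarrow> real. \<forall>x. \<theta> x = \<phi> (norm x))"

definition C_ub :: "(real^'d \<Rightarrow> complex^'n) set" where
  "C_ub = {v \<in> bcontfun. uniformly_continuous_on UNIV v}"

definition has_partial :: "'d \<Rightarrow> (real^'d \<Rightarrow> complex^'n) \<Rightarrow> real^'d \<Rightarrow> bool" where
  "has_partial i v x \<longleftrightarrow> (\<lambda>h::real. v (x + h *\<^sub>R axis i 1)) differentiable (at 0)"

definition partial :: "'d \<Rightarrow> (real^'d \<Rightarrow> complex^'n) \<Rightarrow> real^'d \<Rightarrow> complex^'n" where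
  "partial i v x = vector_derivative (\<lambda>h::real. v (x + h *\<^sub>R axis i 1)) (at 0)"

definition C1_ub :: "(real^'d \<Rightarrow> complex^'n) set" where
  "C1_ub = {v \<in> C_ub. \<forall>i. (\<forall>x. has_partial i v x) \<and> partial i v \<in> C_ub}"

definition C_rub :: "real^'d^'d \<Rightarrow> (real^'d \<Rightarrow> complex^'n) set" where
  "C_rub S = {v \<in> C_ub.
     ((\<lambda>t::real. SUP x. norm (v (matrix_exp (- (t *\<^sub>R S)) *v x) - v x)) \<longlongrightarrow> 0) (at 0)}"

definition C_b_weighted :: "(real^'d \<Rightarrow> real) \<Rightarrow> (real^'d \<Rightarrow> complex^'n) set" where
  "C_b_weighted \<theta> = {v. continuous_on UNIV v \<and> bounded (range (\<lambda>x. \<theta> x *\<^sub>R v x))}"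

definition weighted_norm :: "(real^'d \<Rightarrow> real) \<Rightarrow> (real^'d \<Rightarrow> complex^'n) \<Rightarrow> real" where
  "weighted_norm \<theta> v = (SUP x. norm (\<theta> x *\<^sub>R v x))"

definition C1_b_weighted :: "(real^'d \<Rightarrow> real) \<Rightarrow> (real^'d \<Rightarrow> complex^'n) set" where
  "C1_b_weighted \<theta> =
     {v \<in> C_b_weighted \<theta>. \<forall>i. (\<forall>x. has_partial i v x) \<and> partial i v \<in> C_b_weighted \<theta>}"

text \<open>
  \<open>Y\<close> is a matrix diagonalizing both \<open>A\<close> and \<open>B\<close>; it enters only through the power
  \<open>(4\<pi>tA)\<^sup>-\<^sup>d\<^sup>/\<^sup>2\<close>, whose value does not depend on the choice of \<open>Y\<close>.
\<close>

definition OU_kernel ::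
  "complex^'n^'n \<Rightarrow> complex^'n^'n \<Rightarrow> complex^'n^'n \<Rightarrow> real^'d^'d \<Rightarrow>
   real^'d \<Rightarrow> real^'d \<Rightarrow> real \<Rightarrow> complex^'n^'n" where
  "OU_kernel Y A B S x \<xi> t =
     matrix_powr Y ((4 * pi * t) *\<^sub>R A) (- of_nat CARD('d) / 2) **
     matrix_exp (- (t *\<^sub>R B)
       - (norm (matrix_exp (t *\<^sub>R S) *v x - \<xi>))\<^sup>2 *\<^sub>R matrix_inv ((4 * t) *\<^sub>R A))"

definition OU_semigroup ::
  "complex^'n^'n \<Rightarrow> complex^'n^'n \<Rightarrow> complex^'n^'n \<Rightarrow> real^'d^'d \<Rightarrow>
   real \<Rightarrow> (real^'d \<Rightarrow> complex^'n) \<Rightarrow> real^'d \<Rightarrow> complex^'n" where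
  "OU_semigroup Y A B S t v x =
     (if t = 0 then v x else (LINT \<xi>|lborel. OU_kernel Y A B S x \<xi> t *v v \<xi>))"

text \<open>\<open>(T(t)v - v)/t \<rightarrow> w\<close> in sup-norm as \<open>t \<down> 0\<close>, with \<open>v\<close> and \<open>w\<close> in \<open>C_rub\<close>.\<close>

definition has_generator_value ::
  "complex^'n^'n \<Rightarrow> complex^'n^'n \<Rightarrow> complex^'n^'n \<Rightarrow> real^'d^'d \<Rightarrow>
   (real^'d \<Rightarrow> complex^'n) \<Rightarrow> (real^'d \<Rightarrow> complex^'n) \<Rightarrow> bool" where
  "has_generator_value Y A B S v w \<longleftrightarrow>
     v \<in> C_rub S \<and> w \<in> C_rub S \<and>
     uniform_limit UNIV (\<lambda>t x. (1 / t) *\<^sub>R (OU_semigroup Y A B S t v x - v x)) w (at_right 0)"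

definition generator_domain ::
  "complex^'n^'n \<Rightarrow> complex^'n^'n \<Rightarrow> complex^'n^'n \<Rightarrow> real^'d^'d \<Rightarrow>
   (real^'d \<Rightarrow> complex^'n) set" where
  "generator_domain Y A B S = {v. \<exists>w. has_generator_value Y A B S v w}"

definition generator ::
  "complex^'n^'n \<Rightarrow> complex^'n^'n \<Rightarrow> complex^'n^'n \<Rightarrow> real^'d^'d \<Rightarrow>
   (real^'d \<Rightarrow> complex^'n) \<Rightarrow> real^'d \<Rightarrow> complex^'n" where
  "generator Y A B S v = (THE w. has_generator_value Y A B S v w)"

text \<open>
  The Gauss series diverges for \<open>\<bar>z\<bar> > 1\<close>, where \<open>2F1\<close> means its principal branch: the
  continuation of the series to \<open>\<complex> - [1,\<infinity>)\<close>, i.e. the analytic continuation along the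
  segment from \<open>0\<close> to \<open>z\<close>. We take the value at \<open>z\<close> of any holomorphic extension of the
  series to an open set that is star-shaped about \<open>0\<close>. By \<open>hypergeo_2F1_eqI\<close> it does not
  depend on the extension; by \<open>hypergeo_continuation_slit_plane\<close> the slit plane is a special case.
\<close>

definition hypergeo_continuation ::
  "complex \<Rightarrow> complex \<Rightarrow> complex \<Rightarrow> complex set \<Rightarrow> (complex \<Rightarrow> complex) \<Rightarrow> bool" where
  "hypergeo_continuation a b c U f \<longleftrightarrow>
     open U \<and> 0 \<in> U \<and> (\<forall>z\<in>U. closed_segment 0 z \<subseteq> U) \<and> f holomorphic_on U \<and>
     (\<forall>\<^sub>F z in nhds 0. f z = eval_fps (fps_hypergeo [a, b] [c] 1) z)"

definition hypergeo_2F1 :: "complex \<Rightarrow> complex \<Rightarrow> complex \<Rightarrow> complex \<Rightarrow> complex" where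
  "hypergeo_2F1 a b c z = (THE w. \<exists>U f. hypergeo_continuation a b c U f \<and> z \<in> U \<and> w = f z)"

lemma hypergeo_2F1_eqI:
  assumes "hypergeo_continuation a b c U f" "z \<in> U"
  shows "hypergeo_2F1 a b c z = f z"
  unfolding hypergeo_2F1_def
proof (rule the_equality)
  show "\<exists>U' f'. hypergeo_continuation a b c U' f' \<and> z \<in> U' \<and> f z = f' z"
    using assms by blast
next
  fix w assume "\<exists>V g. hypergeo_continuation a b c V g \<and> z \<in> V \<and> w = g z"
  then obtain V g where g: "hypergeo_continuation a b c V g" "z \<in> V" "w = g z" by blast
  let ?W = "U \<inter> V"
  have W: "open ?W" "0 \<in> ?W" "z \<in> ?W"
    using assms g unfolding hypergeo_continuation_def by auto
  have "starlike ?W"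
    unfolding starlike_def
    using W(2) assms g unfolding hypergeo_continuation_def by (intro bexI[of _ 0]) blast+
  hence conn: "connected ?W" by (rule starlike_imp_connected)
  have "\<forall>\<^sub>F z in nhds 0. f z = eval_fps (fps_hypergeo [a, b] [c] 1) z"
       "\<forall>\<^sub>F z in nhds 0. g z = eval_fps (fps_hypergeo [a, b] [c] 1) z"
    using assms g unfolding hypergeo_continuation_def by auto
  hence "\<forall>\<^sub>F z in nhds 0. f z - g z = 0"
    by eventually_elim simp
  moreover have "\<forall>\<^sub>F z in nhds 0. z \<in> ?W"
    using W eventually_nhds by blast
  ultimately have "\<forall>\<^sub>F z in nhds 0. z \<in> ?W \<and> f z - g z = 0"
    by eventually_elim simp
  then obtain X where X: "open X" "0 \<in> X" "\<And>x. x \<in> X \<Longrightarrow> x \<in> ?W \<and> f x - g x = 0"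
    unfolding eventually_nhds by blast
  have "f z - g z = 0"
  proof (rule analytic_continuation_open[of X ?W "\<lambda>z. f z - g z" "\<lambda>_. 0"])
    show "(\<lambda>z. f z - g z) holomorphic_on ?W"
      using assms g unfolding hypergeo_continuation_def
      by (intro holomorphic_intros) (auto intro: holomorphic_on_subset)
  qed (use X W conn in auto)
  thus "w = f z" using g by simp
qed

lemma hypergeo_continuation_slit_plane:
  assumes "f holomorphic_on - (of_real ` {1..})"
    and "\<And>z. norm z < 1 \<Longrightarrow> f z = eval_fps (fps_hypergeo [a, b] [c] 1) z"
  shows "hypergeo_continuation a b c (- (of_real ` {1..})) f"
  unfolding hypergeo_continuation_def
proof (intro conjI ballI)
  have eq: "(of_real ` {1..} :: complex set) = {z. Im z = 0} \<inter> {z. Re z \<ge> 1}"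
    by (auto simp: complex_eq_iff image_iff intro!: bexI[of _ "Re _"])
  show "open (- (of_real ` {1..} :: complex set))"
    unfolding eq by (intro open_Compl closed_Int closed_halfspace_Re_ge)
      (simp add: closed_Collect_eq continuous_on_Im)
  show "\<forall>\<^sub>F z in nhds 0. f z = eval_fps (fps_hypergeo [a, b] [c] 1) z"
    unfolding eventually_nhds
    by (intro exI[of _ "ball 0 1"]) (use assms(2) in auto)
  fix z :: complex assume z: "z \<in> - (of_real ` {1..})"
  show "closed_segment 0 z \<subseteq> - (of_real ` {1..})"
  proof
    fix y assume "y \<in> closed_segment 0 z"
    then obtain u where u: "0 \<le> u" "u \<le> 1" "y = u *\<^sub>R z"
      by (auto simp: in_segment)
    show "y \<in> - (of_real ` {1..})"
    proof
      assume "y \<in> of_real ` {1..}"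
      hence y: "u * Im z = 0" "u * Re z \<ge> 1" unfolding eq using u by auto
      hence "u \<noteq> 0" by auto
      hence im: "Im z = 0" using y by simp
      have "Re z > 0" using y u by (smt (verit) mult_nonneg_nonpos)
      hence "u * Re z \<le> Re z" using u by (simp add: mult_le_cancel_right1)
      thus False using y im z unfolding eq by auto
    qed
  qed
qed (use assms(1) in auto)

text \<open>
  For real parameters and real \<open>z < 1\<close> the value of \<open>2F1\<close> is real, so taking the real part
  only changes its type.
\<close>

definition hypergeo_real :: "real \<Rightarrow> real \<Rightarrow> real \<Rightarrow> real \<Rightarrow> real" where
  "hypergeo_real a b c z =
     Re (hypergeo_2F1 (of_real a) (of_real b) (of_real c) (of_real z))"

text \<open>
  \<open>d\<close> is the space dimension and \<open>\<delta> \<in> (0,1)\<close> the parameter bounding the growth rate \<open>\<eta>\<close>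
  of the weight by \<open>\<eta>\<^sup>2 \<le> \<delta> a\<^sub>0 (Re \<zeta> - \<omega>\<^sub>b) / a_max\<^sup>2\<close>; the resolvent parameter \<open>\<zeta>\<close> itself
  does not enter.
\<close>

definition const_C7 :: "nat \<Rightarrow> complex^'n^'n \<Rightarrow> complex^'n^'n \<Rightarrow> real \<Rightarrow> real \<Rightarrow> real" where
  "const_C7 d Y A C\<theta> \<delta> =
     C\<theta> * kappa Y * a_one A powr (real d / 2) * (1 / (1 - \<delta>)) *
     (hypergeo_real (- ((real d - 1) / 2)) 1 (1/2) (- (\<delta> / (1 - \<delta>)))
      + pi powr (1/2) * (Gamma ((real d + 1) / 2) / Gamma (real d / 2)) * (\<delta> / (1 - \<delta>)) powr (1/2)
        * hypergeo_real (- ((real d - 2) / 2)) (3/2) (3/2) (- (\<delta> / (1 - \<delta>))))"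

definition const_C8 :: "nat \<Rightarrow> complex^'n^'n \<Rightarrow> complex^'n^'n \<Rightarrow> real \<Rightarrow> real \<Rightarrow> real" where
  "const_C8 d Y A C\<theta> \<delta> =
     C\<theta> * kappa Y * a_one A powr ((real d + 1) / 2) * (Gamma (1/2) / a_min A powr (1/2))
     * (1 / (1 - \<delta>)) powr (1/2) *
     (Gamma ((real d + 1) / 2) / Gamma (real d / 2)
        * hypergeo_real (- (real d / 2)) (1/2) (1/2) (- (\<delta> / (1 - \<delta>)))
      + 2 * (Gamma ((real d + 2) / 2) / (Gamma (1/2) * Gamma (real d / 2))) * (\<delta> / (1 - \<delta>)) powr (1/2)
        * hypergeo_real (- ((real d - 1) / 2)) 1 (3/2) (- (\<delta> / (1 - \<delta>))))"

end

theory Submission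
  imports Defs
begin

text \<open>
  Conjugation by \<open>Y\<close> decouples the system into scalar equations with complex Gaussian kernels
  composed with the rotations \<open>e\<^sup>t\<^sup>S\<close>. The Chapman-Kolmogorov identity for these kernels
  needs only \<open>\<integral> exp (- a |x|\<^sup>2)\<close> for \<open>Re a > 0\<close>, which is obtained by analytic continuation. Applying
  the Laplace transform of the semigroup to the difference quotients of \<open>v\<close> shows that
  \<open>v\<close> is the Laplace transform of \<open>T(t)g\<close>, that is, an \<open>L\<^sup>1\<close> kernel in time and space integrated against
  \<open>g\<close>; its directional derivative is the integral against an \<open>L\<^sup>1\<close> derivative kernel by Fubini and the
  fundamental theorem of calculus.

  Since \<open>\<theta>\<close> is radial and the rotations are isometries, the weighted bounds reduce to the integral of
  a real Gaussian times \<open>exp (\<eta> |\<psi>|)\<close> over time and space. Expanding the exponential turns it into a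
  series of products of Gamma values; its even and odd parts are Gauss series at
  \<open>\<delta>\<close>, which Pfaff's transformation carries to \<open>- \<delta> / (1 - \<delta>)\<close>.
\<close>

text \<open>Two features shape the estimates. First, the eigenvalues of \<open>A\<close> are
  complex, so a scalar kernel has L1 mass \<open>(cmod l / Re l) powr (d / 2)\<close> up to its
  exponential factor, in general above 1: there is no contraction or positivity to use, and every
  bound goes through absolute values. One real Gaussian has to dominate all components, so extreme
  values are taken separately: \<open>a_min\<close> in the prefactor,
  \<open>a0 / (4 * a_max^2)\<close> as the rate \<alpha> in the exponent. Together they produce
  \<open>a_one\<close>. Second, the growth condition is a convergence threshold. With
  \<open>\<mu> = Re \<zeta> - omega_b B\<close>, the maximum of
  \<open>\<eta> r - \<alpha> r^2 / t\<close> over r is \<open>\<eta>^2 t / (4 \<alpha>)\<close>,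
  which the decay \<open>exp (- \<mu> t)\<close> beats when
  \<open>\<eta>^2 < 4 \<alpha> \<mu>\<close>; the hypothesis reads
  \<open>\<eta>^2 \<le> \<delta> * 4 \<alpha> \<mu>\<close> with \<delta> < 1. For \<delta> > 1/2
  the point \<open>- \<delta> / (1 - \<delta>)\<close> lies outside the unit disc, so the stated
  constants have to be reached by continuation from a series that converges at \<delta>.\<close>

unbundle no fps_syntax

section \<open>Gauss hypergeometric function\<close>

text \<open>This expands x^m / (1 - x)^(m + 1). Multiplying by \<open>1 - fps_X\<close> cancels one
  factor \<open>J\<close>, and the resulting recursion for the coefficients is Pascal's
  rule.\<close>

lemma fps_geometric_power_nth:
  fixes X :: "'a::field fps"
  defines "J \<equiv> inverse (1 - fps_X :: 'a fps)"
  shows "fps_nth (J * (fps_X * J) ^ m) n = of_nat (n choose m)"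
proof -
  have J: "J * (1 - fps_X) = 1"
    unfolding J_def by (rule inverse_mult_eq_1) simp
  have J1: "fps_nth J n = 1" for n
  proof (induction n)
    case (Suc n)
    have "fps_nth (J * (1 - fps_X)) (Suc n) = 0" unfolding J by simp
    thus ?case using Suc by (simp add: algebra_simps)
  qed (simp add: J_def)
  show ?thesis
  proof (induction m arbitrary: n)
    case 0
    thus ?case by (simp add: J1)
  next
    case (Suc m)
    let ?P = "\<lambda>m. J * (fps_X * J) ^ m"
    have "?P (Suc m) * (1 - fps_X) = fps_X * ?P m * (J * (1 - fps_X))"
      by (simp add: algebra_simps)
    hence eq: "?P (Suc m) = fps_X * ?P m + fps_X * ?P (Suc m)"
      unfolding J by (simp add: algebra_simps)
    show ?case
    proof (induction n)
      case 0
      thus ?case by (simp add: fps_power_zeroth)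
    next
      case (Suc n)
      have "fps_nth (?P (Suc m)) (Suc n) = fps_nth (?P m) n + fps_nth (?P (Suc m)) n"
        by (subst eq) simp
      thus ?case using Suc.IH Suc.prems \<open>\<And>n. fps_nth (?P m) n = _\<close> by simp
    qed
  qed
qed

text \<open>\<open>- (fps_X * J)\<close> is x / (x - 1), the argument in Pfaff's transformation.
  Composing with it and multiplying by \<open>J\<close> acts on coefficients as the alternating
  binomial transform, which reduces the transformation to a finite sum identity.\<close>

lemma fps_geometric_mult_compose_nth:
  fixes G :: "'a::field fps"
  defines "J \<equiv> inverse (1 - fps_X :: 'a fps)"
  shows "fps_nth (J * (G oo (- (fps_X * J)))) n = (\<Sum>m=0..n. fps_nth G m * (-1) ^ m * of_nat (n choose m))"
proof -
  let ?B = "- (fps_X * J)"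
  have B0: "fps_nth ?B 0 = 0" by simp
  have sub: "fps_nth (?B ^ m) j = 0" if "j < m" for m j
    by (rule startsby_zero_power_prefix[OF B0, rule_format]) (use that in simp)
  have "fps_nth (J * (G oo ?B)) n = (\<Sum>i=0..n. fps_nth J i * (\<Sum>m=0..n-i. fps_nth G m * fps_nth (?B ^ m) (n - i)))"
    by (simp add: fps_mult_nth fps_compose_nth)
  \<comment> \<open>Powers of \<open>?B\<close> start at degree \<open>m\<close>, so the inner sum
    can run up to \<open>n\<close> independently of \<open>i\<close>; only then can the two sums be
    exchanged.\<close>
  also have "\<dots> = (\<Sum>i=0..n. fps_nth J i * (\<Sum>m=0..n. fps_nth G m * fps_nth (?B ^ m) (n - i)))"
    by (intro sum.cong refl arg_cong2[of _ _ _ _ "(*)"] sum.mono_neutral_left) (auto simp: sub)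
  also have "\<dots> = (\<Sum>m=0..n. fps_nth G m * (\<Sum>i=0..n. fps_nth J i * fps_nth (?B ^ m) (n - i)))"
    unfolding sum_distrib_left by (subst sum.swap) (simp add: mult_ac)
  also have "\<dots> = (\<Sum>m=0..n. fps_nth G m * fps_nth (J * ?B ^ m) n)"
    by (simp add: fps_mult_nth)
  also have "\<dots> = (\<Sum>m=0..n. fps_nth G m * (-1) ^ m * of_nat (n choose m))"
  proof (intro sum.cong refl)
    fix m
    have "J * ?B ^ m = fps_const ((-1) ^ m) * (J * (fps_X * J) ^ m)"
      by (subst power_minus) (simp add: fps_const_power [symmetric] fps_const_neg [symmetric] mult_ac del: fps_const_power fps_const_neg)
    thus "fps_nth G m * fps_nth (J * ?B ^ m) n = fps_nth G m * (-1) ^ m * of_nat (n choose m)"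
      unfolding J_def by (simp only: fps_mult_left_const_nth fps_geometric_power_nth mult.assoc)
  qed
  finally show ?thesis .
qed

text \<open>Pfaff's prefactor is (1 - x)^(-b); for b = 1 it is the geometric series
  \<open>J\<close>, so the whole identity lives in formal power series. Coefficientwise it is the
  Chu-Vandermonde sum.\<close>

lemma fps_hypergeo_pfaff_one:
  fixes a c :: complex
  assumes c: "\<And>i. c \<noteq> - of_nat i"
  defines "J \<equiv> inverse (1 - fps_X :: complex fps)"
  shows "J * (fps_hypergeo [c - a, 1] [c] 1 oo (- (fps_X * J))) = fps_hypergeo [a, 1] [c] 1"
proof (rule fps_ext)
  fix n
  have "fps_nth (J * (fps_hypergeo [c - a, 1] [c] 1 oo (- (fps_X * J)))) n =
     (\<Sum>m=0..n. fps_nth (fps_hypergeo [c - a, 1] [c] 1) m * (-1) ^ m * of_nat (n choose m))"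
    unfolding J_def by (rule fps_geometric_mult_compose_nth)
  also have "\<dots> = (\<Sum>m=0..n. pochhammer (c - a) m * pochhammer (- of_nat n) m /
                       (of_nat (fact m) * pochhammer c m))"
  proof (intro sum.cong refl)
    fix m assume m: "m \<in> {0..n}"
    have "of_nat (n choose m) = (of_nat n gchoose m :: complex)"
      by (simp add: binomial_gbinomial)
    also have "\<dots> = (-1) ^ m * pochhammer (- of_nat n) m / fact m"
      by (rule gbinomial_pochhammer)
    finally have "(-1) ^ m * of_nat (n choose m) = (pochhammer (- of_nat n) m / fact m :: complex)"
      by (simp flip: mult.assoc power_mult_distrib)
    thus "fps_nth (fps_hypergeo [c - a, 1] [c] 1) m * (-1) ^ m * of_nat (n choose m) =
      pochhammer (c - a) m * pochhammer (- of_nat n) m / (of_nat (fact m) * pochhammer c m)"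
      unfolding mult.assoc by (simp add: pochhammer_fact [symmetric] mult_ac)
  qed
  also have "\<dots> = pochhammer (c - (c - a)) n / pochhammer c n"
    by (rule Vandermonde_pochhammer) (use c in auto)
  also have "\<dots> = fps_nth (fps_hypergeo [a, 1] [c] 1) n"
    by (simp add: pochhammer_fact [symmetric])
  finally show "fps_nth (J * (fps_hypergeo [c - a, 1] [c] 1 oo (- (fps_X * J)))) n = \<dots>" .
qed

text \<open>The ratio test compares consecutive coefficients, so none may vanish: the condition on
  \<open>a\<close> excludes the terminating series.\<close>

lemma fps_conv_radius_hypergeo_one:
  fixes a c :: complex
  assumes c: "\<And>i. c \<noteq> - of_nat i" and a: "\<And>i. a \<noteq> - of_nat i"
  shows "fps_conv_radius (fps_hypergeo [a, 1] [c] 1) = 1"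
proof -
  have nz: "fps_nth (fps_hypergeo [a, 1] [c] 1) n \<noteq> 0" for n
    using a c by (simp add: pochhammer_eq_0_iff pochhammer_fact [symmetric])
  have eq: "fps_nth (fps_hypergeo [a, 1] [c] 1) n / fps_nth (fps_hypergeo [a, 1] [c] 1) (Suc n)
     = (c + of_nat n) / (a + of_nat n)" for n
  proof -
    have "pochhammer a n \<noteq> 0" "pochhammer c n \<noteq> 0" "a + of_nat n \<noteq> 0" "c + of_nat n \<noteq> 0"
      using a c by (auto simp: pochhammer_eq_0_iff add_eq_0_iff2)
    moreover have "pochhammer (1::complex) n = fact n" "pochhammer (1::complex) (Suc n) = fact (Suc n)"
      by (simp_all only: pochhammer_fact)
    moreover have "fact (Suc n) \<noteq> (0::complex)" by (rule fact_nonzero)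
    ultimately show ?thesis
      by (simp add: pochhammer_Suc del: fact_Suc)
  qed
  have "(\<lambda>n. (c + of_nat n) / (a + of_nat n)) \<longlonglongrightarrow> 1"
  proof -
    have "(\<lambda>n. 1 + (c - a) / (of_nat n + a)) \<longlonglongrightarrow> 1 + 0"
      by (intro tendsto_add tendsto_const tendsto_divide_0[OF tendsto_const]
            tendsto_add_filterlim_at_infinity'[OF tendsto_of_nat tendsto_const])
    also have "(\<lambda>n. 1 + (c - a) / (of_nat n + a)) = (\<lambda>n. (c + of_nat n) / (a + of_nat n))"
      using a by (auto simp: fun_eq_iff divide_simps add_eq_0_iff) (simp add: algebra_simps)
    finally show ?thesis by simp
  qed
  hence "(\<lambda>n. norm ((c + of_nat n) / (a + of_nat n))) \<longlonglongrightarrow> norm (1::complex)"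
    by (rule tendsto_norm)
  hence "(\<lambda>n. norm (fps_nth (fps_hypergeo [a, 1] [c] 1) n) / norm (fps_nth (fps_hypergeo [a, 1] [c] 1) (Suc n))) \<longlonglongrightarrow> 1"
    unfolding norm_divide [symmetric] eq by simp
  thus ?thesis unfolding fps_conv_radius_def
    by (intro conv_radius_ratio_limit_nonzero) (use nz in auto)
qed

text \<open>The transformed side of Pfaff's formula is itself an admissible continuation: |w| < |1 -
  w| holds exactly on \<open>Re w < 1/2\<close>, an open convex half-plane that contains 0 and the
  whole negative axis. At w = - \<delta> / (1 - \<delta>) the argument - w / (1 - w) becomes
  \<delta>.\<close>

lemma hypergeo_2F1_one_pfaff:
  fixes a c :: complex and \<delta> :: real
  assumes c: "\<And>i. c \<noteq> - of_nat i" and a: "\<And>i. c - a \<noteq> - of_nat i"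
    and \<delta>: "0 \<le> \<delta>" "\<delta> < 1"
  shows "hypergeo_2F1 a 1 c (of_real (- (\<delta> / (1 - \<delta>))))
    = of_real (1 - \<delta>) * eval_fps (fps_hypergeo [c - a, 1] [c] 1) (of_real \<delta>)"
proof -
  let ?G = "fps_hypergeo [c - a, 1] [c] 1" and ?U = "{w. Re w < 1/2}"
  let ?J = "inverse (1 - fps_X :: complex fps)"
  define f where "f = (\<lambda>w. inverse (1 - w) * eval_fps ?G (- (w * inverse (1 - w))))"
  have rad: "fps_conv_radius ?G = 1"
    by (rule fps_conv_radius_hypergeo_one) (use a c in auto)
  have less: "cmod w < cmod (1 - w)" if "Re w < 1/2" for w
  proof -
    have "(cmod w)\<^sup>2 < (cmod (1 - w))\<^sup>2"
      using that unfolding cmod_power2 by (simp add: power2_eq_square algebra_simps)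
    thus ?thesis by (rule power2_less_imp_less) simp
  qed
  have "hypergeo_continuation a 1 c ?U f"
    unfolding hypergeo_continuation_def
  proof (intro conjI ballI)
    show "open ?U" by (rule open_halfspace_Re_lt)
    show "f holomorphic_on ?U"
      unfolding f_def
    proof (intro holomorphic_intros holomorphic_on_compose_gen[OF _ holomorphic_on_eval_fps, unfolded o_def])
      show "(\<lambda>w. - (w * inverse (1 - w))) ` ?U \<subseteq> eball 0 (fps_conv_radius ?G)"
      proof safe
        fix w assume "Re w < 1/2"
        hence "cmod w < cmod (1 - w)" by (rule less)
        moreover have "1 - w \<noteq> 0" using calculation by auto
        ultimately have "cmod (- (w * inverse (1 - w))) < 1"
          by (simp add: norm_mult norm_divide field_simps)
        thus "- (w * inverse (1 - w)) \<in> eball 0 (fps_conv_radius ?G)"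
          unfolding rad by (simp add: in_eball_iff one_ereal_def del: norm_minus_cancel norm_mult)
      qed
    qed auto
    show "closed_segment 0 z \<subseteq> ?U" if "z \<in> ?U" for z
      by (rule closed_segment_subset[OF _ that convex_halfspace_Re_lt]) simp
    have "f has_fps_expansion (?J * (?G oo (- (fps_X * ?J))))"
    proof -
      have J: "(\<lambda>w. inverse (1 - w)) has_fps_expansion ?J"
        by (intro has_fps_expansion_inverse has_fps_expansion_diff has_fps_expansion_1
              has_fps_expansion_fps_X) simp
      have B: "(\<lambda>w. - (w * inverse (1 - w))) has_fps_expansion (- (fps_X * ?J))"
        by (intro has_fps_expansion_minus has_fps_expansion_mult has_fps_expansion_fps_X J)
      have B0: "fps_nth (- (fps_X * ?J)) 0 = 0" by simp
      have "eval_fps ?G has_fps_expansion ?G"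
        by (rule eval_fps_has_fps_expansion) (simp add: rad)
      from has_fps_expansion_compose[OF this B B0]
      have "(\<lambda>w. eval_fps ?G (- (w * inverse (1 - w)))) has_fps_expansion (?G oo (- (fps_X * ?J)))"
        by (simp only: o_def)
      thus ?thesis
        unfolding f_def by (rule has_fps_expansion_mult[OF J])
    qed
    \<comment> \<open>The formal identity makes \<open>f\<close> agree with the Gauss series near 0,
      which is all that \<open>hypergeo_continuation\<close> asks of the values of
      \<open>f\<close>.\<close>
    hence "f has_fps_expansion fps_hypergeo [a, 1] [c] 1"
      by (simp only: fps_hypergeo_pfaff_one[OF c])
    thus "\<forall>\<^sub>F z in nhds 0. f z = eval_fps (fps_hypergeo [a, 1] [c] 1) z"
      unfolding has_fps_expansion_def by (auto elim: eventually_mono)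
  qed auto
  hence "hypergeo_2F1 a 1 c (of_real (- (\<delta> / (1 - \<delta>)))) = f (of_real (- (\<delta> / (1 - \<delta>))))"
  proof (rule hypergeo_2F1_eqI)
    have *: "of_real r \<in> ?U" if "r \<le> 0" for r
      using that by simp
    show "of_real (- (\<delta> / (1 - \<delta>))) \<in> ?U" by (rule *) (use \<delta> in simp)
  qed
  also have "\<dots> = of_real (1 - \<delta>) * eval_fps ?G (of_real \<delta>)"
  proof -
    have "inverse (1 - - (\<delta> / (1 - \<delta>))) = 1 - \<delta>"
      using \<delta> by (simp add: field_simps)
    moreover have "inverse (1 - of_real r) = (of_real (inverse (1 - r)) :: complex)" for r
      by simp
    ultimately have *: "inverse (1 - of_real (- (\<delta> / (1 - \<delta>)))) = (of_real (1 - \<delta>) :: complex)"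
      by metis
    have "- (of_real (- (\<delta> / (1 - \<delta>))) * of_real (1 - \<delta>)) = (of_real (- (- (\<delta> / (1 - \<delta>)) * (1 - \<delta>))) :: complex)"
      by (simp only: of_real_mult of_real_minus)
    also have "- (- (\<delta> / (1 - \<delta>)) * (1 - \<delta>)) = \<delta>" using \<delta> by (simp add: field_simps)
    finally show ?thesis unfolding f_def * by simp
  qed
  finally show ?thesis .
qed

text \<open>When the second and third parameters agree they cancel and the Gauss series is the
  binomial series. On \<open>Re w < 1\<close> the base \<open>1 - w\<close> stays in the right
  half-plane, away from the cut of the principal power.\<close>

lemma hypergeo_2F1_cancel:
  fixes a b :: complex and x :: real
  assumes b: "\<And>i. b \<noteq> - of_nat i" and x: "x < 1"
  shows "hypergeo_2F1 a b b (of_real x) = (1 - of_real x) powr (- a)"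
proof -
  let ?U = "{w. Re w < 1}"
  have "hypergeo_continuation a b b ?U (\<lambda>w. (1 - w) powr (- a))"
    unfolding hypergeo_continuation_def
  proof (intro conjI ballI)
    show "open ?U" by (rule open_halfspace_Re_lt)
    show "(\<lambda>w. (1 - w) powr (- a)) holomorphic_on ?U"
      by (intro holomorphic_intros) (auto simp: complex_nonpos_Reals_iff)
    show "closed_segment 0 z \<subseteq> ?U" if "z \<in> ?U" for z
      by (rule closed_segment_subset[OF _ that convex_halfspace_Re_lt]) simp
    have "\<forall>\<^sub>F z in nhds 0. cmod z < 1"
      by (auto simp: eventually_nhds_metric dist_norm intro!: exI[of _ 1])
    thus "\<forall>\<^sub>F z in nhds 0. (1 - z) powr - a = eval_fps (fps_hypergeo [a, b] [b] 1) z"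
    proof eventually_elim
      case (elim z)
      have "eval_fps (fps_hypergeo [a, b] [b] 1) z = (\<Sum>n. ((- a) gchoose n) * (- z) ^ n)"
        unfolding eval_fps_def
      proof (intro suminf_cong)
        fix n
        have "pochhammer b n \<noteq> 0" using b by (simp add: pochhammer_eq_0_iff)
        hence "fps_nth (fps_hypergeo [a, b] [b] 1) n * z ^ n = pochhammer a n / fact n * (((-1) * (-1)) ^ n * z ^ n)"
          by simp
        also have "\<dots> = ((- a) gchoose n) * (- z) ^ n"
          unfolding gbinomial_pochhammer power_minus[of z] power_mult_distrib by simp
        finally show "fps_nth (fps_hypergeo [a, b] [b] 1) n * z ^ n = ((- a) gchoose n) * (- z) ^ n" .
      qed
      also have "\<dots> = (1 + (- z)) powr (- a)"
        using gen_binomial_complex[of "- z" "- a"] elim by (simp add: sums_iff)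
      finally show ?case by simp
    qed
  qed auto
  hence "hypergeo_2F1 a b b (of_real x) = (1 - of_real x) powr (- a)"
    by (rule hypergeo_2F1_eqI) (use x in simp)
  thus ?thesis .
qed

lemma complex_of_real_neq_neg_of_nat:
  assumes "x > 0"
  shows "complex_of_real x \<noteq> - of_nat i"
proof
  assume "complex_of_real x = - of_nat i"
  hence "Re (complex_of_real x) = Re (- of_nat i)" by (rule arg_cong)
  thus False using assms by simp
qed

lemma hypergeo_real_cancel:
  assumes "b > 0" "x < 1"
  shows "hypergeo_real a b b x = (1 - x) powr (- a)"
proof -
  have "complex_of_real b \<noteq> - of_nat i" for i
    using assms(1) by (rule complex_of_real_neq_neg_of_nat)
  hence "hypergeo_2F1 (of_real a) (of_real b) (of_real b) (of_real x) = (1 - of_real x) powr (- of_real a)"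
    using assms(2) by (rule hypergeo_2F1_cancel)
  also have "\<dots> = of_real ((1 - x) powr (- a))"
    using assms(2) by (simp flip: powr_of_real)
  finally show ?thesis unfolding hypergeo_real_def by simp
qed

text \<open>With second parameter 1, Pfaff's transformation moves the argument back inside the disc,
  so a value occurring in the constants becomes a plain sum of Pochhammer quotients at \<delta>,
  with \<open>c - a\<close> in place of \<open>a\<close>.\<close>

lemma hypergeo_real_one_sums:
  assumes "c > 0" "c - a > 0" "0 \<le> \<delta>" "\<delta> < 1"
  shows "(\<lambda>n. pochhammer (c - a) n / pochhammer c n * \<delta> ^ n) sums
           (1 / (1 - \<delta>) * hypergeo_real a 1 c (- (\<delta> / (1 - \<delta>))))"
proof -
  let ?G = "fps_hypergeo [complex_of_real (c - a), 1] [of_real c] 1"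
  have "fps_conv_radius ?G = 1"
    by (rule fps_conv_radius_hypergeo_one) (use complex_of_real_neq_neg_of_nat[of c] complex_of_real_neq_neg_of_nat[of "c - a"] assms in auto)
  hence "(\<lambda>n. fps_nth ?G n * of_real \<delta> ^ n) sums eval_fps ?G (of_real \<delta>)"
    using assms by (intro sums_eval_fps) (simp add: one_ereal_def)
  also have "(\<lambda>n. fps_nth ?G n * of_real \<delta> ^ n) = (\<lambda>n. of_real (pochhammer (c - a) n / pochhammer c n * \<delta> ^ n))"
    by (rule ext) (simp add: pochhammer_of_real pochhammer_fact [symmetric] del: of_real_diff)
  finally have 1: "(\<lambda>n. pochhammer (c - a) n / pochhammer c n * \<delta> ^ n) sums Re (eval_fps ?G (of_real \<delta>))"
    by (metis (no_types, lifting) Re_complex_of_real sums_Re sums_cong)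
  have "hypergeo_2F1 (of_real a) 1 (of_real c) (of_real (- (\<delta> / (1 - \<delta>))))
      = of_real (1 - \<delta>) * eval_fps ?G (of_real \<delta>)"
    unfolding of_real_diff[of c a]
    by (rule hypergeo_2F1_one_pfaff) (use assms complex_of_real_neq_neg_of_nat[of c] complex_of_real_neq_neg_of_nat[of "c - a"] in auto)
  hence "hypergeo_real a 1 c (- (\<delta> / (1 - \<delta>))) = (1 - \<delta>) * Re (eval_fps ?G (of_real \<delta>))"
    by (simp only: hypergeo_real_def of_real_1) simp
  hence "1 / (1 - \<delta>) * hypergeo_real a 1 c (- (\<delta> / (1 - \<delta>))) = Re (eval_fps ?G (of_real \<delta>))"
    using assms by simp
  thus ?thesis using 1 by simp
qed

lemma pochhammer_binomial_sums:
  assumes "0 \<le> \<delta>" "\<delta> < (1::real)"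
  shows "(\<lambda>n. pochhammer p n / fact n * \<delta> ^ n) sums (1 - \<delta>) powr (- p)"
proof -
  have "(\<lambda>n. ((- p) gchoose n) * (- \<delta>) ^ n) sums (1 + (- \<delta>)) powr (- p)"
    by (rule gen_binomial_real) (use assms in auto)
  moreover have "((- p) gchoose n) * (- \<delta>) ^ n = pochhammer p n / fact n * \<delta> ^ n" for n
  proof -
    have "((- p) gchoose n) * (- \<delta>) ^ n = pochhammer p n / fact n * (((-1) * (-1)) ^ n * \<delta> ^ n)"
      unfolding gbinomial_pochhammer power_minus[of \<delta>] power_mult_distrib by simp
    thus ?thesis by simp
  qed
  ultimately show ?thesis by simp
qed

section \<open>Gamma values at half-integer steps and the two series at
  \<open>2 * sqrt \<delta>\<close>\<close>

lemma fact_odd_pochhammer: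
  "fact (2 * j + 1) = (4 ^ j * pochhammer (3/2) j * fact j :: real)"
proof -
  have "pochhammer (1/2 + 1) j * (1/2) = (pochhammer (1/2) j * (1/2 + of_nat j) :: real)"
    using pochhammer_rec[of "1/2::real" j] pochhammer_Suc[of "1/2::real" j] by (simp add: mult_ac)
  hence "pochhammer (3/2) j = pochhammer (1/2) j * (2 * real j + 1)"
    by (simp add: field_simps)
  moreover have "fact (2 * j) = (4 ^ j * pochhammer (1/2) j * fact j :: real)"
    using fact_double[of j, where ?'a = real] by (simp add: power_mult)
  ultimately show ?thesis by simp
qed

lemma sums_even_odd:
  fixes f :: "nat \<Rightarrow> real"
  assumes "(\<lambda>j. f (2 * j)) sums x" "(\<lambda>j. f (2 * j + 1)) sums y"
  shows "f sums (x + y)"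
proof -
  have "(\<lambda>n. if even n then f (2 * (n div 2)) else f (2 * ((n - 1) div 2) + 1)) sums (y + x)"
    by (rule sums_if[OF assms(2,1)])
  also have "(\<lambda>n. if even n then f (2 * (n div 2)) else f (2 * ((n - 1) div 2) + 1)) = f"
    by (rule ext) auto
  finally show ?thesis by (simp add: add.commute)
qed

lemma Gamma_shift_pochhammer:
  assumes "x > 0"
  shows "Gamma (x + real j) = pochhammer x j * Gamma x"
proof -
  have "x \<notin> \<int>\<^sub>\<le>\<^sub>0" using assms nonpos_Ints_nonpos[of x] by auto
  hence "pochhammer x j = Gamma (x + real j) / Gamma x" by (rule pochhammer_Gamma)
  thus ?thesis using Gamma_real_pos[OF assms] by simp
qed

lemma Gamma_three_halves_shift: "Gamma (real j + 3/2) = pochhammer (3/2) j * sqrt pi / 2"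
proof -
  have "Gamma (3/2 :: real) = sqrt pi / 2"
    using Gamma_plus1[of "1/2::real"] nonpos_Ints_nonpos[of "1/2::real"]
    by (force simp: Gamma_one_half_real)
  thus ?thesis using Gamma_shift_pochhammer[of "3/2" j] by (simp add: add.commute)
qed

lemma Gamma_one_half_shift: "Gamma (real j + 1/2) = pochhammer (1/2) j * sqrt pi"
  using Gamma_shift_pochhammer[of "1/2" j] by (simp add: add.commute Gamma_one_half_real)

lemma sums_eqI: "(\<And>j. f j = g j) \<Longrightarrow> g sums x \<Longrightarrow> x = y \<Longrightarrow> f sums y"
  by (simp add: sums_def)

text \<open>The terms come from expanding \<open>exp (\<eta> * norm \<psi>)\<close> with \<eta> at
  its largest admissible value. In the even part \<open>(2j)!\<close> leaves
  \<open>pochhammer (1/2) j\<close> in the denominator, a Gauss series with upper parameter 1. In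
  the odd part \<open>Gamma (j + 3/2)\<close> cancels the factor \<open>pochhammer (3/2) j\<close>
  of \<open>(2j+1)!\<close>, and a binomial series remains, which the constant writes as a 2F1 with
  two equal parameters 3/2.\<close>

lemma gamma_series_C7:
  fixes d :: nat
  assumes d: "d > 0" and \<delta>: "0 < \<delta>" "\<delta> < 1"
  shows "(\<lambda>k. (2 * sqrt \<delta>) ^ k / fact k * Gamma ((real d + real k) / 2) * Gamma (real k / 2 + 1) / Gamma (real d / 2)) sums
    (1 / (1 - \<delta>) *
     (hypergeo_real (- ((real d - 1) / 2)) 1 (1/2) (- (\<delta> / (1 - \<delta>)))
      + pi powr (1/2) * (Gamma ((real d + 1) / 2) / Gamma (real d / 2)) * (\<delta> / (1 - \<delta>)) powr (1/2)
        * hypergeo_real (- ((real d - 2) / 2)) (3/2) (3/2) (- (\<delta> / (1 - \<delta>)))))"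
    (is "?f sums (1 / (1 - \<delta>) * (?h1 + ?q * ?h2))")
proof -
  have G: "Gamma (real d / 2) > 0" using d by simp
  have "(\<lambda>j. ?f (2 * j)) sums (1 / (1 - \<delta>) * ?h1)"
  proof -
    have "?f (2 * j) = pochhammer (real d / 2) j / pochhammer (1/2) j * \<delta> ^ j" for j
    proof -
      have 1: "(2 * sqrt \<delta>) ^ (2 * j) = 4 ^ j * \<delta> ^ j"
        using \<delta> by (simp add: power_mult power_mult_distrib)
      have 2: "Gamma ((real d + real (2 * j)) / 2) = pochhammer (real d / 2) j * Gamma (real d / 2)"
        using Gamma_shift_pochhammer[of "real d / 2" j] d by (simp add: add_divide_distrib)
      have 3: "Gamma (real (2 * j) / 2 + 1) = fact j"
        using Gamma_fact[of j, where ?'a = real] by (simp add: add.commute)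
      have 4: "fact (2 * j) = (4 ^ j * pochhammer (1/2) j * fact j :: real)"
        using fact_double[of j, where ?'a = real] by (simp add: power_mult)
      show ?thesis unfolding 1 2 3 4 using G by simp
    qed
    thus ?thesis using hypergeo_real_one_sums[of "1/2" "- ((real d - 1) / 2)" \<delta>] d \<delta>
      by (simp add: field_simps)
  qed
  moreover have "(\<lambda>j. ?f (2 * j + 1)) sums (1 / (1 - \<delta>) * (?q * ?h2))"
  proof -
    let ?c = "sqrt \<delta> * sqrt pi * (Gamma ((real d + 1) / 2) / Gamma (real d / 2))"
    have "?f (2 * j + 1) = ?c * (pochhammer ((real d + 1) / 2) j / fact j * \<delta> ^ j)" for j
    proof -
      have 1: "(2 * sqrt \<delta>) ^ (2 * j + 1) = 2 * sqrt \<delta> * (4 ^ j * \<delta> ^ j)"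
        using \<delta> by (simp add: power_mult power_mult_distrib)
      have 2: "Gamma ((real d + real (2 * j + 1)) / 2) = pochhammer ((real d + 1) / 2) j * Gamma ((real d + 1) / 2)"
        using Gamma_shift_pochhammer[of "(real d + 1) / 2" j] d by (simp add: add_divide_distrib add_ac)
      have "real (2 * j + 1) / 2 + 1 = real j + 3/2" by (simp add: field_simps)
      hence 3: "Gamma (real (2 * j + 1) / 2 + 1) = pochhammer (3/2) j * sqrt pi / 2"
        by (simp only: Gamma_three_halves_shift)
      have 5: "pochhammer (3/2 :: real) j > 0" by (rule pochhammer_pos) simp
      show ?thesis unfolding 1 2 3 fact_odd_pochhammer using G 5 by (simp add: mult_ac)
    qed
    moreover have "(\<lambda>j. ?c * (pochhammer ((real d + 1) / 2) j / fact j * \<delta> ^ j)) sums (?c * (1 - \<delta>) powr (- ((real d + 1) / 2)))"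
      by (intro sums_mult pochhammer_binomial_sums) (use \<delta> in auto)
    moreover have "?c * (1 - \<delta>) powr (- ((real d + 1) / 2)) = 1 / (1 - \<delta>) * (?q * ?h2)"
    proof -
      have "?h2 = (1 - - (\<delta> / (1 - \<delta>))) powr (- (- ((real d - 2) / 2)))"
        using \<delta> by (intro hypergeo_real_cancel) (auto intro: less_le_trans[of _ 0])
      also have "1 - - (\<delta> / (1 - \<delta>)) = 1 / (1 - \<delta>)" using \<delta> by (simp add: field_simps)
      also have "(1 / (1 - \<delta>)) powr (- (- ((real d - 2) / 2))) = (1 - \<delta>) powr (- ((real d - 2) / 2))"
        using \<delta> by (simp add: powr_divide powr_minus_divide)
      finally have h2: "?h2 = (1 - \<delta>) powr (- ((real d - 2) / 2))" .
      have "1 / (1 - \<delta>) = (1 - \<delta>) powr (-1)" using \<delta> by (simp add: powr_minus_divide)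
      moreover have "(\<delta> / (1 - \<delta>)) powr (1/2) = sqrt \<delta> * (1 - \<delta>) powr (-(1/2))"
        using \<delta> by (simp add: powr_divide powr_half_sqrt powr_minus_divide)
      \<comment> \<open>The exponent splits as -1 - 1/2 - (d - 2)/2: one part each for the outer
        factor, the square root and the 2F1 value.\<close>
      moreover have "(1 - \<delta>) powr (- ((real d + 1) / 2)) =
          (1 - \<delta>) powr (-1) * (1 - \<delta>) powr (-(1/2)) * (1 - \<delta>) powr (- ((real d - 2) / 2))"
        unfolding powr_add [symmetric] by (rule arg_cong[of _ _ "\<lambda>x. (1 - \<delta>) powr x"]) (simp add: field_simps)
      ultimately show ?thesis unfolding h2 by (simp add: powr_half_sqrt mult_ac)
    qed
    ultimately show ?thesis by (rule sums_eqI)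
  qed
  ultimately have "?f sums (1 / (1 - \<delta>) * ?h1 + 1 / (1 - \<delta>) * (?q * ?h2))"
    by (rule sums_even_odd)
  thus ?thesis by (simp only: distrib_left)
qed

text \<open>The gradient carries an extra \<open>norm \<psi> / t\<close>, which shifts the two Gamma
  arguments by one half in opposite directions and exchanges the roles of the parities: now the even
  terms form the binomial series and the odd terms a Gauss series with lower parameter 3/2.\<close>

lemma gamma_series_C8:
  fixes d :: nat
  assumes d: "d > 0" and \<delta>: "0 < \<delta>" "\<delta> < 1"
  shows "(\<lambda>k. (2 * sqrt \<delta>) ^ k / fact k * Gamma ((real d + 1 + real k) / 2) * Gamma (real k / 2 + 1/2) / Gamma (real d / 2)) sums
    (Gamma (1/2) * (1 / (1 - \<delta>)) powr (1/2) *
     (Gamma ((real d + 1) / 2) / Gamma (real d / 2)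
        * hypergeo_real (- (real d / 2)) (1/2) (1/2) (- (\<delta> / (1 - \<delta>)))
      + 2 * (Gamma ((real d + 2) / 2) / (Gamma (1/2) * Gamma (real d / 2))) * (\<delta> / (1 - \<delta>)) powr (1/2)
        * hypergeo_real (- ((real d - 1) / 2)) 1 (3/2) (- (\<delta> / (1 - \<delta>)))))"
    (is "?f sums (?a * (?p * ?h1 + ?q * ?h2))")
proof -
  have G: "Gamma (real d / 2) > 0" using d by simp
  have "(\<lambda>j. ?f (2 * j)) sums (?a * (?p * ?h1))"
  proof -
    let ?c = "sqrt pi * (Gamma ((real d + 1) / 2) / Gamma (real d / 2))"
    have "?f (2 * j) = ?c * (pochhammer ((real d + 1) / 2) j / fact j * \<delta> ^ j)" for j
    proof -
      have 1: "(2 * sqrt \<delta>) ^ (2 * j) = 4 ^ j * \<delta> ^ j"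
        using \<delta> by (simp add: power_mult power_mult_distrib)
      have 2: "Gamma ((real d + 1 + real (2 * j)) / 2) = pochhammer ((real d + 1) / 2) j * Gamma ((real d + 1) / 2)"
        using Gamma_shift_pochhammer[of "(real d + 1) / 2" j] d by (simp add: add_divide_distrib add_ac)
      have "real (2 * j) / 2 + 1/2 = real j + 1/2" by simp
      hence 3: "Gamma (real (2 * j) / 2 + 1/2) = pochhammer (1/2) j * sqrt pi"
        by (simp only: Gamma_one_half_shift)
      have 4: "fact (2 * j) = (4 ^ j * pochhammer (1/2) j * fact j :: real)"
        using fact_double[of j, where ?'a = real] by (simp add: power_mult)
      have 5: "pochhammer (1/2 :: real) j > 0" by (rule pochhammer_pos) simp
      show ?thesis unfolding 1 2 3 4 using G 5 by (simp add: mult_ac)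
    qed
    moreover have "(\<lambda>j. ?c * (pochhammer ((real d + 1) / 2) j / fact j * \<delta> ^ j)) sums (?c * (1 - \<delta>) powr (- ((real d + 1) / 2)))"
      by (intro sums_mult pochhammer_binomial_sums) (use \<delta> in auto)
    moreover have "?c * (1 - \<delta>) powr (- ((real d + 1) / 2)) = ?a * (?p * ?h1)"
    proof -
      have "?h1 = (1 - - (\<delta> / (1 - \<delta>))) powr (- (- (real d / 2)))"
        using \<delta> by (intro hypergeo_real_cancel) (auto intro: less_le_trans[of _ 0])
      also have "1 - - (\<delta> / (1 - \<delta>)) = 1 / (1 - \<delta>)" using \<delta> by (simp add: field_simps)
      also have "(1 / (1 - \<delta>)) powr (- (- (real d / 2))) = (1 - \<delta>) powr (- (real d / 2))"
        using \<delta> by (simp add: powr_divide powr_minus_divide)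
      finally have h1: "?h1 = (1 - \<delta>) powr (- (real d / 2))" .
      have "(1 / (1 - \<delta>)) powr (1/2) = (1 - \<delta>) powr (-(1/2))"
        using \<delta> by (simp add: powr_divide powr_minus_divide)
      moreover have "(1 - \<delta>) powr (- ((real d + 1) / 2)) =
          (1 - \<delta>) powr (-(1/2)) * (1 - \<delta>) powr (- (real d / 2))"
        unfolding powr_add [symmetric] by (rule arg_cong[of _ _ "\<lambda>x. (1 - \<delta>) powr x"]) (simp add: field_simps)
      ultimately show ?thesis unfolding h1 by (simp add: Gamma_one_half_real mult_ac)
    qed
    ultimately show ?thesis by (rule sums_eqI)
  qed
  moreover have "(\<lambda>j. ?f (2 * j + 1)) sums (?a * (?q * ?h2))"
  proof -
    let ?c = "2 * sqrt \<delta> * (Gamma ((real d + 2) / 2) / Gamma (real d / 2))"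
    have "?f (2 * j + 1) = ?c * (pochhammer ((real d + 2) / 2) j / pochhammer (3/2) j * \<delta> ^ j)" for j
    proof -
      have 1: "(2 * sqrt \<delta>) ^ (2 * j + 1) = 2 * sqrt \<delta> * (4 ^ j * \<delta> ^ j)"
        using \<delta> by (simp add: power_mult power_mult_distrib)
      have 2: "Gamma ((real d + 1 + real (2 * j + 1)) / 2) = pochhammer ((real d + 2) / 2) j * Gamma ((real d + 2) / 2)"
        using Gamma_shift_pochhammer[of "(real d + 2) / 2" j] d by (simp add: add_divide_distrib add_ac)
      have "real (2 * j + 1) / 2 + 1/2 = 1 + real j" by (simp add: field_simps)
      hence 3: "Gamma (real (2 * j + 1) / 2 + 1/2) = fact j"
        by (simp only: Gamma_fact)
      show ?thesis unfolding 1 2 3 fact_odd_pochhammer using G by (simp add: mult_ac)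
    qed
    moreover have "(\<lambda>j. ?c * (pochhammer ((real d + 2) / 2) j / pochhammer (3/2) j * \<delta> ^ j)) sums (?c * (1 / (1 - \<delta>) * ?h2))"
      using hypergeo_real_one_sums[of "3/2" "- ((real d - 1) / 2)" \<delta>] d \<delta>
      by (intro sums_mult) (simp add: add_divide_distrib diff_divide_distrib add_ac)
    moreover have "?c * (1 / (1 - \<delta>) * ?h2) = ?a * (?q * ?h2)"
    proof -
      have *: "sqrt \<delta> * (1 / (1 - \<delta>)) = (1 / (1 - \<delta>)) powr (1/2) * (\<delta> / (1 - \<delta>)) powr (1/2)"
        using \<delta> by (simp add: powr_divide powr_half_sqrt)
      have "?c * (1 / (1 - \<delta>) * ?h2) = (sqrt \<delta> * (1 / (1 - \<delta>)))
         * (2 * (Gamma ((real d + 2) / 2) / Gamma (real d / 2)) * ?h2)"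
        by (simp only: mult_ac)
      also have "\<dots> = (1 / (1 - \<delta>)) powr (1/2) * (\<delta> / (1 - \<delta>)) powr (1/2)
         * (2 * (Gamma ((real d + 2) / 2) / Gamma (real d / 2)) * ?h2)"
        by (simp only: *)
      also have "\<dots> = ?a * (?q * ?h2)"
      proof -
        have g: "Gamma (1/2 :: real) \<noteq> 0" by (simp add: Gamma_one_half_real)
        have "u * w * (2 * (a / b) * h) = q * u * (2 * (a / (q * b)) * w * h)" if "q \<noteq> 0" for a b h q u w :: real
          using that by simp
        from this[OF g] show ?thesis .
      qed
      finally show ?thesis .
    qed
    ultimately show ?thesis by (rule sums_eqI)
  qed
  ultimately have "?f sums (?a * (?p * ?h1) + ?a * (?q * ?h2))"
    by (rule sums_even_odd)
  thus ?thesis by (simp only: distrib_left)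
qed

section \<open>Euler integrals and radial Gaussian integrals\<close>

text \<open>Stated for the non-negative integral, as are the computations that build on it: series
  and iterated integrals may then be exchanged freely, and integrability is read off from the finite
  value afterwards.\<close>

lemma nn_integral_gamma:
  assumes x: "x > (0::real)" and c: "c > 0"
  shows "(\<integral>\<^sup>+t. ennreal (indicator {0<..} t * (t powr (x - 1) * exp (- c * t))) \<partial>lborel)
    = ennreal (Gamma x * c powr (- x))"
proof -
  have "(\<integral>\<^sup>+t. ennreal (indicator {0<..} t * (t powr (x - 1) * exp (- c * t))) \<partial>lborel)
    = ennreal \<bar>1 / c\<bar> * (\<integral>\<^sup>+t. ennreal (indicator {0<..} (0 + (1 / c) * t) *
         ((0 + (1 / c) * t) powr (x - 1) * exp (- c * (0 + (1 / c) * t)))) \<partial>lborel)"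
    by (rule nn_integral_real_affine) (use c in auto)
  also have "(\<integral>\<^sup>+t. ennreal (indicator {0<..} (0 + (1 / c) * t) *
         ((0 + (1 / c) * t) powr (x - 1) * exp (- c * (0 + (1 / c) * t)))) \<partial>lborel)
    = (\<integral>\<^sup>+t. ennreal (c powr (1 - x)) * ennreal (indicator {0..} t * t powr (x - 1) / exp t) \<partial>lborel)"
  proof (intro nn_integral_cong_AE)
    have "AE t in lborel. t \<noteq> (0::real)" by (rule AE_lborel_singleton)
    thus "AE t in lborel. ennreal (indicator {0<..} (0 + (1 / c) * t) *
         ((0 + (1 / c) * t) powr (x - 1) * exp (- c * (0 + (1 / c) * t)))) =
         ennreal (c powr (1 - x)) * ennreal (indicator {0..} t * t powr (x - 1) / exp t)"
    proof eventually_elim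
      case (elim t)
      have "(t / c) powr (x - 1) = c powr (1 - x) * t powr (x - 1)" if "t > 0"
        using that c by (simp add: powr_divide) (simp add: powr_diff field_simps)
      thus ?case using elim c
        by (cases "t > 0") (auto simp: ennreal_mult' [symmetric] exp_minus field_simps zero_less_divide_iff)
    qed
  qed
  also have "\<dots> = ennreal (c powr (1 - x)) * ennreal (Gamma x)"
    by (subst nn_integral_cmult) (auto simp: Gamma_conv_nn_integral_real[OF x])
  also have "ennreal \<bar>1 / c\<bar> * \<dots> = ennreal (Gamma x * c powr (- x))"
    using c x by (simp add: ennreal_mult' [symmetric] powr_diff powr_minus field_simps)
  finally show ?thesis .
qed

text \<open>Working with the distribution of \<open>|\<psi>|\<^sup>2\<close> rather than \<open>|\<psi>|\<close> makes every radial integral below an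
  Euler integral.\<close>

lemma distr_norm_square_lborel:
  "distr lborel borel (\<lambda>(x::'a::euclidean_space). (norm x)\<^sup>2) =
   density lborel (\<lambda>\<tau>. ennreal (indicator {0<..} \<tau> *
     (pi powr (real DIM('a) / 2) / Gamma (real DIM('a) / 2) * \<tau> powr (real DIM('a) / 2 - 1))))"
  (is "?M = density lborel ?f")
proof -
  let ?d = "real DIM('a) / 2"
  have d: "?d > 0" by simp
  define c where "c = pi powr ?d / Gamma ?d"
  have c: "c > 0" unfolding c_def using d by simp
  have unit: "unit_ball_vol (DIM('a)) = c / ?d"
  proof -
    have "?d \<notin> \<int>\<^sub>\<le>\<^sub>0" using nonpos_Ints_nonpos[of ?d] by auto
    hence "Gamma (?d + 1) = ?d * Gamma ?d" by (rule Gamma_plus1)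
    thus ?thesis unfolding unit_ball_vol_def c_def by (simp only:) simp
  qed
  \<comment> \<open>Both measures are compared on half-lines, which generate the Borel sets. For the
    image measure this gives the volume of the ball of radius \<open>sqrt x\<close>, for the density
    the integral of a power of \<tau>.\<close>
  have M: "emeasure ?M {..x} = ennreal (if x < 0 then 0 else c / ?d * x powr ?d)" for x
  proof -
    have "emeasure ?M {..x} = emeasure lborel {y::'a. (norm y)\<^sup>2 \<le> x}"
      by (subst emeasure_distr) (auto intro!: arg_cong[of _ _ "emeasure lborel"])
    also have "{y::'a. (norm y)\<^sup>2 \<le> x} = (if x < 0 then {} else cball 0 (sqrt x))"
      by (auto simp: real_le_rsqrt dest: order.trans[OF zero_le_power2])
        (metis norm_ge_zero real_sqrt_le_iff real_sqrt_abs abs_of_nonneg real_sqrt_pow2_iff power_mono not_less)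
    also have "emeasure lborel \<dots> = ennreal (if x < 0 then 0 else c / ?d * x powr ?d)"
    proof (cases "x < 0")
      case False
      have "sqrt x ^ DIM('a) = x powr ?d"
      proof (cases "x = 0")
        case False
        with \<open>\<not> x < 0\<close> have "x > 0" by simp
        thus ?thesis by (simp add: powr_half_sqrt [symmetric] powr_realpow [symmetric] powr_powr)
      qed simp
      thus ?thesis using False by (simp add: emeasure_cball unit)
    qed simp
    finally show ?thesis .
  qed
  have N: "emeasure (density lborel ?f) {..x} = ennreal (if x < 0 then 0 else c / ?d * x powr ?d)" for x
  proof -
    have "emeasure (density lborel ?f) {..x} = (\<integral>\<^sup>+\<tau>. ?f \<tau> * indicator {..x} \<tau> \<partial>lborel)"
      by (subst emeasure_density) auto
    also have "\<dots> = ennreal (if x < 0 then 0 else c / ?d * x powr ?d)"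
    proof (cases "x \<le> 0")
      case True
      hence "(\<integral>\<^sup>+\<tau>. ?f \<tau> * indicator {..x} \<tau> \<partial>lborel) = (\<integral>\<^sup>+(\<tau>::real). 0 \<partial>lborel)"
        by (intro nn_integral_cong) (auto simp: indicator_def)
      thus ?thesis using True by auto
    next
      case False
      have I: "((\<lambda>\<tau>. \<tau> powr (?d - 1)) has_integral (x powr (?d - 1 + 1) / (?d - 1 + 1))) {0..x}"
        using has_integral_powr_from_0[of "?d - 1" x] False d by simp
      have "(\<integral>\<^sup>+\<tau>. ?f \<tau> * indicator {..x} \<tau> \<partial>lborel) =
            (\<integral>\<^sup>+\<tau>. ennreal c * ennreal (indicator {0..x} \<tau> * \<tau> powr (?d - 1)) \<partial>lborel)"
      proof (intro nn_integral_cong_AE)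
        have "AE t in lborel. t \<noteq> (0::real)" by (rule AE_lborel_singleton)
        thus "AE \<tau> in lborel. ?f \<tau> * indicator {..x} \<tau> = ennreal c * ennreal (indicator {0..x} \<tau> * \<tau> powr (?d - 1))"
          by eventually_elim (use c in \<open>auto simp: indicator_def c_def [symmetric] ennreal_mult'\<close>)
      qed
      also have "\<dots> = ennreal c * (\<integral>\<^sup>+\<tau>. ennreal (indicator {0..x} \<tau> * \<tau> powr (?d - 1)) \<partial>lborel)"
        by (rule nn_integral_cmult) auto
      also have "(\<integral>\<^sup>+\<tau>. ennreal (indicator {0..x} \<tau> * \<tau> powr (?d - 1)) \<partial>lborel) = ennreal (x powr ?d / ?d)"
        using nn_integral_has_integral_lebesgue[OF _ I] by simp
      finally show ?thesis using False c by (simp add: ennreal_mult' [symmetric])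
    qed
    finally show ?thesis .
  qed
  show ?thesis
  proof (rule measure_eqI_generator_eq[where E = "range (\<lambda>x. {..x})" and \<Omega> = UNIV and A = "\<lambda>i. {..real i}"])
    show "Int_stable (range (\<lambda>x::real. {..x}))"
      by (auto simp: Int_stable_def)
    show "sets ?M = sigma_sets UNIV (range (\<lambda>x. {..x}))" "sets (density lborel ?f) = sigma_sets UNIV (range (\<lambda>x. {..x}))"
      by (simp_all add: borel_eq_atMost)
    show "\<And>X. X \<in> range (\<lambda>x. {..x}) \<Longrightarrow> emeasure ?M X = emeasure (density lborel ?f) X"
      using M N by auto
    show "(\<Union>i. {..real i}) = UNIV" by (auto intro: real_arch_simple)
    show "\<And>i. emeasure ?M {..real i} \<noteq> \<infinity>" by (simp add: M)
  qed auto
qed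

lemma nn_integral_norm_square:
  fixes f :: "real \<Rightarrow> ennreal"
  assumes [measurable]: "f \<in> borel_measurable borel"
  shows "(\<integral>\<^sup>+ (x::'a::euclidean_space). f ((norm x)\<^sup>2) \<partial>lborel) =
    (\<integral>\<^sup>+\<tau>. ennreal (indicator {0<..} \<tau> * (pi powr (real DIM('a) / 2) / Gamma (real DIM('a) / 2) * \<tau> powr (real DIM('a) / 2 - 1))) * f \<tau> \<partial>lborel)"
proof -
  have "(\<integral>\<^sup>+ (x::'a). f ((norm x)\<^sup>2) \<partial>lborel) = (\<integral>\<^sup>+\<tau>. f \<tau> \<partial>distr lborel borel (\<lambda>(x::'a). (norm x)\<^sup>2))"
    by (subst nn_integral_distr) auto
  thus ?thesis unfolding distr_norm_square_lborel by (subst (asm) nn_integral_density) auto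
qed

lemma nn_integral_norm_powr_gaussian:
  assumes c: "c > 0"
  shows "(\<integral>\<^sup>+ (x::'a::euclidean_space). ennreal (norm x ^ k * exp (- c * (norm x)\<^sup>2)) \<partial>lborel) =
    ennreal (pi powr (real DIM('a) / 2) / Gamma (real DIM('a) / 2) * Gamma ((real DIM('a) + real k) / 2) * c powr (- ((real DIM('a) + real k) / 2)))"
proof -
  let ?d = "real DIM('a) / 2"
  have d: "?d > 0" by simp
  let ?c = "pi powr ?d / Gamma ?d"
  have "(\<integral>\<^sup>+ (x::'a::euclidean_space). ennreal (norm x ^ k * exp (- c * (norm x)\<^sup>2)) \<partial>lborel) =
        (\<integral>\<^sup>+ (x::'a::euclidean_space). ennreal (sqrt ((norm x)\<^sup>2) ^ k * exp (- c * (norm x)\<^sup>2)) \<partial>lborel)"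
    by simp
  also have "\<dots> = (\<integral>\<^sup>+\<tau>. ennreal (indicator {0<..} \<tau> * (?c * \<tau> powr (?d - 1))) * ennreal (sqrt \<tau> ^ k * exp (- c * \<tau>)) \<partial>lborel)"
    by (rule nn_integral_norm_square) simp
  also have "\<dots> = (\<integral>\<^sup>+\<tau>. ennreal ?c * ennreal (indicator {0<..} \<tau> * (\<tau> powr ((real DIM('a) + real k) / 2 - 1) * exp (- c * \<tau>))) \<partial>lborel)"
  proof (intro nn_integral_cong)
    fix \<tau> :: real
    show "ennreal (indicator {0<..} \<tau> * (?c * \<tau> powr (?d - 1))) * ennreal (sqrt \<tau> ^ k * exp (- c * \<tau>)) =
      ennreal ?c * ennreal (indicator {0<..} \<tau> * (\<tau> powr ((real DIM('a) + real k) / 2 - 1) * exp (- c * \<tau>)))"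
    proof (cases "\<tau> > 0")
      case True
      have "sqrt \<tau> ^ k = \<tau> powr (real k / 2)"
        using True by (simp add: powr_half_sqrt [symmetric] powr_realpow [symmetric] powr_powr)
      moreover have "\<tau> powr ((real DIM('a) + real k) / 2 - 1) = \<tau> powr (?d - 1) * \<tau> powr (real k / 2)"
        unfolding powr_add [symmetric] by (simp add: field_simps)
      ultimately show ?thesis using True d
        by (simp add: ennreal_mult' [symmetric] mult_ac)
    qed simp
  qed
  also have "\<dots> = ennreal ?c * (\<integral>\<^sup>+\<tau>. ennreal (indicator {0<..} \<tau> * (\<tau> powr ((real DIM('a) + real k) / 2 - 1) * exp (- c * \<tau>))) \<partial>lborel)"
    by (rule nn_integral_cmult) simp
  also have "\<dots> = ennreal ?c * ennreal (Gamma ((real DIM('a) + real k) / 2) * c powr (- ((real DIM('a) + real k) / 2)))"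
    by (subst nn_integral_gamma) (use c in \<open>auto simp: add_pos_nonneg\<close>)
  also have "\<dots> = ennreal (?c * Gamma ((real DIM('a) + real k) / 2) * c powr (- ((real DIM('a) + real k) / 2)))"
    by (simp add: ennreal_mult' [symmetric] mult_ac)
  finally show ?thesis .
qed

lemma ennreal_exp_suminf:
  assumes "x \<ge> 0"
  shows "ennreal (exp x) = (\<Sum>k. ennreal (x ^ k / fact k))"
proof -
  have "(\<lambda>k. x ^ k / fact k) sums exp x"
    using exp_converges[of x] by (simp add: field_simps)
  thus ?thesis using assms by (subst suminf_ennreal_eq) auto
qed

text \<open>\<open>m = 0\<close> serves the resolvent kernel and \<open>m = 1\<close> its gradient.
  After expanding the exponential of \<open>\<eta> * norm \<psi>\<close>, each term is a Gaussian
  moment in \<psi> followed by an Euler integral in \<open>t\<close>.\<close>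

lemma nn_integral_gaussian_exp_norm:
  fixes m :: nat and \<eta> \<alpha> \<mu> :: real
  assumes m: "m \<le> 1" and pos: "\<alpha> > 0" "\<mu> > 0" "\<eta> \<ge> 0"
  defines "d \<equiv> real DIM('a::euclidean_space)"
  shows "(\<integral>\<^sup>+t. \<integral>\<^sup>+(\<psi>::'a). ennreal (indicator {0<..} t * (exp (- \<mu> * t) * t powr (- d / 2 - m) *
            norm \<psi> ^ m * exp (- \<alpha> * (norm \<psi>)\<^sup>2 / t + \<eta> * norm \<psi>))) \<partial>lborel \<partial>lborel) =
         (\<Sum>k. ennreal (pi powr (d / 2) * (\<eta> ^ k / fact k * Gamma ((d + m + k) / 2) * \<alpha> powr (- ((d + m + k) / 2)) *
            Gamma (1 + (real k - m) / 2) * \<mu> powr (- (1 + (real k - m) / 2)) / Gamma (d / 2))))"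
  (is "?L = (\<Sum>k. ennreal (?R k))")
proof -
  have d: "d > 0" unfolding d_def by simp
  let ?c = "\<lambda>k. pi powr (d / 2) / Gamma (d / 2) * (\<eta> ^ k / fact k * Gamma ((d + m + k) / 2) * \<alpha> powr (- ((d + m + k) / 2)))"
  have G: "Gamma (d / 2) > 0" "Gamma ((d + real m + real k) / 2) > 0" for k
    using d by (auto intro!: Gamma_real_pos simp: add_pos_nonneg)
  have c: "?c k \<ge> 0" for k
    using G pos by (intro mult_nonneg_nonneg divide_nonneg_nonneg zero_le_power) (auto simp: less_imp_le)
  have inner: "(\<integral>\<^sup>+(\<psi>::'a). ennreal (indicator {0<..} t * (exp (- \<mu> * t) * t powr (- d / 2 - m) *
            norm \<psi> ^ m * exp (- \<alpha> * (norm \<psi>)\<^sup>2 / t + \<eta> * norm \<psi>))) \<partial>lborel) =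
       (\<Sum>k. ennreal (?c k) * ennreal (indicator {0<..} t * (t powr (1 + (real k - m) / 2 - 1) * exp (- \<mu> * t))))" for t
  proof (cases "t > 0")
    case t: True
    let ?w = "exp (- \<mu> * t) * t powr (- d / 2 - m)"
    have "(\<integral>\<^sup>+(\<psi>::'a). ennreal (indicator {0<..} t * (?w *
            norm \<psi> ^ m * exp (- \<alpha> * (norm \<psi>)\<^sup>2 / t + \<eta> * norm \<psi>))) \<partial>lborel) =
          (\<integral>\<^sup>+(\<psi>::'a). (\<Sum>k. ennreal (?w * (\<eta> ^ k / fact k)) * ennreal (norm \<psi> ^ (m + k) * exp (- (\<alpha> / t) * (norm \<psi>)\<^sup>2))) \<partial>lborel)"
    proof (intro nn_integral_cong)
      fix \<psi> :: 'a
      have "ennreal (indicator {0<..} t * (?w * norm \<psi> ^ m * exp (- \<alpha> * (norm \<psi>)\<^sup>2 / t + \<eta> * norm \<psi>))) =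
            ennreal (?w * norm \<psi> ^ m * exp (- (\<alpha> / t) * (norm \<psi>)\<^sup>2)) * ennreal (exp (\<eta> * norm \<psi>))"
        using t by (simp add: ennreal_mult' [symmetric] exp_add [symmetric] mult_ac)
      also have "\<dots> = (\<Sum>k. ennreal (?w * norm \<psi> ^ m * exp (- (\<alpha> / t) * (norm \<psi>)\<^sup>2)) * ennreal ((\<eta> * norm \<psi>) ^ k / fact k))"
        using pos by (subst ennreal_exp_suminf) auto
      also have "\<dots> = (\<Sum>k. ennreal (?w * (\<eta> ^ k / fact k)) * ennreal (norm \<psi> ^ (m + k) * exp (- (\<alpha> / t) * (norm \<psi>)\<^sup>2)))"
        using pos by (intro suminf_cong) (simp add: ennreal_mult' [symmetric] power_add power_mult_distrib mult_ac)
      finally show "ennreal (indicator {0<..} t * (?w * norm \<psi> ^ m * exp (- \<alpha> * (norm \<psi>)\<^sup>2 / t + \<eta> * norm \<psi>))) = \<dots>" .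
    qed
    also have "\<dots> = (\<Sum>k. ennreal (?w * (\<eta> ^ k / fact k)) * (\<integral>\<^sup>+(\<psi>::'a). ennreal (norm \<psi> ^ (m + k) * exp (- (\<alpha> / t) * (norm \<psi>)\<^sup>2)) \<partial>lborel))"
      by (subst nn_integral_suminf) (auto simp: nn_integral_cmult)
    also have "\<dots> = (\<Sum>k. ennreal (?c k) * ennreal (indicator {0<..} t * (t powr (1 + (real k - m) / 2 - 1) * exp (- \<mu> * t))))"
    proof (intro suminf_cong)
      fix k :: nat
      let ?e = "(d + m + k) / 2"
      have "(\<alpha> / t) powr (- ?e) = \<alpha> powr (- ?e) * t powr ?e"
        using pos t by (simp add: powr_divide powr_minus field_simps)
      moreover have "t powr (1 + (real k - m) / 2 - 1) = t powr (- d / 2 - m) * t powr ?e"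
        unfolding powr_add [symmetric] by (rule arg_cong[of _ _ "\<lambda>x. t powr x"]) (simp add: field_simps)
      moreover have "(\<integral>\<^sup>+(\<psi>::'a). ennreal (norm \<psi> ^ (m + k) * exp (- (\<alpha> / t) * (norm \<psi>)\<^sup>2)) \<partial>lborel)
          = ennreal (pi powr (d / 2) / Gamma (d / 2) * Gamma ?e * (\<alpha> / t) powr (- ?e))"
        using nn_integral_norm_powr_gaussian[of "\<alpha> / t" "m + k", where ?'a = 'a] pos t
        by (simp add: d_def add_ac)
      ultimately show "ennreal (?w * (\<eta> ^ k / fact k)) * (\<integral>\<^sup>+(\<psi>::'a). ennreal (norm \<psi> ^ (m + k) * exp (- (\<alpha> / t) * (norm \<psi>)\<^sup>2)) \<partial>lborel) =
        ennreal (?c k) * ennreal (indicator {0<..} t * (t powr (1 + (real k - m) / 2 - 1) * exp (- \<mu> * t)))"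
        using t c[of k] pos by (simp add: ennreal_mult' [symmetric] mult_ac)
    qed
    finally show ?thesis .
  qed simp
  have "?L = (\<integral>\<^sup>+t. (\<Sum>k. ennreal (?c k) * ennreal (indicator {0<..} t * (t powr (1 + (real k - m) / 2 - 1) * exp (- \<mu> * t)))) \<partial>lborel)"
    unfolding inner ..
  also have "\<dots> = (\<Sum>k. ennreal (?c k) * (\<integral>\<^sup>+t. ennreal (indicator {0<..} t * (t powr (1 + (real k - m) / 2 - 1) * exp (- \<mu> * t))) \<partial>lborel))"
    by (subst nn_integral_suminf) (auto simp: nn_integral_cmult)
  also have "\<dots> = (\<Sum>k. ennreal (?R k))"
  proof (intro suminf_cong)
    fix k :: nat
    \<comment> \<open>The critical case is \<open>k = 0\<close>, \<open>m = 1\<close>, where the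
      exponent is 1/2. With \<open>m = 2\<close> the time integral of the first term would diverge
      at 0.\<close>
    have p: "1 + (real k - m) / 2 > 0" using m by (simp add: field_simps)
    show "ennreal (?c k) * (\<integral>\<^sup>+t. ennreal (indicator {0<..} t * (t powr (1 + (real k - m) / 2 - 1) * exp (- \<mu> * t))) \<partial>lborel) = ennreal (?R k)"
      unfolding nn_integral_gamma[OF p pos(2)] ennreal_mult'[OF c, symmetric]
      by (rule arg_cong[of _ _ ennreal]) (simp add: mult_ac)
  qed
  finally show ?thesis .
qed

text \<open>Replacing \<eta> by its extreme value cancels the powers \<alpha>^(-k/2) and
  \<mu>^(-k/2) in the \<open>k\<close>-th term. What is left of \<alpha> and \<mu> is one common
  prefactor, and \<open>F\<close> depends on \<delta>, \<open>m\<close> and the dimension alone;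
  this is why the final constants do not involve the resolvent parameter.\<close>

lemma nn_integral_gaussian_exp_norm_le:
  fixes m :: nat and \<eta> \<alpha> \<mu> \<delta> F d :: real
  assumes m: "m \<le> 1" and pos: "\<alpha> > 0" "\<mu> > 0" "\<eta> \<ge> 0"
    and \<eta>: "\<eta> \<le> 2 * sqrt \<delta> * sqrt (\<alpha> * \<mu>)"
  defines "d \<equiv> real DIM('a::euclidean_space)"
  assumes F: "(\<lambda>k. (2 * sqrt \<delta>) ^ k / fact k * Gamma ((d + m + k) / 2) * Gamma (1 + (real k - m) / 2) / Gamma (d / 2)) sums F"
  shows "(\<integral>\<^sup>+t. \<integral>\<^sup>+(\<psi>::'a). ennreal (indicator {0<..} t * (exp (- \<mu> * t) * t powr (- d / 2 - m) *
            norm \<psi> ^ m * exp (- \<alpha> * (norm \<psi>)\<^sup>2 / t + \<eta> * norm \<psi>))) \<partial>lborel \<partial>lborel)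
         \<le> ennreal (pi powr (d / 2) * \<alpha> powr (- ((d + m) / 2)) * \<mu> powr (m / 2 - 1) * F)"
proof -
  have d: "d > 0" unfolding d_def by simp
  have G: "Gamma (d / 2) > 0" "Gamma ((d + real m + real k) / 2) > 0" "Gamma (1 + (real k - m) / 2) > 0" for k
    using d m by (auto intro!: Gamma_real_pos simp: add_pos_nonneg field_simps)
  \<comment> \<open>\<open>sqrt\<close> is an odd function on the whole line, so non-negativity has
    to be extracted from the bound on \<eta>.\<close>
  have \<delta>: "sqrt \<delta> \<ge> 0"
  proof (rule ccontr)
    assume "\<not> sqrt \<delta> \<ge> 0"
    hence "2 * sqrt \<delta> * sqrt (\<alpha> * \<mu>) < 0" using pos by (simp add: mult_less_0_iff)
    thus False using \<eta> pos by simp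
  qed
  let ?q = "pi powr (d / 2) * \<alpha> powr (- ((d + m) / 2)) * \<mu> powr (m / 2 - 1)"
  let ?s = "\<lambda>k. (2 * sqrt \<delta>) ^ k / fact k * Gamma ((d + m + k) / 2) * Gamma (1 + (real k - m) / 2) / Gamma (d / 2)"
  have "(\<Sum>k. ennreal (pi powr (d / 2) * (\<eta> ^ k / fact k * Gamma ((d + m + k) / 2) * \<alpha> powr (- ((d + m + k) / 2)) *
            Gamma (1 + (real k - m) / 2) * \<mu> powr (- (1 + (real k - m) / 2)) / Gamma (d / 2))))
       \<le> (\<Sum>k. ennreal (?q * ?s k))"
  proof (intro suminf_le summableI ennreal_leI)
    fix k :: nat
    have "\<eta> ^ k \<le> (2 * sqrt \<delta>) ^ k * (sqrt (\<alpha> * \<mu>)) ^ k"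
      unfolding power_mult_distrib [symmetric] using \<eta> pos by (intro power_mono) auto
    moreover have "sqrt (\<alpha> * \<mu>) ^ k = \<alpha> powr (k / 2) * \<mu> powr (k / 2)"
      using pos by (simp add: powr_half_sqrt [symmetric] powr_realpow [symmetric] powr_powr powr_mult)
    ultimately have le: "\<eta> ^ k \<le> (2 * sqrt \<delta>) ^ k * (\<alpha> powr (k / 2) * \<mu> powr (k / 2))" by simp
    let ?r = "pi powr (d / 2) * (Gamma ((d + m + k) / 2) * Gamma (1 + (real k - m) / 2) / (fact k * Gamma (d / 2))) *
        (\<alpha> powr (- ((d + m + k) / 2)) * \<mu> powr (- (1 + (real k - m) / 2)))"
    have e1: "\<alpha> powr (k / 2) * \<alpha> powr (- ((d + m + k) / 2)) = \<alpha> powr (- ((d + m) / 2))"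
      unfolding powr_add [symmetric] by (rule arg_cong[of _ _ "\<lambda>x. \<alpha> powr x"]) (simp add: field_simps)
    have e2: "\<mu> powr (k / 2) * \<mu> powr (- (1 + (real k - m) / 2)) = \<mu> powr (m / 2 - 1)"
      unfolding powr_add [symmetric] by (rule arg_cong[of _ _ "\<lambda>x. \<mu> powr x"]) (simp add: field_simps)
    have "pi powr (d / 2) * (\<eta> ^ k / fact k * Gamma ((d + m + k) / 2) * \<alpha> powr (- ((d + m + k) / 2)) *
            Gamma (1 + (real k - m) / 2) * \<mu> powr (- (1 + (real k - m) / 2)) / Gamma (d / 2)) = \<eta> ^ k * ?r"
      by (simp add: mult_ac)
    also have "\<dots> \<le> (2 * sqrt \<delta>) ^ k * (\<alpha> powr (k / 2) * \<mu> powr (k / 2)) * ?r"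
      by (intro mult_right_mono le mult_nonneg_nonneg divide_nonneg_nonneg) (use G in \<open>auto simp: less_imp_le\<close>)
    also have "\<dots> = pi powr (d / 2) * ?s k * ((\<alpha> powr (k / 2) * \<alpha> powr (- ((d + m + k) / 2))) * (\<mu> powr (k / 2) * \<mu> powr (- (1 + (real k - m) / 2))))"
      by (simp add: mult_ac)
    also have "\<dots> = ?q * ?s k" unfolding e1 e2 by (simp only: mult_ac)
    finally show "pi powr (d / 2) * (\<eta> ^ k / fact k * Gamma ((d + m + k) / 2) * \<alpha> powr (- ((d + m + k) / 2)) *
            Gamma (1 + (real k - m) / 2) * \<mu> powr (- (1 + (real k - m) / 2)) / Gamma (d / 2)) \<le> ?q * ?s k" .
  qed
  also have "\<dots> = ennreal (?q * F)"
    by (intro suminf_ennreal_eq sums_mult F mult_nonneg_nonneg divide_nonneg_nonneg)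
       (use G \<delta> in \<open>auto simp: less_imp_le\<close>)
  finally show ?thesis
    unfolding d_def nn_integral_gaussian_exp_norm[OF m pos] .
qed

section \<open>Complex Gaussian integrals\<close>

lemma integrable_gaussian_norm_power:
  assumes "c > 0"
  shows "integrable lborel (\<lambda>x::'a::euclidean_space. norm x ^ k * exp (- c * (norm x)\<^sup>2))"
proof (rule integrableI_nonneg)
  show "(\<integral>\<^sup>+(x::'a). ennreal (norm x ^ k * exp (- c * (norm x)\<^sup>2)) \<partial>lborel) < \<infinity>"
    unfolding nn_integral_norm_powr_gaussian[OF assms] by simp
qed auto

lemma integral_real_gaussian:
  assumes "c > 0"
  shows "(\<integral>x. exp (- c * (norm (x::'a::euclidean_space))\<^sup>2) \<partial>lborel) = pi powr (real DIM('a) / 2) * c powr (- (real DIM('a) / 2))"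
proof -
  have "Gamma (real DIM('a) / 2) > 0" by (rule Gamma_real_pos) simp
  hence "Gamma (real DIM('a) / 2) \<noteq> 0" by linarith
  hence "(\<integral>\<^sup>+(x::'a). ennreal (exp (- c * (norm x)\<^sup>2)) \<partial>lborel) = ennreal (pi powr (real DIM('a) / 2) * c powr (- (real DIM('a) / 2)))"
    using nn_integral_norm_powr_gaussian[OF assms, of 0, where ?'a = 'a] by simp
  thus ?thesis by (subst (asm) nn_integral_eq_integrable) auto
qed

text \<open>Expanding \<open>exp (- a |x|^2)\<close> in powers of \<open>a - R\<close> gives a power
  series with integrals as coefficients. The absolute values of the terms sum to a real Gaussian of
  rate \<open>R - |a - R|\<close>, positive precisely on the disc of radius \<open>R\<close>, so sum
  and integral may be exchanged there.\<close>

lemma complex_gaussian_holomorphic_on_ball: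
  assumes R: "R > 0"
  shows "(\<lambda>a. \<integral>x. exp (- a * complex_of_real ((norm (x::'a::euclidean_space))\<^sup>2)) \<partial>lborel) holomorphic_on ball (of_real R) R"
proof (rule power_series_holomorphic)
  fix a assume "a \<in> ball (complex_of_real R) R"
  hence a: "cmod (a - of_real R) < R" by (simp add: dist_norm norm_minus_commute)
  let ?f = "\<lambda>k (x::'a). (- of_real ((norm x)\<^sup>2)) ^ k / fact k * (a - of_real R) ^ k * exp (- (of_real R) * complex_of_real ((norm x)\<^sup>2))"
  let ?g = "\<lambda>k (x::'a). cmod (a - of_real R) ^ k / fact k * (norm x ^ (2 * k) * exp (- R * (norm x)\<^sup>2))"
  have nf: "norm (?f k x) = ?g k x" for k x
    by (simp add: norm_mult norm_divide norm_power power_mult power_even_eq power2_eq_square power_mult_distrib mult_ac)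
  have fx: "(\<lambda>k. ?f k x) sums exp (- a * complex_of_real ((norm x)\<^sup>2))" for x
  proof -
    have "(\<lambda>k. (- of_real ((norm x)\<^sup>2) * (a - of_real R)) ^ k /\<^sub>R fact k * exp (- (of_real R) * complex_of_real ((norm x)\<^sup>2)))
      sums (exp (- of_real ((norm x)\<^sup>2) * (a - of_real R)) * exp (- (of_real R) * complex_of_real ((norm x)\<^sup>2)))"
      by (intro sums_mult2 exp_converges)
    also have "exp (- of_real ((norm x)\<^sup>2) * (a - of_real R)) * exp (- (of_real R) * complex_of_real ((norm x)\<^sup>2)) = exp (- a * complex_of_real ((norm x)\<^sup>2))"
      by (simp add: exp_add [symmetric] algebra_simps)
    finally have "(\<lambda>k. (- of_real ((norm x)\<^sup>2) * (a - of_real R)) ^ k /\<^sub>R fact k * exp (- (of_real R) * complex_of_real ((norm x)\<^sup>2)))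
      sums exp (- a * complex_of_real ((norm x)\<^sup>2))" .
    thus ?thesis
      unfolding power_mult_distrib scaleR_conv_of_real divide_inverse of_real_inverse of_real_fact by (simp only: mult_ac)
  qed
  have gx: "(\<lambda>k. ?g k x) sums exp (- (R - cmod (a - of_real R)) * (norm x)\<^sup>2)" for x
  proof -
    have "(\<lambda>k. (cmod (a - of_real R) * (norm x)\<^sup>2) ^ k /\<^sub>R fact k * exp (- R * (norm x)\<^sup>2))
      sums (exp (cmod (a - of_real R) * (norm x)\<^sup>2) * exp (- R * (norm x)\<^sup>2))"
      by (intro sums_mult2 exp_converges)
    also have "exp (cmod (a - of_real R) * (norm x)\<^sup>2) * exp (- R * (norm x)\<^sup>2) = exp (- (R - cmod (a - of_real R)) * (norm x)\<^sup>2)"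
      by (simp add: exp_add [symmetric] algebra_simps)
    finally have "(\<lambda>k. (cmod (a - of_real R) * (norm x)\<^sup>2) ^ k /\<^sub>R fact k * exp (- R * (norm x)\<^sup>2))
      sums exp (- (R - cmod (a - of_real R)) * (norm x)\<^sup>2)" .
    thus ?thesis
      unfolding power_mult_distrib power_mult divide_inverse real_scaleR_def by (simp only: mult_ac)
  qed
  have int: "integrable lborel (?f k)" for k
  proof (rule Bochner_Integration.integrable_bound)
    show "integrable lborel (?g k)"
      by (intro integrable_mult_right integrable_gaussian_norm_power R)
    show "AE x in lborel. norm (?f k x) \<le> norm (?g k x)"
      unfolding nf by simp
  qed measurable
  have sumn: "summable (\<lambda>k. \<integral>x. norm (?f k x) \<partial>lborel)"
  proof (rule summable_suminf_not_top)
    have "(\<Sum>k. ennreal (\<integral>x. norm (?f k x) \<partial>lborel)) = (\<Sum>k. \<integral>\<^sup>+x. ennreal (norm (?f k x)) \<partial>lborel)"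
      by (intro suminf_cong nn_integral_eq_integral[symmetric] integrable_norm int) auto
    also have "\<dots> = (\<integral>\<^sup>+x. (\<Sum>k. ennreal (?g k x)) \<partial>lborel)"
      unfolding nf by (rule nn_integral_suminf[symmetric]) simp
    also have "\<dots> = (\<integral>\<^sup>+(x::'a). ennreal (exp (- (R - cmod (a - of_real R)) * (norm x)\<^sup>2)) \<partial>lborel)"
      by (intro nn_integral_cong suminf_ennreal_eq gx) auto
    also have "\<dots> \<noteq> top"
      using nn_integral_norm_powr_gaussian[of "R - cmod (a - of_real R)" 0, where ?'a = 'a] a by simp
    finally show "(\<Sum>k. ennreal (\<integral>x. norm (?f k x) \<partial>lborel)) \<noteq> top" .
  qed auto
  have "(\<lambda>k. integral\<^sup>L lborel (?f k)) sums (\<integral>x. (\<Sum>k. ?f k x) \<partial>lborel)"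
  proof (rule sums_integral[OF int _ sumn])
    show "AE x in lborel. summable (\<lambda>k. norm (?f k x))"
      unfolding nf using gx by (auto intro: sums_summable)
  qed
  also have "(\<lambda>x. \<Sum>k. ?f k x) = (\<lambda>x. exp (- a * complex_of_real ((norm x)\<^sup>2)))"
    using fx by (auto simp: sums_iff)
  also have "(\<lambda>k. integral\<^sup>L lborel (?f k)) = (\<lambda>k. (\<integral>(x::'a). (- of_real ((norm x)\<^sup>2)) ^ k / fact k * exp (- (of_real R) * complex_of_real ((norm x)\<^sup>2)) \<partial>lborel) * (a - of_real R) ^ k)"
    unfolding integral_mult_left_zero [symmetric] by (intro ext Bochner_Integration.integral_cong refl) (simp add: mult_ac)
  finally show "(\<lambda>k. (\<integral>(x::'a). (- of_real ((norm x)\<^sup>2)) ^ k / fact k * exp (- (of_real R) * complex_of_real ((norm x)\<^sup>2)) \<partial>lborel) * (a - of_real R) ^ k) sums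
    (\<integral>x. exp (- a * complex_of_real ((norm (x::'a))\<^sup>2)) \<partial>lborel)" .
qed

lemma integral_complex_gaussian:
  assumes a: "Re a > 0"
  shows "(\<integral>x. exp (- a * complex_of_real ((norm (x::'a::euclidean_space))\<^sup>2)) \<partial>lborel) =
    of_real (pi powr (real DIM('a) / 2)) * a powr (- of_real (real DIM('a) / 2))" (is "?I a = ?J a")
proof -
  \<comment> \<open>The discs of radius \<open>R\<close> about \<open>R\<close> exhaust the right
    half-plane. This choice satisfies \<open>R * Re a = |a|^2\<close>, hence
    \<open>|a - R|^2 = R^2 - |a|^2 < R^2\<close>.\<close>
  define R where "R = (cmod a)\<^sup>2 / Re a"
  have "a \<noteq> 0" using a by auto
  hence R: "R > 0" unfolding R_def using a by simp
  have pos: "Re z > 0" if "z \<in> ball (complex_of_real R) R" for z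
  proof -
    have "cmod (of_real R - z) < R" using that by (simp add: dist_norm)
    with complex_Re_le_cmod[of "of_real R - z"] have "Re (of_real R - z) < R" by (rule le_less_trans)
    thus ?thesis by simp
  qed
  have "(cmod (a - of_real R))\<^sup>2 = (Re a)\<^sup>2 + (Im a)\<^sup>2 - 2 * (R * Re a) + R\<^sup>2"
    unfolding cmod_power2 by (simp add: power2_eq_square algebra_simps)
  moreover have "R * Re a = (Re a)\<^sup>2 + (Im a)\<^sup>2" unfolding R_def cmod_power2 using a by simp
  moreover have "(Re a)\<^sup>2 + (Im a)\<^sup>2 > 0" using a by (simp add: sum_power2_gt_zero_iff)
  ultimately have "(cmod (a - of_real R))\<^sup>2 < R\<^sup>2" by linarith
  hence "cmod (a - of_real R) < R" by (rule power2_less_imp_less) (use R in simp)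
  hence aR: "a \<in> ball (of_real R) R" by (simp only: mem_ball dist_norm norm_minus_commute)
  have npos: "z \<notin> \<real>\<^sub>\<le>\<^sub>0" if "z \<in> ball (complex_of_real R) R" for z
    using pos[OF that] by (simp add: complex_nonpos_Reals_iff)
  let ?U = "complex_of_real ` {0<..<2 * R}"
  \<comment> \<open>On the real diameter of the disc both sides equal the known real Gaussian
    integral, and these points accumulate at the centre.\<close>
  have "?I a - ?J a = 0"
  proof (rule analytic_continuation[of "\<lambda>z. ?I z - ?J z" "ball (of_real R) R" ?U "of_real R"])
    show "(\<lambda>z. ?I z - ?J z) holomorphic_on ball (of_real R) R"
    proof (rule holomorphic_on_diff[OF complex_gaussian_holomorphic_on_ball[OF R] holomorphic_on_mult[OF holomorphic_on_const]])
      show "(\<lambda>z. z powr (- of_real (real DIM('a) / 2))) holomorphic_on ball (complex_of_real R) R"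
        by (rule holomorphic_on_powr[OF holomorphic_on_ident holomorphic_on_const])
          (rule npos)
    qed
    show "?U \<subseteq> ball (of_real R) R"
      by (auto simp: dist_of_real dist_real_def)
    show "complex_of_real R islimpt ?U"
      unfolding islimpt_approachable
    proof (intro allI impI)
      fix e :: real assume e: "e > 0"
      let ?x = "R + min e R / 2"
      have "?x \<in> {0<..<2 * R}" "?x \<noteq> R" "\<bar>?x - R\<bar> < e" using e R by (auto simp: min_def)
      thus "\<exists>x'\<in>?U. x' \<noteq> complex_of_real R \<and> dist x' (complex_of_real R) < e"
        by (intro bexI[of _ "of_real ?x"] conjI imageI) (simp_all only: of_real_eq_iff dist_of_real dist_real_def simp_thms)
    qed
    show "?I z - ?J z = 0" if "z \<in> ?U" for z
    proof -
      from that obtain r where r: "z = of_real r" "r > 0" by auto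
      have "?I z = of_real (\<integral>x. exp (- r * (norm (x::'a))\<^sup>2) \<partial>lborel)"
        unfolding r integral_complex_of_real [symmetric]
        by (intro Bochner_Integration.integral_cong refl) (simp only: exp_of_real [symmetric] of_real_mult of_real_minus)
      also have "\<dots> = ?J z"
      proof -
        have "complex_of_real r powr (- of_real (real DIM('a) / 2)) = of_real (r powr (- (real DIM('a) / 2)))"
          using powr_of_real[of r "- (real DIM('a) / 2)"] r(2) by simp
        thus ?thesis unfolding integral_real_gaussian[OF r(2)] r(1) by (simp only: of_real_mult)
      qed
      finally show ?thesis by simp
    qed
    show "complex_of_real R \<in> ball (of_real R) R" using R by simp
  qed (rule open_ball connected_ball aR)+
  thus ?thesis by (simp only: right_minus_eq)
qed

section \<open>Rotations generated by a skew-symmetric matrix\<close>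

lemma skew_inner_zero:
  fixes S :: "real^'d^'d"
  assumes "transpose S = - S"
  shows "x \<bullet> (S *v x) = 0"
proof -
  have "x \<bullet> (S *v x) = (transpose S *v x) \<bullet> x"
    by (simp add: dot_lmul_matrix vector_transpose_matrix)
  also have "\<dots> = - (x \<bullet> (S *v x))"
    unfolding assms by (simp add: matrix_vector_mult_def inner_vec_def sum_negf mult_ac sum_distrib_left)
  finally show ?thesis by simp
qed

text \<open>Stated for an arbitrary solution of z' = S z rather than for the exponential: applied to
  the flow it gives the isometry, and applied to a difference of two solutions it gives
  uniqueness.\<close>

lemma skew_flow_norm:
  fixes S :: "real^'d^'d"
  assumes S: "transpose S = - S"
    and z: "\<And>t i. ((\<lambda>t. z t $ i) has_real_derivative (S *v z t) $ i) (at t)"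
  shows "norm (z t) = norm (z 0)"
proof -
  have "((\<lambda>t. z t \<bullet> z t) has_real_derivative 0) (at t)" for t
  proof -
    have "((\<lambda>t. \<Sum>i\<in>UNIV. (z t $ i) * (z t $ i)) has_real_derivative
       (\<Sum>i\<in>UNIV. z t $ i * (S *v z t) $ i + (S *v z t) $ i * z t $ i)) (at t)"
      by (rule DERIV_sum) (rule DERIV_mult'[OF z z])
    also have "(\<Sum>i\<in>UNIV. z t $ i * (S *v z t) $ i + (S *v z t) $ i * z t $ i) = 2 * (z t \<bullet> (S *v z t))"
      by (simp add: inner_vec_def sum_distrib_left mult.commute)
    also have "\<dots> = 0" by (simp add: skew_inner_zero[OF S])
    finally show ?thesis by (simp add: inner_vec_def)
  qed
  hence "z t \<bullet> z t = z 0 \<bullet> z 0"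
    by (intro DERIV_isconst_all[of "\<lambda>t. z t \<bullet> z t" t 0]) auto
  thus ?thesis by (simp add: norm_eq_sqrt_inner)
qed

section \<open>The matrix exponential as an entire power series in time\<close>

lemma matrix_power_Suc: "matrix_power M (Suc k) = M ** matrix_power M k"
  by (simp add: matrix_power_def)

lemma matrix_power_0: "matrix_power M 0 = mat 1"
  by (simp add: matrix_power_def)

lemma scaleR_matrix_mult_left: "(c *\<^sub>R A) ** B = c *\<^sub>R (A ** (B :: 'a::real_algebra_1^'p^'n) :: 'a^'p^'m)"
  by (simp add: matrix_matrix_mult_def vec_eq_iff scaleR_sum_right)

lemma scaleR_matrix_mult_right: "A ** (c *\<^sub>R B) = c *\<^sub>R (A ** (B :: 'a::real_algebra_1^'p^'n) :: 'a^'p^'m)"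
  by (simp add: matrix_matrix_mult_def vec_eq_iff scaleR_sum_right)

lemma scaleR_matrix_vector_mult: "(c *\<^sub>R A) *v x = c *\<^sub>R ((A :: 'a::real_algebra_1^'n^'m) *v x)"
  by (simp add: matrix_vector_mult_def vec_eq_iff scaleR_sum_right)

lemma matrix_power_scaleR:
  "matrix_power (c *\<^sub>R M) k = c ^ k *\<^sub>R matrix_power (M :: 'a::real_algebra_1^'n^'n) k"
  by (induction k) (simp_all add: matrix_power_Suc matrix_power_0 scaleR_matrix_mult_left scaleR_matrix_mult_right)

lemma norm_matrix_power_vector_le:
  fixes M :: "real^'d^'d"
  shows "norm (matrix_power M k *v x) \<le> onorm ((*v) M) ^ k * norm x"
proof (induction k)
  case (Suc k)
  have "norm (matrix_power M (Suc k) *v x) \<le> onorm ((*v) M) * norm (matrix_power M k *v x)"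
    unfolding matrix_power_Suc matrix_vector_mul_assoc [symmetric]
    by (rule onorm) (rule matrix_vector_mul_bounded_linear)
  also have "\<dots> \<le> onorm ((*v) M) * (onorm ((*v) M) ^ k * norm x)"
    by (intro mult_left_mono Suc onorm_pos_le) (rule matrix_vector_mul_bounded_linear)
  finally show ?case by (simp add: mult_ac)
qed (simp add: matrix_power_0)

text \<open>Each entry of the \<open>k\<close>-th power is at most the \<open>k\<close>-th power of
  the operator norm, so the scalar exponential series of that norm is a majorant; the squared
  dimension counts the entries.\<close>

lemma summable_matrix_exp:
  fixes M :: "real^'d^'d"
  shows "summable (\<lambda>k. (1 / fact k) *\<^sub>R matrix_power M k)"
proof (rule summable_comparison_test')
  let ?B = "onorm ((*v) M)"
  show "summable (\<lambda>k. real CARD('d) * real CARD('d) * (?B ^ k / fact k))"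
    using summable_exp[of ?B] by (intro summable_mult) (simp add: field_simps)
  fix k
  have entry: "\<bar>matrix_power M k $ i $ j\<bar> \<le> ?B ^ k" for i j
  proof -
    have "matrix_power M k $ i $ j = (matrix_power M k *v axis j 1) $ i"
      by (simp add: matrix_vector_mult_basis column_def)
    also have "\<bar>\<dots>\<bar> \<le> norm (matrix_power M k *v axis j 1)" by (rule component_le_norm_cart)
    also have "\<dots> \<le> ?B ^ k * norm (axis j 1 :: real^'d)" by (rule norm_matrix_power_vector_le)
    finally show ?thesis by (simp add: norm_axis_1)
  qed
  have "norm (matrix_power M k) \<le> (\<Sum>i\<in>UNIV. norm (matrix_power M k $ i))"
    unfolding norm_vec_def by (rule L2_set_le_sum) simp
  also have "\<dots> \<le> (\<Sum>i\<in>(UNIV::'d set). \<Sum>j\<in>(UNIV::'d set). ?B ^ k)"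
    by (intro sum_mono order.trans[OF norm_le_l1_cart] entry)
  finally have "norm (matrix_power M k) \<le> real CARD('d) * real CARD('d) * ?B ^ k" by simp
  thus "norm ((1 / fact k) *\<^sub>R matrix_power M k) \<le> real CARD('d) * real CARD('d) * (?B ^ k / fact k)"
    by (simp add: divide_simps)
qed

lemma matrix_exp_vector_sums:
  fixes M :: "real^'d^'d"
  shows "(\<lambda>k. (matrix_power M k *v x) $ i / fact k) sums (matrix_exp M *v x) $ i"
proof -
  have "bounded_linear (\<lambda>A::real^'d^'d. (A *v x) $ i)"
    by (intro linear_conv_bounded_linear[THEN iffD1])
       (auto simp: linear_iff matrix_vector_mult_add_rdistrib scaleR_matrix_vector_mult)
  from bounded_linear.sums[OF this summable_sums[OF summable_matrix_exp[of M]]]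
  show ?thesis by (simp add: scaleR_matrix_vector_mult matrix_exp_def)
qed

lemma matrix_exp_scaleR_power_series:
  fixes M :: "real^'d^'d"
  shows "(\<lambda>k. (matrix_power M k *v x) $ i / fact k * t ^ k) sums (matrix_exp (t *\<^sub>R M) *v x) $ i"
  using matrix_exp_vector_sums[of "t *\<^sub>R M" x i]
  by (simp add: matrix_power_scaleR scaleR_matrix_vector_mult mult_ac)

text \<open>Each component is a power series in \<open>t\<close> that converges everywhere and may
  be differentiated termwise; the index shift in \<open>diffs\<close> releases one factor
  \<open>M\<close>.\<close>

lemma matrix_exp_flow_derivative:
  fixes M :: "real^'d^'d"
  shows "((\<lambda>t. (matrix_exp (t *\<^sub>R M) *v x) $ i) has_real_derivative (M *v (matrix_exp (t *\<^sub>R M) *v x)) $ i) (at t)"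
proof -
  let ?c = "\<lambda>k. (matrix_power M k *v x) $ i / fact k"
  have "((\<lambda>t. \<Sum>k. ?c k * t ^ k) has_real_derivative (\<Sum>k. diffs ?c k * t ^ k)) (at t)"
    by (rule termdiffs_strong_converges_everywhere)
       (rule sums_summable[OF matrix_exp_scaleR_power_series])
  also have "(\<lambda>t. \<Sum>k. ?c k * t ^ k) = (\<lambda>t. (matrix_exp (t *\<^sub>R M) *v x) $ i)"
    by (rule ext) (rule sums_unique[symmetric, OF matrix_exp_scaleR_power_series])
  also have "diffs ?c = (\<lambda>k. (M *v (matrix_power M k *v x)) $ i / fact k)"
    by (rule ext) (simp add: diffs_def matrix_power_Suc matrix_vector_mul_assoc del: of_nat_Suc)
  also have "(\<Sum>k. (M *v (matrix_power M k *v x)) $ i / fact k * t ^ k) = (M *v (matrix_exp (t *\<^sub>R M) *v x)) $ i"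
  proof -
    have "(\<lambda>k. \<Sum>j\<in>UNIV. M $ i $ j * ((matrix_power M k *v x) $ j / fact k * t ^ k)) sums
          (\<Sum>j\<in>UNIV. M $ i $ j * (matrix_exp (t *\<^sub>R M) *v x) $ j)"
      by (intro sums_sum sums_mult matrix_exp_scaleR_power_series)
    also have "(\<lambda>k. \<Sum>j\<in>UNIV. M $ i $ j * ((matrix_power M k *v x) $ j / fact k * t ^ k)) =
      (\<lambda>k. (M *v (matrix_power M k *v x)) $ i / fact k * t ^ k)"
    proof (rule ext)
      fix k
      have "(M *v (matrix_power M k *v x)) $ i = (\<Sum>j\<in>UNIV. M $ i $ j * (matrix_power M k *v x) $ j)"
        by (simp only: matrix_vector_mult_def vec_lambda_beta)
      thus "(\<Sum>j\<in>UNIV. M $ i $ j * ((matrix_power M k *v x) $ j / fact k * t ^ k)) =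
          (M *v (matrix_power M k *v x)) $ i / fact k * t ^ k"
        by (simp only: sum_distrib_right sum_divide_distrib) (simp add: mult_ac)
    qed
    also have "(\<Sum>j\<in>UNIV. M $ i $ j * (matrix_exp (t *\<^sub>R M) *v x) $ j) = (M *v (matrix_exp (t *\<^sub>R M) *v x)) $ i"
      by (simp add: matrix_vector_mult_def)
    finally show ?thesis by (rule sums_unique[symmetric])
  qed
  finally show ?thesis .
qed

lemma matrix_exp_zero: "matrix_exp (0 *\<^sub>R (M :: real^'d^'d)) *v x = x"
proof -
  have "(matrix_exp (0 *\<^sub>R M) *v x) $ i = x $ i" for i
    using sums_unique2[OF matrix_exp_scaleR_power_series[of M x i 0] powser_sums_zero]
    by (simp add: matrix_power_0)
  thus ?thesis by (simp add: vec_eq_iff)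
qed

lemma continuous_on_matrix_exp_flow:
  fixes M :: "real^'d^'d"
  shows "continuous_on UNIV (\<lambda>t. matrix_exp (t *\<^sub>R M) *v x)"
proof -
  have "continuous_on UNIV (\<lambda>t. \<chi> i. (matrix_exp (t *\<^sub>R M) *v x) $ i)"
    by (intro continuous_on_vec_lambda)
       (auto intro!: continuous_at_imp_continuous_on DERIV_isCont[OF matrix_exp_flow_derivative])
  thus ?thesis by simp
qed

lemma norm_matrix_exp_skew:
  fixes S :: "real^'d^'d"
  assumes "transpose S = - S"
  shows "norm (matrix_exp (t *\<^sub>R S) *v x) = norm x"
  using skew_flow_norm[OF assms, of "\<lambda>t. matrix_exp (t *\<^sub>R S) *v x" t, OF matrix_exp_flow_derivative]
  by (simp only: matrix_exp_zero)

text \<open>Both sides solve z' = S z in \<open>t\<close> and agree at \<open>t = 0\<close>, so norm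
  preservation forces their difference to vanish. This avoids multiplying exponential
  series.\<close>

lemma matrix_exp_skew_add:
  fixes S :: "real^'d^'d"
  assumes "transpose S = - S"
  shows "matrix_exp ((t + s) *\<^sub>R S) *v x = matrix_exp (t *\<^sub>R S) *v (matrix_exp (s *\<^sub>R S) *v x)"
proof -
  define z where "z = (\<lambda>t. matrix_exp ((t + s) *\<^sub>R S) *v x - matrix_exp (t *\<^sub>R S) *v (matrix_exp (s *\<^sub>R S) *v x))"
  have "((\<lambda>t. z t $ i) has_real_derivative (S *v z t) $ i) (at t)" for t i
  proof -
    have "((\<lambda>t. (matrix_exp ((t + s) *\<^sub>R S) *v x) $ i) has_real_derivative
        (S *v (matrix_exp ((t + s) *\<^sub>R S) *v x)) $ i) (at t)"
      using matrix_exp_flow_derivative[of S x i "t + s"] by (simp add: DERIV_shift)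
    from DERIV_diff[OF this matrix_exp_flow_derivative] show ?thesis
      by (simp add: z_def matrix_vector_mult_diff_distrib)
  qed
  from skew_flow_norm[OF assms this, of t] have "norm (z t) = norm (z 0)" .
  also have "z 0 = 0" unfolding z_def by (simp add: matrix_exp_zero del: scaleR_zero_left)
  finally show ?thesis by (simp add: z_def)
qed

section \<open>Convolution along an isometric flow\<close>

lemma distr_lborel_reflect:
  fixes c :: "'a::euclidean_space"
  shows "distr lborel borel (\<lambda>x. c - x) = lborel"
  by (subst lborel_affine[of "-1" c]) (auto simp: density_1 one_ennreal_def [symmetric])

lemma nn_integral_lborel_reflect:
  fixes c :: "'a::euclidean_space"
  assumes [measurable]: "f \<in> borel_measurable borel"
  shows "(\<integral>\<^sup>+x. f (c - x) \<partial>lborel) = (\<integral>\<^sup>+x. f x \<partial>lborel)"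
proof -
  have "(\<integral>\<^sup>+x. f x \<partial>distr lborel borel (\<lambda>x. c - x)) = (\<integral>\<^sup>+x. f (c - x) \<partial>lborel)"
    by (rule nn_integral_distr) simp_all
  thus ?thesis by (simp add: distr_lborel_reflect)
qed

lemma integral_lborel_reflect:
  fixes c :: "'a::euclidean_space" and f :: "'a \<Rightarrow> 'b::{banach, second_countable_topology}"
  assumes [measurable]: "f \<in> borel_measurable borel"
  shows "(\<integral>x. f (c - x) \<partial>lborel) = (\<integral>x. f x \<partial>lborel)"
proof -
  have "(\<integral>x. f x \<partial>distr lborel borel (\<lambda>x. c - x)) = (\<integral>x. f (c - x) \<partial>lborel)"
    by (rule integral_distr) simp_all
  thus ?thesis by (simp add: distr_lborel_reflect)
qed

lemma integrable_lborel_reflect: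
  fixes c :: "'a::euclidean_space" and f :: "'a \<Rightarrow> 'b::{banach, second_countable_topology}"
  assumes "integrable lborel f"
  shows "integrable lborel (\<lambda>x. f (c - x))"
proof -
  have [measurable]: "f \<in> borel_measurable borel" using assms by auto
  show ?thesis using assms
    by (subst integrable_distr_eq[symmetric, of "\<lambda>x. c - x" lborel borel f]) (simp_all add: distr_lborel_reflect)
qed

text \<open>What the analysis uses about the rotations. Continuity is asked for in \<open>t\<close>
  at fixed points only; where time and a point vary together, linearity separates them.\<close>

locale isometric_flow =
  fixes E :: "real \<Rightarrow> 'a::euclidean_space \<Rightarrow> 'a"
  assumes flow_linear: "linear (E t)"
    and flow_norm: "norm (E t x) = norm x"
    and flow_add: "E (t + s) x = E t (E s x)"
    and flow_zero: "E 0 x = x"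
    and flow_continuous: "continuous_on UNIV (\<lambda>t. E t x)"
begin

abbreviation N :: "(real \<times> 'a) measure" where "N \<equiv> lborel \<Otimes>\<^sub>M lborel"

lemma flow_measurable_time [measurable]: "(\<lambda>t. E t x) \<in> borel_measurable borel"
  by (rule borel_measurable_continuous_onI[OF flow_continuous])

lemma flow_measurable_space [measurable]: "E t \<in> borel_measurable borel"
  by (rule borel_measurable_continuous_onI) (intro linear_continuous_on linear_linear[THEN iffD2] flow_linear)

lemma flow_line: "E t (x + \<rho> *\<^sub>R e) = E t x + \<rho> *\<^sub>R E t e"
  using flow_linear[of t] by (simp add: linear_add linear_cmul)

lemma flow_dist: "norm (E t x - E t y) = norm (x - y)"
  using flow_linear[of t] flow_norm[of t "x - y"] by (simp add: linear_diff)

definition conv :: "(real \<times> 'a \<Rightarrow> complex) \<Rightarrow> ('a \<Rightarrow> complex) \<Rightarrow> 'a \<Rightarrow> complex" where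
  "conv P f x = (\<integral>p. P (fst p, E (fst p) x - snd p) * f (snd p) \<partial>N)"

text \<open>At fixed time the map from \<xi> to \<open>u t - \<xi>\<close> preserves Lebesgue
  measure, whatever the measurable curve \<open>u\<close>, so Tonelli allows recentring the kernel
  at each time separately.\<close>

lemma nn_integral_conv_kernel:
  assumes [measurable]: "F \<in> borel_measurable N" "u \<in> borel_measurable borel"
  shows "(\<integral>\<^sup>+p. F (fst p, u (fst p) - snd p) \<partial>N) = (\<integral>\<^sup>+p. F p \<partial>N)"
proof -
  have "(\<integral>\<^sup>+p. F (fst p, u (fst p) - snd p) \<partial>N) = (\<integral>\<^sup>+t. \<integral>\<^sup>+\<xi>. F (t, u t - \<xi>) \<partial>lborel \<partial>lborel)"
    by (subst lborel.nn_integral_fst[symmetric]) simp_all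
  also have "\<dots> = (\<integral>\<^sup>+t. \<integral>\<^sup>+\<xi>. F (t, \<xi>) \<partial>lborel \<partial>lborel)"
    by (intro nn_integral_cong nn_integral_lborel_reflect[of "\<lambda>\<xi>. F (_, \<xi>)"]) simp
  also have "\<dots> = (\<integral>\<^sup>+p. F p \<partial>N)"
    by (rule lborel.nn_integral_fst) simp
  finally show ?thesis .
qed

lemma conv_kernel_integrable:
  assumes P: "integrable N P" and [measurable]: "f \<in> borel_measurable borel" "u \<in> borel_measurable borel"
    and B: "\<And>x. cmod (f x) \<le> B"
  shows "integrable N (\<lambda>p. P (fst p, u (fst p) - snd p) * f (snd p))"
    and "(\<integral>p. cmod (P (fst p, u (fst p) - snd p) * f (snd p)) \<partial>N) \<le> B * (\<integral>p. cmod (P p) \<partial>N)"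
proof -
  have [measurable]: "P \<in> borel_measurable N" using P by auto
  have B0: "B \<ge> 0" using B[of 0] norm_ge_zero[of "f 0"] by linarith
  have "(\<integral>\<^sup>+p. ennreal (cmod (P (fst p, u (fst p) - snd p) * f (snd p))) \<partial>N)
     \<le> (\<integral>\<^sup>+p. ennreal B * ennreal (cmod (P (fst p, u (fst p) - snd p))) \<partial>N)"
    by (intro nn_integral_mono) (use B B0 in \<open>auto simp: norm_mult mult.commute ennreal_mult' [symmetric] intro!: ennreal_leI mult_right_mono\<close>)
  also have "\<dots> = ennreal B * (\<integral>\<^sup>+p. ennreal (cmod (P p)) \<partial>N)"
    using nn_integral_conv_kernel[of "\<lambda>p. ennreal (cmod (P p))" u] by (simp add: nn_integral_cmult)
  also have "(\<integral>\<^sup>+p. ennreal (cmod (P p)) \<partial>N) = ennreal (\<integral>p. cmod (P p) \<partial>N)"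
    by (rule nn_integral_eq_integral) (use P in auto)
  also have "ennreal B * \<dots> = ennreal (B * (\<integral>p. cmod (P p) \<partial>N))"
    using B0 by (simp add: ennreal_mult')
  finally have le: "(\<integral>\<^sup>+p. ennreal (cmod (P (fst p, u (fst p) - snd p) * f (snd p))) \<partial>N) \<le> \<dots>" .
  show int: "integrable N (\<lambda>p. P (fst p, u (fst p) - snd p) * f (snd p))"
    by (rule integrableI_bounded) (use le in \<open>auto intro: order.strict_trans1\<close>)
  have "ennreal (\<integral>p. cmod (P (fst p, u (fst p) - snd p) * f (snd p)) \<partial>N) \<le> ennreal (B * (\<integral>p. cmod (P p) \<partial>N))"
    using le by (subst nn_integral_eq_integral[symmetric]) (use int in auto)
  thus "(\<integral>p. cmod (P (fst p, u (fst p) - snd p) * f (snd p)) \<partial>N) \<le> B * (\<integral>p. cmod (P p) \<partial>N)"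
    by (subst (asm) ennreal_le_iff) (auto intro!: mult_nonneg_nonneg B0 integral_nonneg_AE)
qed

text \<open>In \<open>conv_def\<close> the point \<open>x\<close> sits in the kernel, which suits
  differentiation. Here it sits in \<open>f\<close>, so that moduli of continuity and weighted
  bounds of \<open>f\<close> pass to the convolution.\<close>

lemma conv_reflect:
  assumes P: "integrable N P" and [measurable]: "f \<in> borel_measurable borel"
    and B: "\<And>x. cmod (f x) \<le> B"
  shows "conv P f x = (\<integral>p. P p * f (E (fst p) x - snd p) \<partial>N)"
    and "integrable N (\<lambda>p. P p * f (E (fst p) x - snd p))"
proof -
  have [measurable]: "P \<in> borel_measurable N" using P by auto
  have B0: "B \<ge> 0" using B[of 0] norm_ge_zero[of "f 0"] by linarith
  show int: "integrable N (\<lambda>p. P p * f (E (fst p) x - snd p))"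
    by (rule Bochner_Integration.integrable_bound[OF integrable_mult_left[of B N "\<lambda>p. cmod (P p)"]])
       (use P B B0 in \<open>auto simp: norm_mult intro!: mult_left_mono\<close>)
  note int2 = conv_kernel_integrable(1)[OF P \<open>f \<in> _\<close> flow_measurable_time[of x] B]
  have "conv P f x = (\<integral>t. \<integral>\<xi>. P (t, E t x - \<xi>) * f \<xi> \<partial>lborel \<partial>lborel)"
    unfolding conv_def using lborel_pair.integral_fst'[OF int2] by simp
  also have "\<dots> = (\<integral>t. \<integral>\<xi>. P (t, \<xi>) * f (E t x - \<xi>) \<partial>lborel \<partial>lborel)"
  proof (rule Bochner_Integration.integral_cong[OF refl])
    fix t :: real
    show "(\<integral>\<xi>. P (t, E t x - \<xi>) * f \<xi> \<partial>lborel) = (\<integral>\<xi>. P (t, \<xi>) * f (E t x - \<xi>) \<partial>lborel)"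
      using integral_lborel_reflect[of "\<lambda>\<xi>. P (t, \<xi>) * f (E t x - \<xi>)" "E t x"] by simp
  qed
  also have "\<dots> = (\<integral>p. P p * f (E (fst p) x - snd p) \<partial>N)"
    using lborel_pair.integral_fst'[OF int] by simp
  finally show "conv P f x = (\<integral>p. P p * f (E (fst p) x - snd p) \<partial>N)" .
qed

lemma conv_bound:
  assumes P: "integrable N P" and f: "f \<in> borel_measurable borel" and B: "\<And>x. cmod (f x) \<le> B"
  shows "cmod (conv P f x) \<le> B * (\<integral>p. cmod (P p) \<partial>N)"
  unfolding conv_def
  using order.trans[OF integral_norm_bound conv_kernel_integrable(2)[OF P f flow_measurable_time B]] .

lemma conv_uniformly_continuous:
  assumes P: "integrable N P" and f: "uniformly_continuous_on UNIV f"
    and B: "\<And>x. cmod (f x) \<le> B"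
  shows "uniformly_continuous_on UNIV (conv P f)"
  unfolding uniformly_continuous_on_def
proof (intro allI impI)
  fix e :: real assume e: "e > 0"
  have m: "f \<in> borel_measurable borel"
    by (rule borel_measurable_continuous_onI[OF uniformly_continuous_imp_continuous[OF f]])
  let ?K = "\<integral>p. cmod (P p) \<partial>N"
  have K: "?K \<ge> 0" by (intro integral_nonneg_AE) auto
  have "?K + 1 > 0" using K by linarith
  \<comment> \<open>The \<open>+ 1\<close> covers a kernel of zero mass. One modulus of continuity
    works for all times because the flow preserves distances.\<close>
  hence "e / (?K + 1) > 0" by (rule divide_pos_pos[OF e])
  with f obtain d where d: "d > 0" "\<And>x y. dist y x < d \<Longrightarrow> dist (f y) (f x) < e / (?K + 1)"
    unfolding uniformly_continuous_on_def by (metis UNIV_I)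
  show "\<exists>d>0. \<forall>x\<in>UNIV. \<forall>x'\<in>UNIV. dist x' x < d \<longrightarrow> dist (conv P f x') (conv P f x) < e"
  proof (intro exI conjI ballI impI)
    fix x x' :: 'a assume xx: "dist x' x < d"
    have "conv P f x' - conv P f x = (\<integral>p. P p * f (E (fst p) x' - snd p) - P p * f (E (fst p) x - snd p) \<partial>N)"
      unfolding conv_reflect(1)[OF P m B] by (intro Bochner_Integration.integral_diff[symmetric] conv_reflect(2)[OF P m B])
    also have "cmod \<dots> \<le> (\<integral>p. cmod (P p) * (e / (?K + 1)) \<partial>N)"
    proof (rule order.trans[OF integral_norm_bound], rule integral_mono)
      show "integrable N (\<lambda>p. cmod (P p * f (E (fst p) x' - snd p) - P p * f (E (fst p) x - snd p)))"
        by (intro integrable_norm Bochner_Integration.integrable_diff conv_reflect(2)[OF P m B])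
      show "integrable N (\<lambda>p. cmod (P p) * (e / (?K + 1)))"
        by (intro integrable_mult_left integrable_norm P)
      fix p :: "real \<times> 'a"
      have "dist (E (fst p) x' - snd p) (E (fst p) x - snd p) < d"
        using xx flow_dist[of "fst p" x' x] by (simp add: dist_norm)
      from d(2)[OF this] have "cmod (f (E (fst p) x' - snd p) - f (E (fst p) x - snd p)) \<le> e / (?K + 1)"
        by (simp add: dist_norm)
      hence "cmod (P p) * cmod (f (E (fst p) x' - snd p) - f (E (fst p) x - snd p)) \<le> cmod (P p) * (e / (?K + 1))"
        by (rule mult_left_mono) simp
      thus "cmod (P p * f (E (fst p) x' - snd p) - P p * f (E (fst p) x - snd p)) \<le> cmod (P p) * (e / (?K + 1))"
        by (simp only: right_diff_distrib [symmetric] norm_mult)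
    qed
    also have "\<dots> = ?K * (e / (?K + 1))" by (rule integral_mult_left_zero)
    also have "\<dots> < e" using e \<open>?K + 1 > 0\<close> by (subst times_divide_eq_right, subst pos_divide_less_eq) (auto simp: algebra_simps)
    finally show "dist (conv P f x') (conv P f x) < e" by (simp add: dist_norm)
  qed (use d in auto)
qed

text \<open>Difference quotients are never dominated. Integrating the derivative kernel along a
  segment and exchanging the integrals shows that increments of \<open>conv P f\<close> are
  integrals of the continuous function \<open>conv P' f\<close>; integrability of \<open>P'\<close>
  over time and space takes the place of a majorant uniform in the step.\<close>

lemma conv_has_vector_derivative:
  assumes P: "integrable N P" and P': "integrable N P'"
    and f: "uniformly_continuous_on UNIV f" and B: "\<And>x. cmod (f x) \<le> B"
    and deriv: "\<And>t z \<rho>. ((\<lambda>\<rho>. P (t, z + \<rho> *\<^sub>R E t e)) has_vector_derivative P' (t, z + \<rho> *\<^sub>R E t e)) (at \<rho>)"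
    and cont: "\<And>t z. continuous_on UNIV (\<lambda>\<rho>. P' (t, z + \<rho> *\<^sub>R E t e))"
  shows "((\<lambda>h. conv P f (x + h *\<^sub>R e)) has_vector_derivative conv P' f x) (at 0)"
proof -
  have fm [measurable]: "f \<in> borel_measurable borel"
    by (rule borel_measurable_continuous_onI[OF uniformly_continuous_imp_continuous[OF f]])
  have [measurable]: "P \<in> borel_measurable N" "P' \<in> borel_measurable N" using P P' by auto
  let ?W = "\<lambda>\<rho>. conv P' f (x + \<rho> *\<^sub>R e)"
  have Wc: "continuous_on UNIV ?W"
    by (rule continuous_on_compose2[OF uniformly_continuous_imp_continuous[OF conv_uniformly_continuous[OF P' f B]]])
       (auto intro!: continuous_intros)
  interpret PN: pair_sigma_finite lborel N
    by (intro pair_sigma_finite.intro lborel.sigma_finite_measure_axioms lborel_pair.P.sigma_finite_measure_axioms)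
  \<comment> \<open>The base point has parameter -1, so that 0 is interior to \<open>{-1..1}\<close>
    and the derivative of the integral is two-sided.\<close>
  have incr: "conv P f (x + h *\<^sub>R e) - conv P f (x - e) = integral {-1..h} ?W" if h: "-1 \<le> h" for h
  proof -
    let ?g = "\<lambda>\<rho> p. indicat_real {-1..h} \<rho> *\<^sub>R (P' (fst p, E (fst p) (x + \<rho> *\<^sub>R e) - snd p) * f (snd p))"
    \<comment> \<open>\<open>flow_line\<close> takes the parameter out of the flow and leaves
      \<open>E t x\<close> and \<open>E t e\<close> at fixed vectors, whose measurability in
      \<open>t\<close> is known.\<close>
    have gm [measurable]: "case_prod ?g \<in> borel_measurable (lborel \<Otimes>\<^sub>M N)"
      unfolding flow_line by measurable
    have int_p: "integrable N (\<lambda>p. ?g \<rho> p)" for \<rho>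
      by (intro integrable_scaleR_right conv_kernel_integrable(1)[OF P' fm flow_measurable_time B])
    have "integrable (lborel \<Otimes>\<^sub>M N) (case_prod ?g)"
    proof (rule PN.Fubini_integrable)
      show "integrable lborel (\<lambda>\<rho>. \<integral>p. norm (case_prod ?g (\<rho>, p)) \<partial>N)"
      proof (rule Bochner_Integration.integrable_bound)
        show "integrable lborel (\<lambda>\<rho>. indicat_real {-1..h} \<rho> * (B * (\<integral>p. cmod (P' p) \<partial>N)))"
          by (intro integrable_mult_left integrable_real_indicator) (use h in \<open>auto simp: emeasure_lborel_Icc\<close>)
        show "(\<lambda>\<rho>. \<integral>p. norm (case_prod ?g (\<rho>, p)) \<partial>N) \<in> borel_measurable lborel"
          using gm by measurable
        show "AE \<rho> in lborel. norm (\<integral>p. norm (case_prod ?g (\<rho>, p)) \<partial>N) \<le> norm (indicat_real {-1..h} \<rho> * (B * (\<integral>p. cmod (P' p) \<partial>N)))"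
        proof (intro AE_I2)
          fix \<rho> :: real
          have "(\<integral>p. norm (case_prod ?g (\<rho>, p)) \<partial>N) = indicat_real {-1..h} \<rho> * (\<integral>p. cmod (P' (fst p, E (fst p) (x + \<rho> *\<^sub>R e) - snd p) * f (snd p)) \<partial>N)"
            by simp
          also have "\<dots> \<le> indicat_real {-1..h} \<rho> * (B * (\<integral>p. cmod (P' p) \<partial>N))"
            by (intro mult_left_mono conv_kernel_integrable(2)[OF P' fm flow_measurable_time B]) auto
          finally have "(\<integral>p. norm (case_prod ?g (\<rho>, p)) \<partial>N) \<le> indicat_real {-1..h} \<rho> * (B * (\<integral>p. cmod (P' p) \<partial>N))" .
          moreover have "(\<integral>p. norm (case_prod ?g (\<rho>, p)) \<partial>N) \<ge> 0" by (intro integral_nonneg_AE) auto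
          ultimately show "norm (\<integral>p. norm (case_prod ?g (\<rho>, p)) \<partial>N) \<le> norm (indicat_real {-1..h} \<rho> * (B * (\<integral>p. cmod (P' p) \<partial>N)))"
            unfolding real_norm_def by linarith
        qed
      qed
      show "AE \<rho> in lborel. integrable N (\<lambda>p. case_prod ?g (\<rho>, p))"
        using int_p by simp
    qed (rule gm)
    from PN.Fubini_integral[OF this]
    have "(\<integral>p. \<integral>\<rho>. ?g \<rho> p \<partial>lborel \<partial>N) = (\<integral>\<rho>. \<integral>p. ?g \<rho> p \<partial>N \<partial>lborel)" by simp
    also have "\<dots> = (\<integral>\<rho>. indicat_real {-1..h} \<rho> *\<^sub>R ?W \<rho> \<partial>lborel)"
      unfolding conv_def by simp
    also have "\<dots> = integral {-1..h} ?W"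
      using set_borel_integral_eq_integral(2)[of "{-1..h}" ?W] borel_integrable_atLeastAtMost'[of "-1" h ?W] Wc
      unfolding set_lebesgue_integral_def by (auto intro: continuous_on_subset)
    finally have 1: "(\<integral>p. \<integral>\<rho>. ?g \<rho> p \<partial>lborel \<partial>N) = integral {-1..h} ?W" .
    have 2: "(\<integral>\<rho>. ?g \<rho> p \<partial>lborel) = P (fst p, E (fst p) (x + h *\<^sub>R e) - snd p) * f (snd p) - P (fst p, E (fst p) (x - e) - snd p) * f (snd p)" for p
    proof -
      let ?t = "fst p" let ?z = "E (fst p) x - snd p"
      have line: "E ?t (x + \<rho> *\<^sub>R e) - snd p = ?z + \<rho> *\<^sub>R E ?t e" for \<rho>
        by (simp add: flow_line)
      have "(\<integral>\<rho>. indicat_real {-1..h} \<rho> *\<^sub>R P' (?t, ?z + \<rho> *\<^sub>R E ?t e) \<partial>lborel) = P (?t, ?z + h *\<^sub>R E ?t e) - P (?t, ?z + (-1) *\<^sub>R E ?t e)"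
        by (rule integral_FTC_Icc[OF h has_vector_derivative_at_within[OF deriv] continuous_on_subset[OF cont]]) auto
      moreover have "(\<integral>\<rho>. ?g \<rho> p \<partial>lborel) = (\<integral>\<rho>. indicat_real {-1..h} \<rho> *\<^sub>R P' (?t, ?z + \<rho> *\<^sub>R E ?t e) \<partial>lborel) * f (snd p)"
        unfolding line integral_mult_left_zero [symmetric] by (intro Bochner_Integration.integral_cong refl) simp
      moreover have "x - e = x + (-1) *\<^sub>R e" by simp
      ultimately show ?thesis by (simp only: line left_diff_distrib)
    qed
    have "conv P f (x + h *\<^sub>R e) - conv P f (x - e) = (\<integral>p. \<integral>\<rho>. ?g \<rho> p \<partial>lborel \<partial>N)"
      unfolding 2 unfolding conv_def
      by (intro Bochner_Integration.integral_diff[symmetric] conv_kernel_integrable(1)[OF P fm flow_measurable_time B])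
    thus ?thesis using 1 by simp
  qed
  have "((\<lambda>h. integral {-1..h} ?W) has_vector_derivative ?W 0) (at 0 within {-1..1})"
    by (rule integral_has_vector_derivative) (auto intro: continuous_on_subset[OF Wc])
  hence "((\<lambda>h. integral {-1..h} ?W) has_vector_derivative ?W 0) (at 0)"
    by (simp add: at_within_interior[of 0 "{-1..1}"])
  hence "((\<lambda>h. conv P f (x - e) + integral {-1..h} ?W) has_vector_derivative ?W 0) (at 0)"
    by (auto intro!: derivative_eq_intros)
  hence "((\<lambda>h. conv P f (x + h *\<^sub>R e)) has_vector_derivative ?W 0) (at 0)"
  proof (rule has_vector_derivative_transform_within_open)
    show "conv P f (x - e) + integral {-1..h} ?W = conv P f (x + h *\<^sub>R e)" if "h \<in> {-1<..<1}" for h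
      by (subst incr[symmetric]) (use that in auto)
  qed auto
  thus ?thesis by simp
qed

end

section \<open>Scalar semigroup and resolvent\<close>

text \<open>One diagonal entry of \<open>OU_kernel\<close>, for eigenvalues \<open>l\<close> of
  \<open>A\<close> and \<open>b\<close> of \<open>B\<close>, in terms of the displacement
  \<open>z\<close>. The positive factor \<open>4 * pi * t\<close> is kept out of the complex power,
  so that only the power of \<open>l\<close> depends on a branch.\<close>

definition ou_scalar_kernel :: "complex \<Rightarrow> complex \<Rightarrow> real \<Rightarrow> 'a::euclidean_space \<Rightarrow> complex" where
  "ou_scalar_kernel l b t z =
     of_real ((4 * pi * t) powr (- (real DIM('a) / 2))) * l powr (- of_real (real DIM('a) / 2))
     * exp (- (of_real t * b) - of_real ((norm z)\<^sup>2) / (of_real (4 * t) * l))"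

lemma norm_powr_of_real: "z \<noteq> 0 \<Longrightarrow> cmod (z powr of_real x) = cmod z powr x"
  by (simp add: powr_def)

lemma Re_of_real_mult: "Re (of_real r * z) = r * Re z"
  by simp

lemma Re_inverse_eq: "Re (1 / l) = Re l / (cmod l)\<^sup>2"
  by (simp add: Re_divide cmod_power2)

lemma norm_ou_scalar_kernel:
  fixes z :: "'a::euclidean_space"
  assumes l: "Re l > 0" and t: "t > 0"
  shows "cmod (ou_scalar_kernel l b t z) = (4 * pi * cmod l) powr (- (real DIM('a) / 2)) * t powr (- (real DIM('a) / 2))
     * exp (- t * Re b) * exp (- (Re l / (4 * (cmod l)\<^sup>2)) * (norm z)\<^sup>2 / t)"
proof -
  have l0: "l \<noteq> 0" using l by auto
  have "of_real ((norm z)\<^sup>2) / (of_real (4 * t) * l) = of_real ((norm z)\<^sup>2 / (4 * t)) * (1 / l)"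
    by simp
  hence "Re (of_real ((norm z)\<^sup>2) / (of_real (4 * t) * l)) = Re (of_real ((norm z)\<^sup>2 / (4 * t)) * (1 / l))"
    by (simp only:)
  also have "\<dots> = (norm z)\<^sup>2 / (4 * t) * (Re l / (cmod l)\<^sup>2)"
    unfolding Re_inverse_eq [symmetric] by (rule Re_of_real_mult)
  finally have re: "Re (- (of_real t * b) - of_real ((norm z)\<^sup>2) / (of_real (4 * t) * l))
      = - t * Re b + - (Re l / (4 * (cmod l)\<^sup>2)) * (norm z)\<^sup>2 / t"
    by (simp add: mult_ac)
  have "cmod (l powr (- of_real (real DIM('a) / 2))) = cmod l powr (- (real DIM('a) / 2))"
    using norm_powr_of_real[OF l0, of "- (real DIM('a) / 2)"] by simp
  moreover have "(4 * pi * t) powr (- (real DIM('a) / 2)) * cmod l powr (- (real DIM('a) / 2)) =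
      (4 * pi * cmod l) powr (- (real DIM('a) / 2)) * t powr (- (real DIM('a) / 2))"
    using t by (simp add: powr_mult mult_ac)
  ultimately show ?thesis
    unfolding ou_scalar_kernel_def norm_mult norm_exp_eq_Re re exp_add by simp
qed

lemma ou_scalar_kernel_measurable [measurable (raw)]:
  assumes [measurable]: "f \<in> borel_measurable M" "g \<in> borel_measurable M"
  shows "(\<lambda>x. ou_scalar_kernel l b (f x) (g x :: 'a::euclidean_space)) \<in> borel_measurable M"
  unfolding ou_scalar_kernel_def by measurable

text \<open>The modulus is a Gaussian of rate Re l / (4 |l|^2 t). Its mass exceeds
  \<open>exp (- t * Re b)\<close> unless \<open>l\<close> is real, because taking absolute values
  discards the oscillation.\<close>

lemma integrable_ou_scalar_kernel:
  assumes l: "Re l > 0" and t: "t > 0"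
  shows "integrable lborel (ou_scalar_kernel l b t :: 'a::euclidean_space \<Rightarrow> complex)"
    and "(\<integral>z. cmod (ou_scalar_kernel l b t (z::'a)) \<partial>lborel) = (cmod l / Re l) powr (real DIM('a) / 2) * exp (- t * Re b)"
proof -
  let ?d = "real DIM('a) / 2" and ?c = "Re l / (4 * (cmod l)\<^sup>2) / t"
  have l0: "cmod l > 0" using l by auto
  have c: "?c > 0" using l t l0 by simp
  have eq: "cmod (ou_scalar_kernel l b t z) = (4 * pi * cmod l) powr (- ?d) * t powr (- ?d) * exp (- t * Re b) * exp (- ?c * (norm z)\<^sup>2)" for z :: 'a
    unfolding norm_ou_scalar_kernel[OF l t] by simp
  have int: "integrable lborel (\<lambda>z::'a. exp (- ?c * (norm z)\<^sup>2))"
    using integrable_gaussian_norm_power[OF c, of 0, where ?'a = 'a] by (simp only: power_0 mult_1)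
  show "integrable lborel (ou_scalar_kernel l b t :: 'a \<Rightarrow> complex)"
  proof (rule Bochner_Integration.integrable_bound)
    show "integrable lborel (\<lambda>z::'a. (4 * pi * cmod l) powr (- ?d) * t powr (- ?d) * exp (- t * Re b) * exp (- ?c * (norm z)\<^sup>2))"
      by (intro integrable_mult_right int)
    show "AE z in lborel. cmod (ou_scalar_kernel l b t z) \<le> norm ((4 * pi * cmod l) powr (- ?d) * t powr (- ?d) * exp (- t * Re b) * exp (- ?c * (norm (z::'a))\<^sup>2))"
      unfolding eq by simp
  qed measurable
  have "(4 * pi * cmod l) powr (- ?d) * t powr (- ?d) * (pi powr ?d * ?c powr (- ?d)) = (cmod l / Re l) powr ?d"
  proof -
    have "cmod l / Re l = inverse (4 * pi * cmod l) * inverse t * (pi * inverse ?c)"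
      using l t l0 by (simp add: field_simps power2_eq_square)
    hence "(cmod l / Re l) powr ?d = inverse (4 * pi * cmod l) powr ?d * inverse t powr ?d * (pi powr ?d * inverse ?c powr ?d)"
      using l t l0 c by (simp only: powr_mult)
    thus ?thesis unfolding inverse_powr powr_minus by (simp only: mult_ac)
  qed
  moreover have "(\<integral>z. cmod (ou_scalar_kernel l b t (z::'a)) \<partial>lborel) =
      (4 * pi * cmod l) powr (- ?d) * t powr (- ?d) * exp (- t * Re b) * (\<integral>z. exp (- ?c * (norm (z::'a))\<^sup>2) \<partial>lborel)"
    unfolding eq by (rule integral_mult_right_zero)
  ultimately show "(\<integral>z. cmod (ou_scalar_kernel l b t (z::'a)) \<partial>lborel) = (cmod l / Re l) powr ?d * exp (- t * Re b)"
    unfolding integral_real_gaussian[OF c] by (simp only: mult_ac)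
qed

text \<open>Completing the square produces a \<^emph>\<open>real\<close> centre, although the diffusion coefficient is complex.\<close>

lemma complete_square:
  fixes y z \<xi> :: "'a::euclidean_space"
  assumes "s > 0" "h > 0"
  shows "(norm (y - \<xi>))\<^sup>2 / s + (norm (\<xi> - z))\<^sup>2 / h =
    (s + h) / (s * h) * (norm (\<xi> - (1 / (s + h)) *\<^sub>R (h *\<^sub>R y + s *\<^sub>R z)))\<^sup>2 + (norm (y - z))\<^sup>2 / (s + h)"
proof -
  define u v where "u = \<xi> - y" and "v = \<xi> - z"
  have sh: "s + h > 0" using assms by simp
  have "\<xi> - (1 / (s + h)) *\<^sub>R (h *\<^sub>R y + s *\<^sub>R z) = (1 / (s + h)) *\<^sub>R ((s + h) *\<^sub>R \<xi> - (h *\<^sub>R y + s *\<^sub>R z))"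
    using sh by (simp add: scaleR_diff_right)
  also have "(s + h) *\<^sub>R \<xi> - (h *\<^sub>R y + s *\<^sub>R z) = h *\<^sub>R u + s *\<^sub>R v"
    unfolding u_def v_def by (simp add: algebra_simps)
  finally have 1: "\<xi> - (1 / (s + h)) *\<^sub>R (h *\<^sub>R y + s *\<^sub>R z) = (1 / (s + h)) *\<^sub>R (h *\<^sub>R u + s *\<^sub>R v)" .
  have 2: "y - z = v - u" "y - \<xi> = - u" unfolding u_def v_def by simp_all
  have n1: "(norm (h *\<^sub>R u + s *\<^sub>R v))\<^sup>2 = h\<^sup>2 * (u \<bullet> u) + 2 * (h * s * (u \<bullet> v)) + s\<^sup>2 * (v \<bullet> v)"
    unfolding power2_norm_eq_inner
    by (simp add: inner_add_left inner_add_right inner_commute power2_eq_square algebra_simps)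
  have n2: "(norm (v - u))\<^sup>2 = u \<bullet> u - 2 * (u \<bullet> v) + v \<bullet> v"
    by (simp add: power2_norm_eq_inner inner_diff_left inner_diff_right inner_commute)
  have n3: "(norm (- u))\<^sup>2 = u \<bullet> u" "(norm v)\<^sup>2 = v \<bullet> v" by (simp_all add: power2_norm_eq_inner)
  have "a / s + b / h = (s + h) / (s * h) * ((1 / (s + h))\<^sup>2 * (h\<^sup>2 * a + 2 * (h * s * c) + s\<^sup>2 * b)) + (a - 2 * c + b) / (s + h)" for a b c :: real
  proof -
    have "(s + h) / (s * h) * ((1 / (s + h))\<^sup>2 * (h\<^sup>2 * a + 2 * (h * s * c) + s\<^sup>2 * b)) = (h\<^sup>2 * a + 2 * (h * s * c) + s\<^sup>2 * b) / (s * h * (s + h))"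
    proof -
      have "q / w * ((1 / q)\<^sup>2 * x) = x / (w * q)" if "q \<noteq> 0" for q w x :: real
        using that by (simp add: power2_eq_square)
      from this[of "s + h"] show ?thesis using sh by simp
    qed
    also have "\<dots> + (a - 2 * c + b) / (s + h) = (h\<^sup>2 * a + 2 * (h * s * c) + s\<^sup>2 * b + s * h * (a - 2 * c + b)) / (s * h * (s + h))"
      using assms sh by (simp add: add_divide_distrib)
    also have "h\<^sup>2 * a + 2 * (h * s * c) + s\<^sup>2 * b + s * h * (a - 2 * c + b) = (s + h) * (h * a + s * b)"
      by (simp add: power2_eq_square algebra_simps)
    also have "(s + h) * (h * a + s * b) / (s * h * (s + h)) = a / s + b / h"
    proof -
      have "(s + h) * (h * a + s * b) / (s * h * (s + h)) = (h * a + s * b) / (s * h)" using sh by simp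
      thus ?thesis using assms by (simp add: field_simps)
    qed
    finally show ?thesis by simp
  qed
  from this[of "u \<bullet> u" "v \<bullet> v" "u \<bullet> v"] show ?thesis
    unfolding 1 2 norm_scaleR power_mult_distrib n1 n2 n3 v_def[symmetric] by (simp add: power_divide)
qed

text \<open>Because the square is completed about a real point, a reflection of space reduces the
  integral to a centred Gaussian of complex rate (s + h) / (4 s h l), whose real part is positive
  along with that of \<open>1 / l\<close>. The rest is bookkeeping of powers.\<close>

lemma ou_scalar_kernel_chapman_kolmogorov:
  fixes y z :: "'a::euclidean_space"
  assumes l: "Re l > 0" and s: "s > 0" and h: "h > 0"
  shows "(\<integral>\<xi>. ou_scalar_kernel l b s (y - \<xi>) * ou_scalar_kernel l b h (\<xi> - z) \<partial>lborel) = ou_scalar_kernel l b (s + h) (y - z)"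
proof -
  let ?d = "real DIM('a) / 2"
  let ?c = "(1 / (s + h)) *\<^sub>R (h *\<^sub>R y + s *\<^sub>R z)"
  let ?r = "(s + h) / (4 * (s * h))"
  let ?a = "of_real ?r * (1 / l)"
  let ?p = "\<lambda>t. complex_of_real ((4 * pi * t) powr (- ?d))"
  let ?l = "l powr (- of_real ?d)"
  have l0: "l \<noteq> 0" using l by auto
  have r: "?r > 0" using s h by simp
  have Re: "Re ?a > 0" unfolding Re_of_real_mult Re_inverse_eq 
    by (rule mult_pos_pos[OF r]) (use l l0 in simp)
  have expo: "- (of_real s * b) - of_real ((norm (y - \<xi>))\<^sup>2) / (of_real (4 * s) * l) + (- (of_real h * b) - of_real ((norm (\<xi> - z))\<^sup>2) / (of_real (4 * h) * l))
     = - ?a * of_real ((norm (\<xi> - ?c))\<^sup>2) + (- (of_real (s + h) * b) - of_real ((norm (y - z))\<^sup>2) / (of_real (4 * (s + h)) * l))" for \<xi>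
  proof -
    have "of_real ((norm (y - \<xi>))\<^sup>2) / (of_real (4 * s) * l) + of_real ((norm (\<xi> - z))\<^sup>2) / (of_real (4 * h) * l)
      = of_real ((norm (y - \<xi>))\<^sup>2 / s + (norm (\<xi> - z))\<^sup>2 / h) * (1 / (4 * l))"
      using s h l0 by (simp add: field_simps)
    also have "\<dots> = ?a * of_real ((norm (\<xi> - ?c))\<^sup>2) + of_real ((norm (y - z))\<^sup>2) / (of_real (4 * (s + h)) * l)"
    proof -
      have "of_real (a * u + v / q) * (1 / (4 * l)) = of_real (a / 4) * (1 / l) * of_real u + of_real v / (of_real (4 * q) * l)" for a u v q
        by (simp add: add_divide_distrib)
      moreover have "(s + h) / (s * h) / 4 = ?r" by simp
      ultimately show ?thesis unfolding complete_square[OF s h] by metis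
    qed
    finally show ?thesis by (simp add: algebra_simps)
  qed
  have "(\<integral>\<xi>. ou_scalar_kernel l b s (y - \<xi>) * ou_scalar_kernel l b h (\<xi> - z) \<partial>lborel)
     = (\<integral>\<xi>. (?p s * ?p h * ?l * ?l * exp (- (of_real (s + h) * b) - of_real ((norm (y - z))\<^sup>2) / (of_real (4 * (s + h)) * l)))
          * exp (- ?a * of_real ((norm (\<xi> - ?c))\<^sup>2)) \<partial>lborel)"
  proof (rule Bochner_Integration.integral_cong[OF refl])
    fix \<xi>
    have "ou_scalar_kernel l b s (y - \<xi>) * ou_scalar_kernel l b h (\<xi> - z) = ?p s * ?p h * ?l * ?l *
      exp (- (of_real s * b) - of_real ((norm (y - \<xi>))\<^sup>2) / (of_real (4 * s) * l) + (- (of_real h * b) - of_real ((norm (\<xi> - z))\<^sup>2) / (of_real (4 * h) * l)))"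
      unfolding ou_scalar_kernel_def exp_add by (simp only: mult_ac)
    thus "ou_scalar_kernel l b s (y - \<xi>) * ou_scalar_kernel l b h (\<xi> - z) = (?p s * ?p h * ?l * ?l * exp (- (of_real (s + h) * b) - of_real ((norm (y - z))\<^sup>2) / (of_real (4 * (s + h)) * l)))
          * exp (- ?a * of_real ((norm (\<xi> - ?c))\<^sup>2))"
      unfolding expo exp_add by (simp only: mult_ac)
  qed
  also have "\<dots> = (?p s * ?p h * ?l * ?l * exp (- (of_real (s + h) * b) - of_real ((norm (y - z))\<^sup>2) / (of_real (4 * (s + h)) * l)))
      * (\<integral>\<xi>. exp (- ?a * of_real ((norm (\<xi> - ?c))\<^sup>2)) \<partial>lborel)"
    by (rule integral_mult_right_zero)
  also have "(\<integral>\<xi>. exp (- ?a * of_real ((norm (\<xi> - ?c))\<^sup>2)) \<partial>lborel) = (\<integral>\<xi>. exp (- ?a * of_real ((norm (?c - \<xi>))\<^sup>2)) \<partial>lborel)"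
    by (simp only: norm_minus_commute)
  also have "\<dots> = (\<integral>(\<xi>::'a). exp (- ?a * of_real ((norm \<xi>)\<^sup>2)) \<partial>lborel)"
    by (rule integral_lborel_reflect[of "\<lambda>\<xi>. exp (- ?a * of_real ((norm \<xi>)\<^sup>2))"]) measurable
  also have "\<dots> = of_real (pi powr ?d) * ?a powr (- of_real ?d)"
    by (rule integral_complex_gaussian[OF Re])
  \<comment> \<open>Splitting a complex power over a product is safe here because \<open>?r\<close>
    is a positive real.\<close>
  also have "?a powr (- of_real ?d) = of_real (?r powr (- ?d)) * (1 / l) powr (- of_real ?d)"
  proof -
    have "(of_real ?r * (1 / l)) powr (- of_real ?d) = of_real ?r powr (- of_real ?d) * (1 / l) powr (- of_real ?d)"
      by (rule powr_times_real_left) (use r in auto)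
    also have "of_real ?r powr (- of_real ?d) = complex_of_real (?r powr (- ?d))"
      using powr_of_real[of ?r "- ?d"] r by simp
    finally show ?thesis .
  qed
  also have "(?p s * ?p h * ?l * ?l * exp (- (of_real (s + h) * b) - of_real ((norm (y - z))\<^sup>2) / (of_real (4 * (s + h)) * l)))
       * (of_real (pi powr ?d) * (of_real (?r powr (- ?d)) * (1 / l) powr (- of_real ?d)))
     = (?p s * ?p h * of_real (pi powr ?d) * of_real (?r powr (- ?d))) * (?l * (1 / l) powr (- of_real ?d)) *
       ?l * exp (- (of_real (s + h) * b) - of_real ((norm (y - z))\<^sup>2) / (of_real (4 * (s + h)) * l))"
    by (simp only: mult_ac)
  \<comment> \<open>Off the nonpositive real axis \<open>Ln (1 / l) = - Ln l\<close>, so the power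
    of \<open>1 / l\<close> cancels one of the two powers of \<open>l\<close> and the normalisation
    of a single kernel survives.\<close>
  also have "?l * (1 / l) powr (- of_real ?d) = 1"
  proof -
    have "l \<notin> \<real>\<^sub>\<le>\<^sub>0" using l by (auto simp: complex_nonpos_Reals_iff)
    hence "Ln (1 / l) = - Ln l" using Ln_inverse[of l] by (simp add: inverse_eq_divide)
    thus ?thesis using l0 by (simp add: powr_def flip: exp_add)
  qed
  also have "?p s * ?p h * of_real (pi powr ?d) * of_real (?r powr (- ?d)) = ?p (s + h)"
  proof -
    have "(4 * pi * s) powr (- ?d) * (4 * pi * h) powr (- ?d) * pi powr ?d * ?r powr (- ?d) = (4 * pi * (s + h)) powr (- ?d)"
    proof -
      have "pi powr ?d = (1 / pi) powr (- ?d)" by (simp add: powr_divide powr_minus_divide)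
      hence "(4 * pi * s) powr (- ?d) * (4 * pi * h) powr (- ?d) * pi powr ?d * ?r powr (- ?d)
        = ((4 * pi * s) * (4 * pi * h) * (1 / pi) * ?r) powr (- ?d)"
        using s h r by (simp only: powr_mult)
      also have "(4 * pi * s) * (4 * pi * h) * (1 / pi) * ?r = 4 * pi * (s + h)"
        using s h by (simp add: field_simps)
      finally show ?thesis .
    qed
    thus ?thesis by (simp only: of_real_mult [symmetric])
  qed
  finally show ?thesis unfolding ou_scalar_kernel_def by simp
qed

section \<open>Laplace transforms and averages in time\<close>

lemma indicator_greaterThan_exp:
  assumes "\<mu> > 0"
  shows "integrable lborel (\<lambda>t::real. indicator {0<..} t * exp (- \<mu> * t))"
    and "(\<integral>t. indicator {0<..} t * exp (- \<mu> * t) \<partial>lborel) = 1 / \<mu>"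
proof -
  have "(\<integral>\<^sup>+t. ennreal (indicator {0<..} t * exp (- \<mu> * t)) \<partial>lborel)
     = (\<integral>\<^sup>+t. ennreal (indicator {0<..} t * (t powr (1 - 1) * exp (- \<mu> * t))) \<partial>lborel)"
    by (intro nn_integral_cong) (auto simp: indicator_def)
  also have "\<dots> = ennreal (Gamma 1 * \<mu> powr (- 1))"
    by (rule nn_integral_gamma) (use assms in auto)
  also have "Gamma 1 * \<mu> powr (- 1) = 1 / \<mu>"
    using assms by (simp add: powr_minus_divide)
  finally have "integrable lborel (\<lambda>t::real. indicator {0<..} t * exp (- \<mu> * t)) \<and>
     (\<integral>t. indicator {0<..} t * exp (- \<mu> * t) \<partial>lborel) = 1 / \<mu>"
    using assms by (subst (asm) nn_integral_eq_integrable) auto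
  thus "integrable lborel (\<lambda>t::real. indicator {0<..} t * exp (- \<mu> * t))"
    "(\<integral>t. indicator {0<..} t * exp (- \<mu> * t) \<partial>lborel) = 1 / \<mu>" by auto
qed

text \<open>Differentiation of an integral at its endpoint, for an integrand that is merely
  measurable and bounded with a limit at 0: this is what is known of an orbit of the semigroup when
  the lemma is applied.\<close>

lemma average_at_zero:
  fixes \<Phi> :: "real \<Rightarrow> complex"
  assumes [measurable]: "\<Phi> \<in> borel_measurable borel"
    and B: "\<And>t. t > 0 \<Longrightarrow> cmod (\<Phi> t) \<le> B" and lim: "(\<Phi> \<longlongrightarrow> L) (at_right 0)"
  shows "((\<lambda>h. (1 / of_real h) * (\<integral>t. indicator {0<..h} t *\<^sub>R \<Phi> t \<partial>lborel)) \<longlongrightarrow> L) (at_right 0)"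
proof (rule tendstoI)
  fix e :: real assume e: "e > 0"
  have int: "integrable lborel (\<lambda>t. indicator {0<..h} t *\<^sub>R \<Phi> t)" if "h > 0" for h
  proof (rule Bochner_Integration.integrable_bound)
    show "integrable lborel (\<lambda>t. indicat_real {0<..h} t * B)"
      by (intro integrable_mult_left integrable_real_indicator) (use that in auto)
    show "AE t in lborel. norm (indicator {0<..h} t *\<^sub>R \<Phi> t) \<le> norm (indicat_real {0<..h} t * B)"
      by (intro AE_I2) (use B in \<open>fastforce simp: indicator_def\<close>)
  qed measurable
  from tendstoD[OF lim, of "e / 2"] e obtain c where c: "c > 0" "\<And>t. 0 < t \<Longrightarrow> t < c \<Longrightarrow> dist (\<Phi> t) L < e / 2"
    unfolding eventually_at_right_field by auto
  have "dist ((1 / of_real h) * (\<integral>t. indicator {0<..h} t *\<^sub>R \<Phi> t \<partial>lborel)) L < e" if h: "0 < h" "h < c" for h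
  proof -
    have intL: "integrable lborel (\<lambda>t. indicat_real {0<..h} t *\<^sub>R L)"
      by (intro integrable_scaleR_left integrable_real_indicator) (use h in auto)
    have "(\<integral>t. indicat_real {0<..h} t *\<^sub>R L \<partial>lborel) = of_real h * L"
      using h by (simp add: scaleR_conv_of_real)
    hence "(1 / of_real h) * (\<integral>t. indicator {0<..h} t *\<^sub>R \<Phi> t \<partial>lborel) - L =
        (1 / of_real h) * ((\<integral>t. indicator {0<..h} t *\<^sub>R \<Phi> t \<partial>lborel) - (\<integral>t. indicat_real {0<..h} t *\<^sub>R L \<partial>lborel))"
      using h by (simp add: field_simps)
    also have "(\<integral>t. indicator {0<..h} t *\<^sub>R \<Phi> t \<partial>lborel) - (\<integral>t. indicat_real {0<..h} t *\<^sub>R L \<partial>lborel)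
        = (\<integral>t. indicator {0<..h} t *\<^sub>R \<Phi> t - indicat_real {0<..h} t *\<^sub>R L \<partial>lborel)"
      by (rule Bochner_Integration.integral_diff[symmetric, OF int[OF h(1)] intL])
    finally have eq: "cmod ((1 / of_real h) * (\<integral>t. indicator {0<..h} t *\<^sub>R \<Phi> t \<partial>lborel) - L)
        = (1 / h) * cmod (\<integral>t. indicator {0<..h} t *\<^sub>R \<Phi> t - indicat_real {0<..h} t *\<^sub>R L \<partial>lborel)"
      using h by (simp add: norm_mult norm_divide)
    have "cmod (\<integral>t. indicator {0<..h} t *\<^sub>R \<Phi> t - indicat_real {0<..h} t *\<^sub>R L \<partial>lborel) \<le> (\<integral>t. indicat_real {0<..h} t * (e / 2) \<partial>lborel)"
    proof (rule order.trans[OF integral_norm_bound], rule integral_mono)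
      show "integrable lborel (\<lambda>t. indicat_real {0<..h} t * (e / 2))"
        by (intro integrable_mult_left integrable_real_indicator) (use h in auto)
      show "integrable lborel (\<lambda>t. cmod (indicator {0<..h} t *\<^sub>R \<Phi> t - indicat_real {0<..h} t *\<^sub>R L))"
        by (intro integrable_norm Bochner_Integration.integrable_diff int intL h)
      show "cmod (indicator {0<..h} t *\<^sub>R \<Phi> t - indicat_real {0<..h} t *\<^sub>R L) \<le> indicat_real {0<..h} t * (e / 2)" for t
        using c(2)[of t] h by (auto simp: indicator_def dist_norm less_imp_le)
    qed
    also have "(\<integral>t. indicat_real {0<..h} t * (e / 2) \<partial>lborel) = h * (e / 2)"
      using h by simp
    finally have "cmod ((1 / of_real h) * (\<integral>t. indicator {0<..h} t *\<^sub>R \<Phi> t \<partial>lborel) - L) \<le> (1 / h) * (h * (e / 2))"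
      unfolding eq by (rule mult_left_mono) (use h in simp)
    also have "\<dots> < e" using h e by simp
    finally show ?thesis by (simp only: dist_norm)
  qed
  thus "\<forall>\<^sub>F h in at_right 0. dist ((1 / of_real h) * (\<integral>t. indicator {0<..h} t *\<^sub>R \<Phi> t \<partial>lborel)) L < e"
    unfolding eventually_at_right_field using c(1) by blast
qed

text \<open>The L1 norm of the scalar kernel apart from its factor
  \<open>exp (- t * Re b)\<close>.\<close>

definition kernel_mass :: "nat \<Rightarrow> complex \<Rightarrow> real" where
  "kernel_mass d l = (cmod l / Re l) powr (real d / 2)"

lemma kernel_mass_nonneg [simp]: "kernel_mass d l \<ge> 0"
  by (simp add: kernel_mass_def)

context isometric_flow
begin

text \<open>At \<open>t = 0\<close> this gives 0 instead of \<open>f\<close>, since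
  \<open>0 powr s = 0\<close>; the identity appears only as a limit from the right.\<close>

definition ou_op :: "complex \<Rightarrow> complex \<Rightarrow> real \<Rightarrow> ('a \<Rightarrow> complex) \<Rightarrow> 'a \<Rightarrow> complex" where
  "ou_op l b t f x = (\<integral>\<xi>. ou_scalar_kernel l b t (E t x - \<xi>) * f \<xi> \<partial>lborel)"

lemma flow_joint_measurable [measurable (raw)]:
  assumes [measurable]: "f \<in> borel_measurable M"
  shows "(\<lambda>x. E t (f x)) \<in> borel_measurable M"
  by (rule measurable_compose[OF assms flow_measurable_space])

lemma ou_op_measurable_time:
  assumes [measurable]: "f \<in> borel_measurable borel"
  shows "(\<lambda>t. ou_op l b t f x) \<in> borel_measurable borel"
proof -
  have "(\<lambda>t. ou_op l b t f x) \<in> borel_measurable lborel"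
    unfolding ou_op_def by measurable
  thus ?thesis by simp
qed

lemma ou_op_measurable_space:
  assumes [measurable]: "f \<in> borel_measurable borel"
  shows "(\<lambda>x. ou_op l b t f x) \<in> borel_measurable borel"
proof -
  have "(\<lambda>x. ou_op l b t f x) \<in> borel_measurable lborel"
    unfolding ou_op_def by measurable
  thus ?thesis by simp
qed

lemma ou_op_integrable:
  fixes y :: 'a
  assumes l: "Re l > 0" and t: "t > 0" and [measurable]: "f \<in> borel_measurable borel" and B: "\<And>x. cmod (f x) \<le> B"
  shows "integrable lborel (\<lambda>\<xi>. ou_scalar_kernel l b t (y - \<xi>) * f \<xi>)"
    and "(\<integral>\<xi>. cmod (ou_scalar_kernel l b t (y - \<xi>) * f \<xi>) \<partial>lborel) \<le> kernel_mass DIM('a) l * exp (- t * Re b) * B"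
proof -
  note k = integrable_ou_scalar_kernel[OF l t, of b, where ?'a = 'a]
  have ik: "integrable lborel (\<lambda>\<xi>. cmod (ou_scalar_kernel l b t (y - \<xi>)) * B)"
    using integrable_norm[OF integrable_lborel_reflect[OF k(1), of y]] by simp
  have B0: "B \<ge> 0" using B[of 0] norm_ge_zero[of "f 0"] by linarith
  show int: "integrable lborel (\<lambda>\<xi>. ou_scalar_kernel l b t (y - \<xi>) * f \<xi>)"
    by (rule Bochner_Integration.integrable_bound[OF ik]) (use B B0 in \<open>auto simp: norm_mult intro!: mult_left_mono\<close>)
  have "(\<integral>\<xi>. cmod (ou_scalar_kernel l b t (y - \<xi>) * f \<xi>) \<partial>lborel) \<le> (\<integral>\<xi>. cmod (ou_scalar_kernel l b t (y - \<xi>)) * B \<partial>lborel)"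
    by (intro integral_mono integrable_norm int ik) (use B in \<open>auto simp: norm_mult intro!: mult_left_mono\<close>)
  also have "\<dots> = (\<integral>\<xi>. cmod (ou_scalar_kernel l b t (y - \<xi>)) \<partial>lborel) * B"
    by (rule integral_mult_left_zero)
  also have "(\<integral>\<xi>. cmod (ou_scalar_kernel l b t (y - \<xi>)) \<partial>lborel) = (\<integral>(\<xi>::'a). cmod (ou_scalar_kernel l b t \<xi>) \<partial>lborel)"
    by (rule integral_lborel_reflect[of "\<lambda>\<xi>. cmod (ou_scalar_kernel l b t \<xi>)"]) measurable
  finally show "(\<integral>\<xi>. cmod (ou_scalar_kernel l b t (y - \<xi>) * f \<xi>) \<partial>lborel) \<le> kernel_mass DIM('a) l * exp (- t * Re b) * B"
    unfolding k(2) kernel_mass_def .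
qed

lemma ou_op_bound:
  assumes "Re l > 0" "t > 0" "f \<in> borel_measurable borel" "\<And>x. cmod (f x) \<le> B"
  shows "cmod (ou_op l b t f x) \<le> kernel_mass DIM('a) l * exp (- t * Re b) * B"
  unfolding ou_op_def by (rule order.trans[OF integral_norm_bound ou_op_integrable(2)[OF assms]])

text \<open>The kernel depends only on the norm of its argument, so the inner rotation can be moved
  to the other variable: |E h \<xi> - \<eta>| = |\<xi> - E (- h) \<eta>|. After Fubini the
  \<xi>-integral is the Chapman-Kolmogorov integral, and a second use of the isometry turns the
  result into the kernel at time \<open>s + h\<close>.\<close>

lemma ou_op_semigroup:
  assumes l: "Re l > 0" and s: "s > 0" and h: "h > 0" and [measurable]: "f \<in> borel_measurable borel"
    and B: "\<And>x. cmod (f x) \<le> B"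
  shows "ou_op l b s (ou_op l b h f) x = ou_op l b (s + h) f x"
proof -
  let ?k = "ou_scalar_kernel l b"
  let ?g = "\<lambda>\<xi> \<eta>. ?k s (E s x - \<xi>) * (?k h (E h \<xi> - \<eta>) * f \<eta>)"
  have gm: "case_prod ?g \<in> borel_measurable (lborel \<Otimes>\<^sub>M lborel)" by measurable
  note ih = ou_op_integrable[OF l h \<open>f \<in> _\<close> B, of b]
  have B0: "B \<ge> 0" using B[of 0] norm_ge_zero[of "f 0"] by linarith
  have "integrable (lborel \<Otimes>\<^sub>M lborel) (case_prod ?g)"
  proof (rule lborel_pair.Fubini_integrable[OF gm])
    show "integrable lborel (\<lambda>\<xi>. \<integral>\<eta>. norm (case_prod ?g (\<xi>, \<eta>)) \<partial>lborel)"
    proof (rule Bochner_Integration.integrable_bound)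
      show "integrable lborel (\<lambda>\<xi>. cmod (?k s (E s x - \<xi>)) * (kernel_mass DIM('a) l * exp (- h * Re b) * B))"
        by (intro integrable_mult_left integrable_norm integrable_lborel_reflect integrable_ou_scalar_kernel(1) l s)
      show "(\<lambda>\<xi>. \<integral>\<eta>. norm (case_prod ?g (\<xi>, \<eta>)) \<partial>lborel) \<in> borel_measurable lborel"
        using gm by measurable
      show "AE \<xi> in lborel. norm (\<integral>\<eta>. norm (case_prod ?g (\<xi>, \<eta>)) \<partial>lborel) \<le> norm (cmod (?k s (E s x - \<xi>)) * (kernel_mass DIM('a) l * exp (- h * Re b) * B))"
      proof (rule AE_I2)
        fix \<xi> :: 'a
        have "(\<integral>\<eta>. norm (case_prod ?g (\<xi>, \<eta>)) \<partial>lborel) = cmod (?k s (E s x - \<xi>)) * (\<integral>\<eta>. cmod (?k h (E h \<xi> - \<eta>) * f \<eta>) \<partial>lborel)"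
          by (simp add: norm_mult mult.assoc)
        also have "\<dots> \<le> cmod (?k s (E s x - \<xi>)) * (kernel_mass DIM('a) l * exp (- h * Re b) * B)"
          by (intro mult_left_mono ih) simp
        finally have "(\<integral>\<eta>. norm (case_prod ?g (\<xi>, \<eta>)) \<partial>lborel) \<le> \<dots>" .
        moreover have "(\<integral>\<eta>. norm (case_prod ?g (\<xi>, \<eta>)) \<partial>lborel) \<ge> 0" by (intro integral_nonneg_AE) auto
        ultimately show "norm (\<integral>\<eta>. norm (case_prod ?g (\<xi>, \<eta>)) \<partial>lborel) \<le> norm (cmod (?k s (E s x - \<xi>)) * (kernel_mass DIM('a) l * exp (- h * Re b) * B))"
          unfolding real_norm_def by linarith
      qed
    qed
    show "AE \<xi> in lborel. integrable lborel (\<lambda>\<eta>. case_prod ?g (\<xi>, \<eta>))"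
      by (intro AE_I2) (simp add: ih(1))
  qed
  from lborel_pair.Fubini_integral[OF this]
  have swap: "(\<integral>\<eta>. \<integral>\<xi>. ?g \<xi> \<eta> \<partial>lborel \<partial>lborel) = (\<integral>\<xi>. \<integral>\<eta>. ?g \<xi> \<eta> \<partial>lborel \<partial>lborel)" .
  have "ou_op l b s (ou_op l b h f) x = (\<integral>\<xi>. \<integral>\<eta>. ?g \<xi> \<eta> \<partial>lborel \<partial>lborel)"
    unfolding ou_op_def by simp
  also have "\<dots> = (\<integral>\<eta>. \<integral>\<xi>. ?g \<xi> \<eta> \<partial>lborel \<partial>lborel)" by (rule swap[symmetric])
  also have "\<dots> = (\<integral>\<eta>. ?k (s + h) (E (s + h) x - \<eta>) * f \<eta> \<partial>lborel)"
  proof (rule Bochner_Integration.integral_cong[OF refl])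
    fix \<eta>
    have inv: "E h (E (- h) \<eta>) = \<eta>" using flow_add[of h "- h" \<eta>] by (simp add: flow_zero)
    have 1: "?k h (E h \<xi> - \<eta>) = ?k h (\<xi> - E (- h) \<eta>)" for \<xi>
      unfolding ou_scalar_kernel_def using flow_dist[of h \<xi> "E (- h) \<eta>"] by (simp add: inv)
    have 2: "?k (s + h) (E s x - E (- h) \<eta>) = ?k (s + h) (E (s + h) x - \<eta>)"
      unfolding ou_scalar_kernel_def using flow_dist[of h "E s x" "E (- h) \<eta>"] flow_add[of h s x]
      by (simp add: inv add.commute)
    have "(\<integral>\<xi>. ?g \<xi> \<eta> \<partial>lborel) = (\<integral>\<xi>. ?k s (E s x - \<xi>) * ?k h (\<xi> - E (- h) \<eta>) * f \<eta> \<partial>lborel)"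
      unfolding 1 by (simp add: mult.assoc)
    also have "\<dots> = (\<integral>\<xi>. ?k s (E s x - \<xi>) * ?k h (\<xi> - E (- h) \<eta>) \<partial>lborel) * f \<eta>"
      by (rule integral_mult_left_zero)
    finally show "(\<integral>\<xi>. ?g \<xi> \<eta> \<partial>lborel) = ?k (s + h) (E (s + h) x - \<eta>) * f \<eta>"
      unfolding ou_scalar_kernel_chapman_kolmogorov[OF l s h] 2 .
  qed
  finally show ?thesis unfolding ou_op_def .
qed

definition resolvent :: "complex \<Rightarrow> complex \<Rightarrow> complex \<Rightarrow> ('a \<Rightarrow> complex) \<Rightarrow> 'a \<Rightarrow> complex" where
  "resolvent l b \<zeta> f x = (\<integral>t. indicator {0<..} t *\<^sub>R (exp (- \<zeta> * of_real t) * ou_op l b t f x) \<partial>lborel)"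

context
  fixes l b \<zeta> :: complex
  assumes l: "Re l > 0" and \<mu>: "Re \<zeta> + Re b > 0"
begin

lemma resolvent_integrand_bound:
  assumes f: "f \<in> borel_measurable borel" "\<And>x. cmod (f x) \<le> B" and t: "t > 0"
  shows "cmod (exp (- \<zeta> * of_real t) * ou_op l b t f x) \<le> kernel_mass DIM('a) l * B * exp (- (Re \<zeta> + Re b) * t)"
proof -
  have "cmod (exp (- \<zeta> * of_real t) * ou_op l b t f x) \<le> exp (- Re \<zeta> * t) * (kernel_mass DIM('a) l * exp (- t * Re b) * B)"
    unfolding norm_mult by (intro mult_mono ou_op_bound l t f) auto
  also have "\<dots> = kernel_mass DIM('a) l * B * exp (- (Re \<zeta> + Re b) * t)"
    by (simp add: exp_add [symmetric] algebra_simps)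
  finally show ?thesis .
qed

lemma resolvent_integrable:
  assumes f: "f \<in> borel_measurable borel" "\<And>x. cmod (f x) \<le> B"
  shows "integrable lborel (\<lambda>t. indicator {0<..} t *\<^sub>R (exp (- \<zeta> * of_real t) * ou_op l b t f x))"
proof (rule Bochner_Integration.integrable_bound)
  show "integrable lborel (\<lambda>t. kernel_mass DIM('a) l * B * (indicator {0<..} t * exp (- (Re \<zeta> + Re b) * t)))"
    by (intro integrable_mult_right indicator_greaterThan_exp \<mu>)
  show "AE t in lborel. norm (indicator {0<..} t *\<^sub>R (exp (- \<zeta> * of_real t) * ou_op l b t f x))
      \<le> norm (kernel_mass DIM('a) l * B * (indicator {0<..} t * exp (- (Re \<zeta> + Re b) * t)))"
  proof (rule AE_I2)
    fix t
    have "norm (indicator {0<..} t *\<^sub>R (exp (- \<zeta> * of_real t) * ou_op l b t f x))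
      \<le> kernel_mass DIM('a) l * B * (indicator {0<..} t * exp (- (Re \<zeta> + Re b) * t))"
      using resolvent_integrand_bound[OF f, of t x] by (auto simp: indicator_def)
    thus "norm (indicator {0<..} t *\<^sub>R (exp (- \<zeta> * of_real t) * ou_op l b t f x))
      \<le> norm (kernel_mass DIM('a) l * B * (indicator {0<..} t * exp (- (Re \<zeta> + Re b) * t)))"
      unfolding real_norm_def by linarith
  qed
  show "(\<lambda>t. indicator {0<..} t *\<^sub>R (exp (- \<zeta> * of_real t) * ou_op l b t f x)) \<in> borel_measurable lborel"
    using ou_op_measurable_time[OF f(1), of l b x] by measurable
qed

lemma resolvent_bound:
  assumes f: "f \<in> borel_measurable borel" "\<And>x. cmod (f x) \<le> B"
  shows "cmod (resolvent l b \<zeta> f x) \<le> kernel_mass DIM('a) l * B * (1 / (Re \<zeta> + Re b))"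
proof -
  have "cmod (resolvent l b \<zeta> f x) \<le> (\<integral>t. kernel_mass DIM('a) l * B * (indicator {0<..} t * exp (- (Re \<zeta> + Re b) * t)) \<partial>lborel)"
    unfolding resolvent_def
  proof (rule order.trans[OF integral_norm_bound], rule integral_mono)
    show "integrable lborel (\<lambda>t. kernel_mass DIM('a) l * B * (indicator {0<..} t * exp (- (Re \<zeta> + Re b) * t)))"
      by (intro integrable_mult_right indicator_greaterThan_exp \<mu>)
    show "norm (indicator {0<..} t *\<^sub>R (exp (- \<zeta> * of_real t) * ou_op l b t f x))
      \<le> kernel_mass DIM('a) l * B * (indicator {0<..} t * exp (- (Re \<zeta> + Re b) * t))" for t
      using resolvent_integrand_bound[OF f, of t x] by (auto simp: indicator_def)
  qed (intro integrable_norm resolvent_integrable[OF f])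
  also have "\<dots> = kernel_mass DIM('a) l * B * (1 / (Re \<zeta> + Re b))"
    unfolding integral_mult_right_zero indicator_greaterThan_exp(2)[OF \<mu>] ..
  finally show ?thesis .
qed

lemma ou_op_linear:
  assumes "t > 0" and f: "f \<in> borel_measurable borel" "\<And>x. cmod (f x) \<le> B"
    and g: "g \<in> borel_measurable borel" "\<And>x. cmod (g x) \<le> C"
  shows "ou_op l b t (\<lambda>x. c * f x + g x) x = c * ou_op l b t f x + ou_op l b t g x"
proof -
  have "ou_op l b t (\<lambda>x. c * f x + g x) x =
     (\<integral>\<xi>. c * (ou_scalar_kernel l b t (E t x - \<xi>) * f \<xi>) + ou_scalar_kernel l b t (E t x - \<xi>) * g \<xi> \<partial>lborel)"
    unfolding ou_op_def by (simp add: algebra_simps)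
  also have "\<dots> = (\<integral>\<xi>. c * (ou_scalar_kernel l b t (E t x - \<xi>) * f \<xi>) \<partial>lborel) + ou_op l b t g x"
    unfolding ou_op_def
    by (intro Bochner_Integration.integral_add integrable_mult_right ou_op_integrable(1)[OF l assms(1) f] ou_op_integrable(1)[OF l assms(1) g])
  finally show ?thesis unfolding integral_mult_right_zero by (simp only: ou_op_def)
qed

lemma resolvent_linear:
  assumes f: "f \<in> borel_measurable borel" "\<And>x. cmod (f x) \<le> B"
    and g: "g \<in> borel_measurable borel" "\<And>x. cmod (g x) \<le> C"
  shows "resolvent l b \<zeta> (\<lambda>x. c * f x + g x) x = c * resolvent l b \<zeta> f x + resolvent l b \<zeta> g x"
proof -
  have "resolvent l b \<zeta> (\<lambda>x. c * f x + g x) x =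
    (\<integral>t. c * (indicator {0<..} t *\<^sub>R (exp (- \<zeta> * of_real t) * ou_op l b t f x)) +
         indicator {0<..} t *\<^sub>R (exp (- \<zeta> * of_real t) * ou_op l b t g x) \<partial>lborel)"
    unfolding resolvent_def
  proof (rule Bochner_Integration.integral_cong[OF refl])
    fix t :: real
    show "indicator {0<..} t *\<^sub>R (exp (- \<zeta> * of_real t) * ou_op l b t (\<lambda>x. c * f x + g x) x) =
      c * (indicator {0<..} t *\<^sub>R (exp (- \<zeta> * of_real t) * ou_op l b t f x)) +
         indicator {0<..} t *\<^sub>R (exp (- \<zeta> * of_real t) * ou_op l b t g x)"
    proof (cases "t > 0")
      case True
      show ?thesis unfolding ou_op_linear[OF True f g] by (simp add: algebra_simps)
    qed simp
  qed
  also have "\<dots> = (\<integral>t. c * (indicator {0<..} t *\<^sub>R (exp (- \<zeta> * of_real t) * ou_op l b t f x)) \<partial>lborel) + resolvent l b \<zeta> g x"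
    unfolding resolvent_def
    by (intro Bochner_Integration.integral_add integrable_mult_right resolvent_integrable[OF f] resolvent_integrable[OF g])
  finally show ?thesis unfolding integral_mult_right_zero by (simp only: resolvent_def)
qed

text \<open>Shifting time by \<open>h\<close> in the Laplace integral releases the factor
  \<open>exp (\<zeta> h)\<close> and loses the piece over (0, h]. That piece, divided by
  \<open>h\<close>, is what produces \<open>f\<close> in the limit.\<close>

lemma resolvent_shift:
  assumes f: "f \<in> borel_measurable borel" "\<And>x. cmod (f x) \<le> B" and h: "h > 0"
  shows "resolvent l b \<zeta> (ou_op l b h f) x = exp (\<zeta> * of_real h) *
    (resolvent l b \<zeta> f x - (\<integral>t. indicator {0<..h} t *\<^sub>R (exp (- \<zeta> * of_real t) * ou_op l b t f x) \<partial>lborel))"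
proof -
  let ?\<Phi> = "\<lambda>t. exp (- \<zeta> * of_real t) * ou_op l b t f x"
  have int0: "integrable lborel (\<lambda>t. indicator {0<..} t *\<^sub>R ?\<Phi> t)" by (rule resolvent_integrable[OF f])
  have inth: "integrable lborel (\<lambda>t. indicator {0<..h} t *\<^sub>R ?\<Phi> t)"
    by (rule Bochner_Integration.integrable_bound[OF int0])
       (use ou_op_measurable_time[OF f(1), of l b x] in \<open>auto simp: indicator_def\<close>)
  have "resolvent l b \<zeta> (ou_op l b h f) x =
     (\<integral>t. indicator {0<..} t *\<^sub>R (exp (- \<zeta> * of_real t) * ou_op l b (t + h) f x) \<partial>lborel)"
    unfolding resolvent_def
    by (intro Bochner_Integration.integral_cong refl) (auto simp: indicator_def ou_op_semigroup[OF l _ h f])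
  also have "\<dots> = (\<integral>t. indicator {0<..} (- h + 1 * t) *\<^sub>R (exp (- \<zeta> * of_real (- h + 1 * t)) * ou_op l b ((- h + 1 * t) + h) f x) \<partial>lborel)"
    by (subst lborel_integral_real_affine[where c = 1 and t = "- h"]) auto
  also have "\<dots> = (\<integral>t. exp (\<zeta> * of_real h) * (indicator {0<..} t *\<^sub>R ?\<Phi> t - indicator {0<..h} t *\<^sub>R ?\<Phi> t) \<partial>lborel)"
    using h by (intro Bochner_Integration.integral_cong refl)
       (auto simp: indicator_def exp_add [symmetric] algebra_simps)
  also have "\<dots> = exp (\<zeta> * of_real h) * (\<integral>t. indicator {0<..} t *\<^sub>R ?\<Phi> t - indicator {0<..h} t *\<^sub>R ?\<Phi> t \<partial>lborel)"
    by (rule integral_mult_right_zero)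
  also have "(\<integral>t. indicator {0<..} t *\<^sub>R ?\<Phi> t - indicator {0<..h} t *\<^sub>R ?\<Phi> t \<partial>lborel)
      = resolvent l b \<zeta> f x - (\<integral>t. indicator {0<..h} t *\<^sub>R ?\<Phi> t \<partial>lborel)"
    unfolding resolvent_def by (rule Bochner_Integration.integral_diff[OF int0 inth])
  finally show ?thesis .
qed

text \<open>The resolvent inverts \<open>\<zeta> - A\<close>: apply it to the difference quotients of the semigroup and let the step tend to 0.\<close>

lemma resolvent_generator:
  assumes f: "f \<in> borel_measurable borel" "\<And>x. cmod (f x) \<le> B"
    and w: "w \<in> borel_measurable borel" "\<And>x. cmod (w x) \<le> B'"
    and lim: "uniform_limit UNIV (\<lambda>h x. (1 / of_real h) * (ou_op l b h f x - f x)) w (at_right 0)"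
  shows "f x = resolvent l b \<zeta> (\<lambda>x. \<zeta> * f x - w x) x"
proof -
  let ?D = "\<lambda>h x. (1 / of_real h) * (ou_op l b h f x - f x)"
  let ?R = "resolvent l b \<zeta>"
  let ?\<Phi> = "\<lambda>t. exp (- \<zeta> * of_real t) * ou_op l b t f x"
  let ?A = "\<lambda>h. \<integral>t. indicator {0<..h} t *\<^sub>R ?\<Phi> t \<partial>lborel"
  \<comment> \<open>The resolvent of a difference quotient, arranged so that both terms have evident
    limits as \<open>h\<close> tends to 0: \<zeta> times the resolvent of \<open>f\<close>, and
    \<open>f\<close> itself.\<close>
  have R_D: "?R (?D h) x = ((exp (\<zeta> * of_real h) - 1) / of_real h) * ?R f x - exp (\<zeta> * of_real h) * ((1 / of_real h) * ?A h)"
    if h: "h > 0" for h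
  proof -
    have m: "ou_op l b h f \<in> borel_measurable borel" by (rule ou_op_measurable_space[OF f(1)])
    have bd: "cmod (ou_op l b h f y) \<le> kernel_mass DIM('a) l * exp (- h * Re b) * B" for y
      by (rule ou_op_bound[OF l h f])
    have "?R (?D h) x = ?R (\<lambda>x. (1 / of_real h) * ((-1) * f x + ou_op l b h f x) + 0) x"
      by (rule arg_cong[of _ _ "\<lambda>u. ?R u x"]) (simp add: fun_eq_iff)
    also have "\<dots> = (1 / of_real h) * ?R (\<lambda>x. (-1) * f x + ou_op l b h f x) x + ?R (\<lambda>_. 0) x"
    proof (rule resolvent_linear)
      show "cmod ((-1) * f x + ou_op l b h f x) \<le> B + kernel_mass DIM('a) l * exp (- h * Re b) * B" for x
        by (rule norm_triangle_le) (use f(2)[of x] bd[of x] in simp)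
    qed (use m f(1) in auto)
    also have "?R (\<lambda>_. 0) x = 0" unfolding resolvent_def ou_op_def by simp
    also have "?R (\<lambda>x. (-1) * f x + ou_op l b h f x) x = (-1) * ?R f x + ?R (ou_op l b h f) x"
      by (rule resolvent_linear[OF f m bd])
    finally have "?R (?D h) x = (1 / of_real h) * ((-1) * ?R f x + ?R (ou_op l b h f) x) + 0" .
    moreover have "1 / q * ((-1) * r + e * (r - a)) + 0 = (e - 1) / q * r - e * (1 / q * a)" for q r e a :: complex
      by (simp add: algebra_simps diff_divide_distrib add_divide_distrib)
    ultimately show ?thesis
      unfolding resolvent_shift[OF f h] by (simp only:)
  qed
  have D_x: "((\<lambda>h. ?D h y) \<longlongrightarrow> w y) (at_right 0)" for y
    by (rule tendsto_uniform_limitI[OF lim]) simp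
  \<comment> \<open>Strong continuity at 0 comes from the generator limit: the increment of the
    orbit is \<open>h\<close> times a convergent quotient.\<close>
  have "((\<lambda>h. of_real h * ?D h x + f x) \<longlongrightarrow> of_real 0 * w x + f x) (at_right 0)"
    by (intro tendsto_intros D_x)
  hence "((\<lambda>h. of_real h * ?D h x + f x) \<longlongrightarrow> f x) (at_right 0)"
    by (simp only: of_real_0 mult_zero_left add_0)
  hence "((\<lambda>h. ou_op l b h f x) \<longlongrightarrow> f x) (at_right 0)"
  proof (rule Lim_transform_eventually)
    show "\<forall>\<^sub>F h in at_right 0. of_real h * ?D h x + f x = ou_op l b h f x"
      by (auto simp: eventually_at_right_field intro!: exI[of _ 1])
  qed
  hence "((\<lambda>h. exp (- \<zeta> * of_real h) * ou_op l b h f x) \<longlongrightarrow> exp (- \<zeta> * of_real 0) * f x) (at_right 0)"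
    by (intro tendsto_intros)
  hence \<Phi>0: "(?\<Phi> \<longlongrightarrow> f x) (at_right 0)" by simp
  have avg: "((\<lambda>h. (1 / of_real h) * ?A h) \<longlongrightarrow> f x) (at_right 0)"
  proof (rule average_at_zero[OF _ _ \<Phi>0])
    show "?\<Phi> \<in> borel_measurable borel" using ou_op_measurable_time[OF f(1), of l b x] by measurable
    fix t :: real assume t: "t > 0"
    have "B \<ge> 0" using f(2)[of 0] norm_ge_zero[of "f 0"] by linarith
    hence "kernel_mass DIM('a) l * B * exp (- (Re \<zeta> + Re b) * t) \<le> kernel_mass DIM('a) l * B * 1"
    proof (intro mult_left_mono)
      have "- (Re \<zeta> + Re b) * t \<le> 0" unfolding mult_minus_left using \<mu> t by simp
      thus "exp (- (Re \<zeta> + Re b) * t) \<le> 1" by (simp only: exp_le_one_iff)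
    qed auto
    thus "cmod (?\<Phi> t) \<le> kernel_mass DIM('a) l * B * 1"
      by (rule order.trans[OF resolvent_integrand_bound[OF f t]])
  qed
  have "((\<lambda>z. exp (\<zeta> * z)) has_field_derivative \<zeta>) (at 0)"
    by (auto intro!: derivative_eq_intros)
  hence "((\<lambda>z. (exp (\<zeta> * z) - 1) / z) \<longlongrightarrow> \<zeta>) (at 0)"
    by (simp add: DERIV_def)
  moreover have "filterlim complex_of_real (at 0) (at_right 0)"
  proof (rule filterlim_atI)
    show "(complex_of_real \<longlongrightarrow> 0) (at_right 0)"
      using tendsto_of_real[OF tendsto_ident_at[of 0 "{0<..}"], where ?'a = complex] by simp
    show "\<forall>\<^sub>F h in at_right 0. complex_of_real h \<noteq> 0"
      by (auto simp: eventually_at_right_field intro!: exI[of _ 1])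
  qed
  ultimately have "((\<lambda>h. (exp (\<zeta> * of_real h) - 1) / of_real h) \<longlongrightarrow> \<zeta>) (at_right 0)"
    by (rule filterlim_compose)
  hence "((\<lambda>h. ((exp (\<zeta> * of_real h) - 1) / of_real h) * ?R f x - exp (\<zeta> * of_real h) * ((1 / of_real h) * ?A h)) \<longlongrightarrow>
        \<zeta> * ?R f x - exp (\<zeta> * of_real 0) * f x) (at_right 0)"
    by (intro tendsto_intros avg)
  hence "((\<lambda>h. ?R (?D h) x) \<longlongrightarrow> \<zeta> * ?R f x - exp (\<zeta> * of_real 0) * f x) (at_right 0)"
  proof (rule Lim_transform_eventually)
    show "\<forall>\<^sub>F h in at_right 0. ((exp (\<zeta> * of_real h) - 1) / of_real h) * ?R f x - exp (\<zeta> * of_real h) * ((1 / of_real h) * ?A h) = ?R (?D h) x"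
      using eventually_at_right_less[of "0::real"] by eventually_elim (rule R_D[symmetric])
  qed
  hence lim1: "((\<lambda>h. ?R (?D h) x) \<longlongrightarrow> \<zeta> * ?R f x - f x) (at_right 0)" by simp
  \<comment> \<open>Here the uniformity of the limit enters: the resolvent is bounded for the
    sup-norm, so it may be applied under the limit.\<close>
  have lim2: "((\<lambda>h. ?R (?D h) x) \<longlongrightarrow> ?R w x) (at_right 0)"
  proof (rule tendstoI)
    fix e :: real assume e: "e > 0"
    let ?K = "kernel_mass DIM('a) l * (1 / (Re \<zeta> + Re b))"
    have K: "?K \<ge> 0" using \<mu> by simp
    define e' where "e' = e / (?K + 1)"
    have e': "e' > 0" unfolding e'_def using e K by (intro divide_pos_pos) linarith+
    have ev: "\<forall>\<^sub>F h in at_right 0. \<forall>x\<in>UNIV. dist (?D h x) (w x) < e'"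
      using uniform_limitD[OF lim e'] .
    have "\<forall>\<^sub>F h in at_right (0::real). h > 0" by (rule eventually_at_right_less)
    with ev show "\<forall>\<^sub>F h in at_right 0. dist (?R (?D h) x) (?R w x) < e"
    proof eventually_elim
      case (elim h)
      have m: "?D h \<in> borel_measurable borel" using f(1) ou_op_measurable_space[OF f(1), of l b h] by measurable
      have bd: "cmod (?D h y - w y) \<le> e'" for y using elim(1) by (auto simp: dist_norm less_imp_le)
      have eq: "?D h = (\<lambda>y. 1 * w y + (?D h y - w y))" by simp
      have "?R (?D h) x = 1 * ?R w x + ?R (\<lambda>y. ?D h y - w y) x"
        by (subst eq, rule resolvent_linear[OF w _ bd]) (use m w(1) in measurable)
      hence "dist (?R (?D h) x) (?R w x) = cmod (?R (\<lambda>y. ?D h y - w y) x)" by (simp add: dist_norm)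
      also have "\<dots> \<le> kernel_mass DIM('a) l * e' * (1 / (Re \<zeta> + Re b))"
        by (rule resolvent_bound[OF _ bd]) (use m w(1) in measurable)
      also have "\<dots> = ?K * e'" by simp
      also have "\<dots> < (?K + 1) * e'" unfolding distrib_right using e' by simp
      also have "\<dots> = e" unfolding e'_def using K by (simp add: add_nonneg_eq_0_iff)
      finally show ?case .
    qed
  qed
  have "?R w x = \<zeta> * ?R f x - f x"
    by (rule tendsto_unique[OF _ lim2 lim1]) simp
  moreover have "?R (\<lambda>x. \<zeta> * f x + (-1 * w x + 0)) x = \<zeta> * ?R f x + ?R (\<lambda>x. -1 * w x + 0) x"
    by (rule resolvent_linear[OF f, of _ B']) (use w in auto)
  moreover have "?R (\<lambda>x. -1 * w x + 0) x = -1 * ?R w x + ?R (\<lambda>_. 0) x"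
    by (rule resolvent_linear[OF w, of _ 0]) auto
  moreover have "?R (\<lambda>_. 0) x = 0" unfolding resolvent_def ou_op_def by simp
  ultimately show ?thesis by simp
qed

end

end

section \<open>Regularity of the scalar resolvent\<close>

context isometric_flow
begin

text \<open>Common real majorant: up to a constant factor, \<open>m = 0\<close> dominates the
  resolvent kernel and \<open>m = 1\<close> its directional derivative.\<close>

definition gauss_weight :: "nat \<Rightarrow> real \<Rightarrow> real \<Rightarrow> real \<times> 'a \<Rightarrow> real" where
  "gauss_weight m \<mu> \<alpha> p = indicator {0<..} (fst p) * (exp (- \<mu> * fst p) * fst p powr (- real DIM('a) / 2 - m) *
      norm (snd p) ^ m * exp (- \<alpha> * (norm (snd p))\<^sup>2 / fst p))"

lemma gauss_weight_nonneg [simp]: "gauss_weight m \<mu> \<alpha> p \<ge> 0"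
  by (simp add: gauss_weight_def)

lemma gauss_weight_measurable [measurable]: "gauss_weight m \<mu> \<alpha> \<in> borel_measurable N"
  unfolding gauss_weight_def by measurable

lemma gauss_weight_exp:
  fixes m :: nat
  assumes m: "m \<le> 1" and pos: "\<alpha> > 0" "\<mu> > 0" "\<eta> \<ge> 0"
    and \<eta>: "\<eta> \<le> 2 * sqrt \<delta> * sqrt (\<alpha> * \<mu>)"
    and F: "(\<lambda>k. (2 * sqrt \<delta>) ^ k / fact k * Gamma ((real DIM('a) + m + k) / 2) * Gamma (1 + (real k - m) / 2) / Gamma (real DIM('a) / 2)) sums F"
  shows "integrable N (\<lambda>p. gauss_weight m \<mu> \<alpha> p * exp (\<eta> * norm (snd p)))"
    and "(\<integral>p. gauss_weight m \<mu> \<alpha> p * exp (\<eta> * norm (snd p)) \<partial>N)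
         \<le> pi powr (real DIM('a) / 2) * \<alpha> powr (- ((real DIM('a) + m) / 2)) * \<mu> powr (m / 2 - 1) * F"
proof -
  let ?g = "\<lambda>p. gauss_weight m \<mu> \<alpha> p * exp (\<eta> * norm (snd p))"
  let ?K = "pi powr (real DIM('a) / 2) * \<alpha> powr (- ((real DIM('a) + m) / 2)) * \<mu> powr (m / 2 - 1) * F"
  have "(\<integral>\<^sup>+p. ennreal (?g p) \<partial>N) = (\<integral>\<^sup>+t. \<integral>\<^sup>+\<psi>. ennreal (?g (t, \<psi>)) \<partial>lborel \<partial>lborel)"
    by (rule lborel.nn_integral_fst[symmetric]) measurable
  also have "\<dots> = (\<integral>\<^sup>+t. \<integral>\<^sup>+(\<psi>::'a). ennreal (indicator {0<..} t * (exp (- \<mu> * t) * t powr (- real DIM('a) / 2 - m) *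
            norm \<psi> ^ m * exp (- \<alpha> * (norm \<psi>)\<^sup>2 / t + \<eta> * norm \<psi>))) \<partial>lborel \<partial>lborel)"
    by (intro nn_integral_cong arg_cong[of _ _ ennreal]) (simp only: gauss_weight_def fst_conv snd_conv exp_add mult.assoc)
  also have "\<dots> \<le> ennreal ?K"
    by (rule nn_integral_gaussian_exp_norm_le[OF m pos \<eta> F])
  finally have le: "(\<integral>\<^sup>+p. ennreal (?g p) \<partial>N) \<le> ennreal ?K" .
  have d2: "sqrt \<delta> \<ge> 0"
  proof (rule ccontr)
    assume "\<not> sqrt \<delta> \<ge> 0"
    hence "2 * sqrt \<delta> * sqrt (\<alpha> * \<mu>) < 0" using pos by (simp add: mult_less_0_iff)
    thus False using \<eta> pos by simp
  qed
  have G: "Gamma ((real DIM('a) + m + k) / 2) > 0" "Gamma (1 + (real k - m) / 2) > 0" "Gamma (real DIM('a) / 2) > 0" for k :: nat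
  proof -
    show "Gamma ((real DIM('a) + m + k) / 2) > 0" by (rule Gamma_real_pos) (simp add: add_pos_nonneg)
    show "Gamma (1 + (real k - m) / 2) > 0" by (rule Gamma_real_pos) (use m in \<open>simp add: field_simps\<close>)
    show "Gamma (real DIM('a) / 2) > 0" by (rule Gamma_real_pos) simp
  qed
  have "F \<ge> 0"
    by (rule sums_le[OF _ sums_zero F])
       (use d2 in \<open>auto intro!: mult_nonneg_nonneg divide_nonneg_nonneg less_imp_le[OF G(1)] less_imp_le[OF G(2)] less_imp_le[OF G(3)]\<close>)
  hence K: "?K \<ge> 0" by simp
  show int: "integrable N ?g"
    by (rule integrableI_nonneg) (use le in \<open>auto intro: order.strict_trans1\<close>)
  have "ennreal (\<integral>p. ?g p \<partial>N) \<le> ennreal ?K"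
    using le by (subst nn_integral_eq_integral[symmetric]) (use int in auto)
  thus "(\<integral>p. ?g p \<partial>N) \<le> ?K" using K by (simp only: ennreal_le_iff)
qed

text \<open>The case \<eta> = \<delta> = 0 of the preceding estimate, where the series consists of
  its term \<open>k = 0\<close>.\<close>

lemma gauss_weight_integrable:
  assumes m: "m \<le> 1" and pos: "\<alpha> > 0" "\<mu> > 0"
  shows "integrable N (gauss_weight m \<mu> \<alpha>)"
proof -
  let ?f = "\<lambda>k. (2 * sqrt 0) ^ k / fact k * Gamma ((real DIM('a) + m + k) / 2) * Gamma (1 + (real k - m) / 2) / Gamma (real DIM('a) / 2)"
  have "?f sums (\<Sum>k\<in>{0}. ?f k)"
    by (rule sums_finite) auto
  from gauss_weight_exp(1)[OF m pos order.refl _ this] show ?thesis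
    using pos by simp
qed

section \<open>The resolvent kernel and its directional derivative\<close>

definition resolvent_kernel :: "complex \<Rightarrow> complex \<Rightarrow> complex \<Rightarrow> real \<times> 'a \<Rightarrow> complex" where
  "resolvent_kernel l b \<zeta> p = indicator {0<..} (fst p) *\<^sub>R (exp (- \<zeta> * of_real (fst p)) * ou_scalar_kernel l b (fst p) (snd p))"

text \<open>Moving \<open>x\<close> along \<open>e\<close> moves \<open>E t x\<close> along
  \<open>E t e\<close>, so the direction of differentiation rotates with time.\<close>

definition resolvent_kernel_deriv :: "complex \<Rightarrow> complex \<Rightarrow> complex \<Rightarrow> 'a \<Rightarrow> real \<times> 'a \<Rightarrow> complex" where
  "resolvent_kernel_deriv l b \<zeta> e p =
     of_real (- (snd p \<bullet> E (fst p) e) / (2 * fst p)) / l * resolvent_kernel l b \<zeta> p"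

lemma resolvent_kernel_measurable [measurable]: "resolvent_kernel l b \<zeta> \<in> borel_measurable N"
  unfolding resolvent_kernel_def by measurable

lemma resolvent_kernel_deriv_measurable [measurable]: "resolvent_kernel_deriv l b \<zeta> e \<in> borel_measurable N"
  unfolding resolvent_kernel_deriv_def by measurable

text \<open>The parameters \<open>a\<close>, \<mu> and \<alpha> are bounds for the eigenvalue data
  instead of the data themselves, so that a single weight can later serve all components at
  once.\<close>

lemma resolvent_kernel_bound:
  assumes l: "Re l > 0" and a: "0 < a" "a \<le> cmod l"
    and \<mu>: "\<mu> \<le> Re \<zeta> + Re b" and \<alpha>: "\<alpha> \<le> Re l / (4 * (cmod l)\<^sup>2)"
  shows "cmod (resolvent_kernel l b \<zeta> p) \<le> (4 * pi * a) powr (- (real DIM('a) / 2)) * gauss_weight 0 \<mu> \<alpha> p"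
proof (cases "fst p > 0")
  case t: True
  let ?d = "real DIM('a) / 2"
  have "cmod (resolvent_kernel l b \<zeta> p) = exp (- Re \<zeta> * fst p) * cmod (ou_scalar_kernel l b (fst p) (snd p))"
    using t by (simp add: resolvent_kernel_def norm_mult)
  also have "\<dots> = (4 * pi * cmod l) powr (- ?d) * ((exp (- Re \<zeta> * fst p) * exp (- fst p * Re b)) * fst p powr (- ?d)
       * exp (- (Re l / (4 * (cmod l)\<^sup>2)) * (norm (snd p))\<^sup>2 / fst p))"
    unfolding norm_ou_scalar_kernel[OF l t] by (simp only: mult_ac)
  also have "exp (- Re \<zeta> * fst p) * exp (- fst p * Re b) = exp (- (Re \<zeta> + Re b) * fst p)"
    by (simp add: exp_add [symmetric] algebra_simps)
  also have "(4 * pi * cmod l) powr (- ?d) * (exp (- (Re \<zeta> + Re b) * fst p) * fst p powr (- ?d)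
       * exp (- (Re l / (4 * (cmod l)\<^sup>2)) * (norm (snd p))\<^sup>2 / fst p))
     \<le> (4 * pi * a) powr (- ?d) * (exp (- \<mu> * fst p) * fst p powr (- ?d) * exp (- \<alpha> * (norm (snd p))\<^sup>2 / fst p))"
  proof (intro mult_mono mult_nonneg_nonneg)
    show "(4 * pi * cmod l) powr (- ?d) \<le> (4 * pi * a) powr (- ?d)"
      using a by (intro powr_mono2') auto
    show "exp (- (Re \<zeta> + Re b) * fst p) \<le> exp (- \<mu> * fst p)"
      using \<mu> t by (simp del: minus_add_distrib)
    show "exp (- (Re l / (4 * (cmod l)\<^sup>2)) * (norm (snd p))\<^sup>2 / fst p) \<le> exp (- \<alpha> * (norm (snd p))\<^sup>2 / fst p)"
      unfolding exp_le_cancel_iff by (intro divide_right_mono mult_right_mono) (use \<alpha> t in auto)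
  qed auto
  also have "\<dots> = (4 * pi * a) powr (- ?d) * gauss_weight 0 \<mu> \<alpha> p"
    using t by (simp add: gauss_weight_def)
  finally show ?thesis .
qed (simp add: resolvent_kernel_def)

text \<open>Cauchy-Schwarz and the isometry bound the inner product by
  \<open>norm (snd p) * norm e\<close>; the remaining quotient \<open>norm (snd p) / fst p\<close>
  is the passage from weight 0 to weight 1.\<close>

lemma resolvent_kernel_deriv_bound:
  assumes l: "Re l > 0" and a: "0 < a" "a \<le> cmod l"
    and \<mu>: "\<mu> \<le> Re \<zeta> + Re b" and \<alpha>: "\<alpha> \<le> Re l / (4 * (cmod l)\<^sup>2)"
  shows "cmod (resolvent_kernel_deriv l b \<zeta> e p) \<le> (4 * pi * a) powr (- (real DIM('a) / 2)) / (2 * a) * norm e * gauss_weight 1 \<mu> \<alpha> p"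
proof (cases "fst p > 0")
  case t: True
  let ?d = "real DIM('a) / 2"
  have "cmod (resolvent_kernel_deriv l b \<zeta> e p) = \<bar>snd p \<bullet> E (fst p) e\<bar> / (2 * fst p * cmod l) * cmod (resolvent_kernel l b \<zeta> p)"
    unfolding resolvent_kernel_deriv_def using t by (simp add: norm_mult norm_divide)
  also have "\<dots> \<le> norm (snd p) * norm e / (2 * fst p * a) * ((4 * pi * a) powr (- ?d) * gauss_weight 0 \<mu> \<alpha> p)"
  proof (intro mult_mono frac_le)
    show "\<bar>snd p \<bullet> E (fst p) e\<bar> \<le> norm (snd p) * norm e"
      using Cauchy_Schwarz_ineq2[of "snd p" "E (fst p) e"] by (simp add: flow_norm)
  qed (use t a resolvent_kernel_bound[OF assms] in \<open>auto intro!: mult_left_mono\<close>)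
  also have "\<dots> = (4 * pi * a) powr (- ?d) / (2 * a) * norm e * (gauss_weight 0 \<mu> \<alpha> p * (norm (snd p) / fst p))"
    using a t by (simp add: field_simps)
  also have "gauss_weight 0 \<mu> \<alpha> p * (norm (snd p) / fst p) = gauss_weight 1 \<mu> \<alpha> p"
  proof -
    have "fst p powr (- real DIM('a) / 2 - 1) = fst p powr (- real DIM('a) / 2) / fst p"
      using t by (simp add: powr_diff)
    thus ?thesis using t by (simp add: gauss_weight_def)
  qed
  finally show ?thesis .
qed (use a in \<open>simp add: resolvent_kernel_def resolvent_kernel_deriv_def\<close>)

lemma resolvent_kernel_vector_derivative:
  assumes l: "Re l > 0"
  shows "((\<lambda>\<rho>. resolvent_kernel l b \<zeta> (t, z + \<rho> *\<^sub>R E t e)) has_vector_derivative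
     resolvent_kernel_deriv l b \<zeta> e (t, z + \<rho> *\<^sub>R E t e)) (at \<rho>)"
proof (cases "t > 0")
  case t: True
  let ?n = "\<lambda>\<rho>. (norm (z + \<rho> *\<^sub>R E t e))\<^sup>2"
  let ?c = "exp (- \<zeta> * of_real t) * (of_real ((4 * pi * t) powr (- (real DIM('a) / 2))) * l powr (- of_real (real DIM('a) / 2)))"
  let ?q = "of_real (4 * t) * l"
  have l0: "l \<noteq> 0" using l by auto
  have "(?n has_real_derivative 2 * ((z + \<rho> *\<^sub>R E t e) \<bullet> E t e)) (at \<rho>)"
    unfolding power2_norm_eq_inner has_real_derivative_iff_has_vector_derivative has_vector_derivative_def
    by (auto intro!: derivative_eq_intros simp: fun_eq_iff inner_commute algebra_simps)
  hence "((\<lambda>\<rho>. complex_of_real (?n \<rho>)) has_vector_derivative of_real (2 * ((z + \<rho> *\<^sub>R E t e) \<bullet> E t e))) (at \<rho>)"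
    by (intro has_vector_derivative_of_real)
       (simp only: has_real_derivative_iff_has_vector_derivative)
  moreover have "((\<lambda>w. ?c * exp (- (of_real t * b) - w / ?q)) has_field_derivative
      ?c * exp (- (of_real t * b) - of_real (?n \<rho>) / ?q) * (- 1 / ?q)) (at (of_real (?n \<rho>)))"
  proof -
    have "((\<lambda>w. c * exp (u - w / q)) has_field_derivative c * exp (u - w0 / q) * (- 1 / q)) (at w0)"
      if "q \<noteq> 0" for c u q w0 :: complex
      using that by (auto intro!: derivative_eq_intros)
    thus ?thesis using t l0 by simp
  qed
  ultimately have "((\<lambda>w. ?c * exp (- (of_real t * b) - w / ?q)) \<circ> (\<lambda>\<rho>. complex_of_real (?n \<rho>)) has_vector_derivative
     of_real (2 * ((z + \<rho> *\<^sub>R E t e) \<bullet> E t e)) * (?c * exp (- (of_real t * b) - of_real (?n \<rho>) / ?q) * (- 1 / ?q))) (at \<rho>)"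
    by (rule field_vector_diff_chain_at)
  moreover have "(\<lambda>w. ?c * exp (- (of_real t * b) - w / ?q)) \<circ> (\<lambda>\<rho>. complex_of_real (?n \<rho>)) =
     (\<lambda>\<rho>. resolvent_kernel l b \<zeta> (t, z + \<rho> *\<^sub>R E t e))"
    using t by (auto simp: resolvent_kernel_def ou_scalar_kernel_def o_def)
  moreover have "of_real (2 * ((z + \<rho> *\<^sub>R E t e) \<bullet> E t e)) * (?c * exp (- (of_real t * b) - of_real (?n \<rho>) / ?q) * (- 1 / ?q))
     = resolvent_kernel_deriv l b \<zeta> e (t, z + \<rho> *\<^sub>R E t e)"
  proof -
    have "of_real (2 * s) * (c * x * (- 1 / (of_real (4 * t) * l))) = of_real (- s / (2 * t)) / l * (c * x)" for s :: real and c x :: complex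
      using t l0 by (simp add: field_simps)
    thus ?thesis using t unfolding resolvent_kernel_deriv_def resolvent_kernel_def ou_scalar_kernel_def
      by (simp only: fst_conv snd_conv mult.assoc) (simp add: mult_ac)
  qed
  ultimately show ?thesis by simp
qed (simp add: resolvent_kernel_def resolvent_kernel_deriv_def)

lemma resolvent_kernel_deriv_continuous:
  "continuous_on UNIV (\<lambda>\<rho>. resolvent_kernel_deriv l b \<zeta> e (t, z + \<rho> *\<^sub>R E t e))"
proof (cases "l = 0 \<or> t = 0")
  case True
  \<comment> \<open>Division by zero yields 0 when \<open>l = 0\<close>, and the indicator vanishes
    at \<open>t = 0\<close>.\<close>
  hence eq: "(\<lambda>\<rho>. resolvent_kernel_deriv l b \<zeta> e (t, z + \<rho> *\<^sub>R E t e)) = (\<lambda>_. 0)"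
    by (auto simp: resolvent_kernel_deriv_def)
  show ?thesis by (subst eq) (rule continuous_on_const)
next
  case False
  thus ?thesis
    unfolding resolvent_kernel_deriv_def resolvent_kernel_def ou_scalar_kernel_def
    by (auto intro!: continuous_intros)
qed

context
  fixes l b \<zeta> :: complex
  assumes l: "Re l > 0" and \<mu>: "Re \<zeta> + Re b > 0"
begin

lemma resolvent_kernel_integrable:
  "integrable N (resolvent_kernel l b \<zeta>)" "integrable N (resolvent_kernel_deriv l b \<zeta> e)"
proof -
  let ?\<alpha> = "Re l / (4 * (cmod l)\<^sup>2)" and ?\<mu> = "Re \<zeta> + Re b"
  have l0: "cmod l > 0" using l by auto
  have \<alpha>: "?\<alpha> > 0" using l l0 by simp
  note par = l l0 order.refl order.refl order.refl
  show "integrable N (resolvent_kernel l b \<zeta>)"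
  proof (rule Bochner_Integration.integrable_bound)
    show "integrable N (\<lambda>p. (4 * pi * cmod l) powr (- (real DIM('a) / 2)) * gauss_weight 0 ?\<mu> ?\<alpha> p)"
      by (intro integrable_mult_right gauss_weight_integrable \<alpha> \<mu>) simp
    show "AE p in N. norm (resolvent_kernel l b \<zeta> p) \<le> norm ((4 * pi * cmod l) powr (- (real DIM('a) / 2)) * gauss_weight 0 ?\<mu> ?\<alpha> p)"
      by (intro AE_I2 order.trans[OF resolvent_kernel_bound[OF par]]) simp
  qed measurable
  show "integrable N (resolvent_kernel_deriv l b \<zeta> e)"
  proof (rule Bochner_Integration.integrable_bound)
    show "integrable N (\<lambda>p. (4 * pi * cmod l) powr (- (real DIM('a) / 2)) / (2 * cmod l) * norm e * gauss_weight 1 ?\<mu> ?\<alpha> p)"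
      by (intro integrable_mult_right gauss_weight_integrable \<alpha> \<mu>) simp
    show "AE p in N. norm (resolvent_kernel_deriv l b \<zeta> e p) \<le> norm ((4 * pi * cmod l) powr (- (real DIM('a) / 2)) / (2 * cmod l) * norm e * gauss_weight 1 ?\<mu> ?\<alpha> p)"
      by (intro AE_I2 order.trans[OF resolvent_kernel_deriv_bound[OF par]]) simp
  qed measurable
qed

text \<open>By Fubini the iterated Laplace and space integral becomes one integral over
  \<open>N\<close>, the form to which the results on \<open>conv\<close> apply.\<close>

lemma resolvent_eq_conv:
  assumes f: "f \<in> borel_measurable borel" "\<And>x. cmod (f x) \<le> B"
  shows "resolvent l b \<zeta> f x = conv (resolvent_kernel l b \<zeta>) f x"
proof -
  have "conv (resolvent_kernel l b \<zeta>) f x = (\<integral>t. \<integral>\<xi>. resolvent_kernel l b \<zeta> (t, E t x - \<xi>) * f \<xi> \<partial>lborel \<partial>lborel)"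
    unfolding conv_def
    using lborel_pair.integral_fst'[OF conv_kernel_integrable(1)[OF resolvent_kernel_integrable(1) f(1) flow_measurable_time[of x] f(2)]]
    by simp
  also have "\<dots> = resolvent l b \<zeta> f x"
    unfolding resolvent_def
  proof (rule Bochner_Integration.integral_cong[OF refl])
    fix t :: real
    have "(\<integral>\<xi>. resolvent_kernel l b \<zeta> (t, E t x - \<xi>) * f \<xi> \<partial>lborel) =
       (\<integral>\<xi>. (of_real (indicator {0<..} t) * exp (- \<zeta> * of_real t)) * (ou_scalar_kernel l b t (E t x - \<xi>) * f \<xi>) \<partial>lborel)"
      unfolding resolvent_kernel_def fst_conv snd_conv scaleR_conv_of_real by (simp only: mult_ac)
    also have "\<dots> = (of_real (indicator {0<..} t) * exp (- \<zeta> * of_real t)) * ou_op l b t f x"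
      unfolding ou_op_def by (rule integral_mult_right_zero)
    finally show "(\<integral>\<xi>. resolvent_kernel l b \<zeta> (t, E t x - \<xi>) * f \<xi> \<partial>lborel) =
       indicator {0<..} t *\<^sub>R (exp (- \<zeta> * of_real t) * ou_op l b t f x)"
      by (simp only: scaleR_conv_of_real mult.assoc)
  qed
  finally show ?thesis by simp
qed

end

end

section \<open>Reduction to diagonal matrices\<close>

definition diag_matrix :: "('n \<Rightarrow> complex) \<Rightarrow> complex^'n^'n" where
  "diag_matrix d = (\<chi> i j. if i = j then d i else 0)"

lemma diag_matrix_vector_mult: "diag_matrix d *v x = (\<chi> i. d i * x $ i)"
proof -
  have "(\<Sum>j\<in>UNIV. (if i = j then d i else 0) * x $ j) = (\<Sum>j\<in>UNIV. if i = j then d i * x $ j else 0)" for i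
    by (intro sum.cong) auto
  thus ?thesis by (simp add: diag_matrix_def matrix_vector_mult_def vec_eq_iff)
qed

lemma diag_matrix_mult: "diag_matrix d ** diag_matrix e = diag_matrix (\<lambda>i. d i * e i)"
proof -
  have "(\<Sum>k\<in>UNIV. (if i = k then d i else 0) * (if k = j then e k else 0)) = (\<Sum>k\<in>UNIV. if i = k then (if i = j then d i * e i else 0) else 0)" for i j
    by (intro sum.cong) auto
  thus ?thesis by (simp add: diag_matrix_def matrix_matrix_mult_def vec_eq_iff)
qed

lemma diag_matrix_one: "diag_matrix (\<lambda>_. 1) = mat 1"
  by (simp add: diag_matrix_def mat_def)

lemma matrix_inv_mult:
  assumes "invertible A"
  shows "A ** matrix_inv A = mat 1" "matrix_inv A ** A = mat 1"
proof -
  from assms have "\<exists>B. A ** B = mat 1 \<and> B ** A = mat 1" unfolding invertible_def .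
  from someI_ex[OF this] show "A ** matrix_inv A = mat 1" "matrix_inv A ** A = mat 1"
    unfolding matrix_inv_def by auto
qed

lemma matrix_inv_unique:
  fixes A B :: "'a::field^'n^'n"
  assumes "A ** B = mat 1" "B ** A = mat 1"
  shows "matrix_inv A = B"
proof -
  have inv: "invertible A" using assms unfolding invertible_def by blast
  have "matrix_inv A = matrix_inv A ** (A ** B)" by (simp add: assms)
  also have "\<dots> = B" using matrix_inv_mult(2)[OF inv] by (simp add: matrix_mul_assoc)
  finally show ?thesis .
qed

lemma sums_vecI:
  fixes f :: "nat \<Rightarrow> 'a::real_normed_vector^'n"
  assumes "\<And>i. (\<lambda>n. f n $ i) sums (x $ i)"
  shows "f sums x"
  using assms unfolding sums_def by (intro vec_tendstoI) simp

lemma norm_matrix_vector_le: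
  fixes M :: "complex^'n^'n"
  shows "norm (M *v x) \<le> spectral_norm M * norm x"
  unfolding spectral_norm_def
  by (rule onorm) (rule matrix_vector_mul_bounded_linear)

lemma spectral_norm_nonneg: "spectral_norm (M :: complex^'n^'n) \<ge> 0"
  unfolding spectral_norm_def
  by (rule onorm_pos_le) (rule matrix_vector_mul_bounded_linear)

locale diagonalizing =
  fixes Y :: "complex^'n^'n"
  assumes invertible: "invertible Y"
begin

lemma inv_left: "matrix_inv Y ** Y = mat 1" and inv_right: "Y ** matrix_inv Y = mat 1"
  using matrix_inv_mult[OF invertible] by auto

text \<open>The matrices that \<open>Y\<close> diagonalizes. They are closed under the operations
  occurring in \<open>OU_kernel\<close>, which therefore act on the diagonal entries alone.\<close>

definition similar_diag :: "('n \<Rightarrow> complex) \<Rightarrow> complex^'n^'n" where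
  "similar_diag d = Y ** diag_matrix d ** matrix_inv Y"

lemma similar_diag_nth: "similar_diag d $ i $ j = (\<Sum>k\<in>UNIV. Y $ i $ k * d k * matrix_inv Y $ k $ j)"
proof -
  have "(Y ** diag_matrix d) $ i $ k = Y $ i $ k * d k" for k
  proof -
    have "(\<Sum>j\<in>UNIV. Y $ i $ j * (if j = k then d j else 0)) = (\<Sum>j\<in>UNIV. if j = k then Y $ i $ j * d j else 0)"
      by (intro sum.cong) auto
    thus ?thesis by (simp add: diag_matrix_def matrix_matrix_mult_def)
  qed
  thus ?thesis unfolding similar_diag_def by (simp add: matrix_matrix_mult_def)
qed

lemma similar_diag_mult: "similar_diag d ** similar_diag e = similar_diag (\<lambda>i. d i * e i)"
proof -
  have "similar_diag d ** similar_diag e = Y ** diag_matrix d ** (matrix_inv Y ** Y) ** diag_matrix e ** matrix_inv Y"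
    unfolding similar_diag_def by (simp only: matrix_mul_assoc)
  also have "\<dots> = Y ** (diag_matrix d ** diag_matrix e) ** matrix_inv Y"
    unfolding inv_left by (simp add: matrix_mul_assoc)
  finally show ?thesis unfolding diag_matrix_mult similar_diag_def .
qed

lemma similar_diag_one: "similar_diag (\<lambda>_. 1) = mat 1"
  unfolding similar_diag_def diag_matrix_one by (simp add: inv_right)

lemma similar_diag_scaleR: "r *\<^sub>R similar_diag d = similar_diag (\<lambda>i. r *\<^sub>R d i)"
  by (simp add: vec_eq_iff similar_diag_nth scaleR_sum_right)

lemma similar_diag_uminus: "- similar_diag d = similar_diag (\<lambda>i. - d i)"
  by (simp add: vec_eq_iff similar_diag_nth sum_negf)

lemma similar_diag_diff: "similar_diag d - similar_diag e = similar_diag (\<lambda>i. d i - e i)"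
  by (simp add: vec_eq_iff similar_diag_nth algebra_simps sum_subtractf)

lemma similar_diag_vector_mult: "similar_diag d *v x = Y *v (\<chi> i. d i * (matrix_inv Y *v x) $ i)"
  unfolding similar_diag_def by (simp add: matrix_vector_mul_assoc [symmetric] diag_matrix_vector_mult)

lemma similar_diag_conjugate: "matrix_inv Y ** similar_diag d ** Y = diag_matrix d"
proof -
  have "matrix_inv Y ** similar_diag d ** Y = (matrix_inv Y ** Y) ** diag_matrix d ** (matrix_inv Y ** Y)"
    unfolding similar_diag_def by (simp only: matrix_mul_assoc)
  thus ?thesis unfolding inv_left by simp
qed

lemma diagonalizable_eq_similar_diag:
  assumes "diagonal_matrix (matrix_inv Y ** M ** Y)"
  shows "M = similar_diag (\<lambda>i. (matrix_inv Y ** M ** Y) $ i $ i)"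
proof -
  have eq: "diag_matrix (\<lambda>i. (matrix_inv Y ** M ** Y) $ i $ i) = matrix_inv Y ** M ** Y"
    using assms unfolding diagonal_matrix_def diag_matrix_def by (auto simp: vec_eq_iff)
  have "similar_diag (\<lambda>i. (matrix_inv Y ** M ** Y) $ i $ i) = Y ** (matrix_inv Y ** M ** Y) ** matrix_inv Y"
    unfolding similar_diag_def eq ..
  also have "\<dots> = (Y ** matrix_inv Y) ** M ** (Y ** matrix_inv Y)"
    by (simp only: matrix_mul_assoc)
  also have "\<dots> = M" unfolding inv_right by simp
  finally show ?thesis by (rule sym)
qed

lemma matrix_inv_similar_diag:
  assumes "\<And>i. d i \<noteq> 0"
  shows "matrix_inv (similar_diag d) = similar_diag (\<lambda>i. 1 / d i)"
  by (rule matrix_inv_unique) (simp_all add: similar_diag_mult assms similar_diag_one)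

lemma matrix_power_similar_diag: "matrix_power (similar_diag d) k = similar_diag (\<lambda>i. d i ^ k)"
  by (induction k) (simp_all add: matrix_power_0 matrix_power_Suc similar_diag_mult similar_diag_one)

lemma matrix_exp_similar_diag: "matrix_exp (similar_diag d) = similar_diag (\<lambda>i. exp (d i))"
proof -
  have "(\<lambda>k. (1 / fact k) *\<^sub>R matrix_power (similar_diag d) k) sums similar_diag (\<lambda>i. exp (d i))"
  proof (intro sums_vecI)
    fix i j
    have "(\<lambda>k. \<Sum>l\<in>UNIV. Y $ i $ l * (d l ^ k /\<^sub>R fact k) * matrix_inv Y $ l $ j) sums
        (\<Sum>l\<in>UNIV. Y $ i $ l * exp (d l) * matrix_inv Y $ l $ j)"
      by (intro sums_sum sums_mult sums_mult2 exp_converges)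
    thus "(\<lambda>k. ((1 / fact k) *\<^sub>R matrix_power (similar_diag d) k) $ i $ j) sums similar_diag (\<lambda>i. exp (d i)) $ i $ j"
      unfolding matrix_power_similar_diag similar_diag_scaleR similar_diag_nth inverse_eq_divide .
  qed
  thus ?thesis unfolding matrix_exp_def by (rule sums_unique[symmetric])
qed

lemma spectrum_similar_diag: "spectrum (similar_diag d) = range d"
proof (intro equalityI subsetI)
  fix \<mu> assume "\<mu> \<in> spectrum (similar_diag d)"
  then obtain v where v: "v \<noteq> 0" "similar_diag d *v v = \<mu> *s v" unfolding spectrum_def by blast
  define u where "u = matrix_inv Y *v v"
  have Yu: "Y *v u = v" unfolding u_def by (simp add: matrix_vector_mul_assoc inv_right)
  have "matrix_inv Y *v (similar_diag d *v v) = \<mu> *s u"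
    unfolding v(2) u_def by (simp add: vector_scalar_commute)
  moreover have "matrix_inv Y *v (similar_diag d *v v) = (\<chi> i. d i * u $ i)"
    unfolding similar_diag_vector_mult u_def by (simp add: matrix_vector_mul_assoc inv_left)
  ultimately have "d i * u $ i = \<mu> * u $ i" for i
    by (simp add: vec_eq_iff)
  hence eq: "d i * u $ i = \<mu> * u $ i" for i .
  have "u \<noteq> 0"
  proof
    assume "u = 0"
    with Yu have "v = 0" by simp
    with v(1) show False ..
  qed
  then obtain i where i: "u $ i \<noteq> 0" by (auto simp: vec_eq_iff)
  have "d i = \<mu>" using eq[of i] i by simp
  thus "\<mu> \<in> range d" by blast
next
  fix \<mu> assume "\<mu> \<in> range d"
  then obtain i where i: "\<mu> = d i" by blast
  let ?v = "Y *v axis i 1"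
  have inv: "matrix_inv Y *v ?v = axis i 1" by (simp add: matrix_vector_mul_assoc inv_left)
  have "?v \<noteq> 0"
  proof
    assume "?v = 0"
    hence "axis i (1::complex) = 0" using inv by simp
    thus False by simp
  qed
  moreover have "similar_diag d *v ?v = d i *s ?v"
  proof -
    have "(\<chi> k. d k * (axis i 1 :: complex^'n) $ k) = d i *s axis i 1"
      by (auto simp: vec_eq_iff axis_def)
    thus ?thesis unfolding similar_diag_vector_mult inv by (simp add: vector_scalar_commute)
  qed
  ultimately show "\<mu> \<in> spectrum (similar_diag d)" unfolding spectrum_def i by blast
qed

text \<open>All ingredients of the kernel stay in the family \<open>similar_diag\<close>, so the
  comparison is entry by entry. The one analytic point is the principal power, from which the
  positive factor \<open>4 * pi * t\<close> splits off.\<close>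

lemma OU_kernel_similar_diag:
  fixes S :: "real^'d^'d"
  assumes t: "t > 0" and l: "\<And>i. Re (l i) > 0"
  shows "OU_kernel Y (similar_diag l) (similar_diag b) S x \<xi> t =
    similar_diag (\<lambda>i. ou_scalar_kernel (l i) (b i) t (matrix_exp (t *\<^sub>R S) *v x - \<xi>))"
proof -
  let ?r = "(norm (matrix_exp (t *\<^sub>R S) *v x - \<xi>))\<^sup>2"
  have l0: "l i \<noteq> 0" for i using l[of i] by auto
  have pow: "matrix_powr Y ((4 * pi * t) *\<^sub>R similar_diag l) (- of_nat CARD('d) / 2) =
     similar_diag (\<lambda>i. of_real ((4 * pi * t) powr (- (real CARD('d) / 2))) * l i powr (- of_real (real CARD('d) / 2)))"
  proof -
    have "((4 * pi * t) *\<^sub>R l i) powr (- of_nat CARD('d) / 2) =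
       of_real ((4 * pi * t) powr (- (real CARD('d) / 2))) * l i powr (- of_real (real CARD('d) / 2))" for i
    proof -
      have "(of_real (4 * pi * t) * l i) powr (- of_real (real CARD('d) / 2)) =
         of_real (4 * pi * t) powr (- of_real (real CARD('d) / 2)) * l i powr (- of_real (real CARD('d) / 2))"
        by (rule powr_times_real_left) (use t in auto)
      also have "of_real (4 * pi * t) powr (- of_real (real CARD('d) / 2)) = complex_of_real ((4 * pi * t) powr (- (real CARD('d) / 2)))"
        using powr_of_real[of "4 * pi * t" "- (real CARD('d) / 2)"] t by simp
      finally show ?thesis by (simp add: scaleR_conv_of_real)
    qed
    thus ?thesis
      unfolding matrix_powr_def similar_diag_scaleR similar_diag_conjugate
      by (simp add: similar_diag_def diag_matrix_def cong: if_cong)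
  qed
  have inv: "matrix_inv ((4 * t) *\<^sub>R similar_diag l) = similar_diag (\<lambda>i. 1 / ((4 * t) *\<^sub>R l i))"
    unfolding similar_diag_scaleR by (rule matrix_inv_similar_diag) (use t l0 in simp)
  have ex: "matrix_exp (- (t *\<^sub>R similar_diag b) - ?r *\<^sub>R matrix_inv ((4 * t) *\<^sub>R similar_diag l)) =
     similar_diag (\<lambda>i. exp (- (of_real t * b i) - of_real ?r / (of_real (4 * t) * l i)))"
  proof -
    have "matrix_exp (- (t *\<^sub>R similar_diag b) - ?r *\<^sub>R matrix_inv ((4 * t) *\<^sub>R similar_diag l)) =
      similar_diag (\<lambda>i. exp (- (t *\<^sub>R b i) - ?r *\<^sub>R (1 / ((4 * t) *\<^sub>R l i))))"
      unfolding inv unfolding similar_diag_scaleR similar_diag_uminus similar_diag_diff matrix_exp_similar_diag ..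
    moreover have "?r *\<^sub>R (1 / ((4 * t) *\<^sub>R l i)) = of_real ?r / (of_real (4 * t) * l i)" "t *\<^sub>R b i = of_real t * b i" for i
      unfolding scaleR_conv_of_real by simp_all
    ultimately show ?thesis by (simp only:)
  qed
  show ?thesis
    unfolding OU_kernel_def pow ex similar_diag_mult ou_scalar_kernel_def by simp
qed

end

lemma isometric_flow_skew:
  fixes S :: "real^'d^'d"
  assumes "transpose S = - S"
  shows "isometric_flow (\<lambda>t x. matrix_exp (t *\<^sub>R S) *v x)"
  by (intro isometric_flow.intro matrix_vector_mul_linear norm_matrix_exp_skew[OF assms]
      matrix_exp_skew_add[OF assms] matrix_exp_zero continuous_on_matrix_exp_flow)

section \<open>Vector-valued estimates\<close>

lemma bounded_linear_axis_image:
  fixes Y :: "complex^'m^'n"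
  shows "bounded_linear (\<lambda>z. Y *v axis i z)"
proof -
  have "bounded_linear (axis i :: complex \<Rightarrow> complex^'m)"
    by (rule linear_linear[THEN iffD2]) (auto simp: linear_iff vec_eq_iff axis_def)
  thus ?thesis
    using bounded_linear_compose[OF matrix_vector_mul_bounded_linear[of Y]] by blast
qed

text \<open>A finite sum of bounded linear images of the coordinates: in this form continuity,
  derivatives and integrals transfer directly from scalar results.\<close>

lemma matrix_vector_sum_axis:
  fixes Y :: "complex^'m^'n"
  shows "Y *v (\<chi> i. u i) = (\<Sum>i\<in>UNIV. Y *v axis i (u i))"
proof -
  have "(\<chi> i. u i) = (\<Sum>i\<in>UNIV. axis i (u i))"
  proof (subst vec_eq_iff, rule allI)
    fix j
    have "(\<Sum>i\<in>UNIV. axis i (u i)) $ j = (\<Sum>i\<in>UNIV. if i = j then u i else 0)"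
      unfolding sum_component by (intro sum.cong) (auto simp: axis_def)
    thus "(\<chi> i. u i) $ j = (\<Sum>i\<in>UNIV. axis i (u i)) $ j" by simp
  qed
  thus ?thesis
    using linear_sum[OF matrix_vector_mul_linear[of Y], of "\<lambda>i. axis i (u i)" UNIV] by simp
qed

locale diagonal_ou = diagonalizing Y + isometric_flow E
  for Y :: "complex^'n^'n" and E :: "real \<Rightarrow> real^'d \<Rightarrow> real^'d" +
  fixes l b :: "'n \<Rightarrow> complex" and \<zeta> :: complex
  assumes l: "Re (l i) > 0" and \<mu>: "Re \<zeta> + Re (b i) > 0"
begin

definition coordinate :: "(real^'d \<Rightarrow> complex^'n) \<Rightarrow> 'n \<Rightarrow> real^'d \<Rightarrow> complex" where
  "coordinate g i x = (matrix_inv Y *v g x) $ i"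

lemma bounded_linear_coordinate: "bounded_linear (\<lambda>y. (matrix_inv Y *v y) $ i)"
  using bounded_linear_compose[OF bounded_linear_vec_nth matrix_vector_mul_bounded_linear[of "matrix_inv Y"]] .

lemma coordinate_bound:
  assumes "\<And>x. norm (g x) \<le> B"
  shows "cmod (coordinate g i x) \<le> spectral_norm (matrix_inv Y) * B"
proof -
  have "cmod (coordinate g i x) \<le> norm (matrix_inv Y *v g x)"
    unfolding coordinate_def by (rule Finite_Cartesian_Product.norm_nth_le)
  also have "\<dots> \<le> spectral_norm (matrix_inv Y) * norm (g x)" by (rule norm_matrix_vector_le)
  also have "\<dots> \<le> spectral_norm (matrix_inv Y) * B" by (intro mult_left_mono assms spectral_norm_nonneg)
  finally show ?thesis .
qed

lemma coordinate_uniformly_continuous: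
  "uniformly_continuous_on UNIV g \<Longrightarrow> uniformly_continuous_on UNIV (coordinate g i)"
  unfolding coordinate_def by (rule bounded_linear.uniformly_continuous_on[OF bounded_linear_coordinate])

lemma coordinate_measurable: "continuous_on UNIV g \<Longrightarrow> coordinate g i \<in> borel_measurable borel"
  unfolding coordinate_def
  by (intro borel_measurable_continuous_onI bounded_linear.continuous_on[OF bounded_linear_coordinate])

lemma coordinate_inverse: "Y *v (\<chi> i. coordinate g i x) = g x"
proof -
  have "(\<chi> i. coordinate g i x) = matrix_inv Y *v g x" by (simp add: coordinate_def vec_eq_iff)
  thus ?thesis by (simp add: matrix_vector_mul_assoc inv_right)
qed

definition vector_conv :: "('n \<Rightarrow> real \<times> (real^'d) \<Rightarrow> complex) \<Rightarrow> (real^'d \<Rightarrow> complex^'n) \<Rightarrow> real^'d \<Rightarrow> complex^'n" where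
  "vector_conv P g x = Y *v (\<chi> i. conv (P i) (coordinate g i) x)"

lemma vector_conv_C_ub:
  assumes P: "\<And>i. integrable N (P i)" and g: "g \<in> C_ub"
  shows "vector_conv P g \<in> C_ub"
proof -
  from g have gu: "uniformly_continuous_on UNIV g" and "g \<in> bcontfun" unfolding C_ub_def by auto
  then obtain B where B: "\<And>x. norm (g x) \<le> B"
    unfolding bcontfun_def bounded_iff by auto
  have gm: "coordinate g i \<in> borel_measurable borel" for i
    by (rule coordinate_measurable[OF uniformly_continuous_imp_continuous[OF gu]])
  have eq: "vector_conv P g = (\<lambda>x. \<Sum>i\<in>UNIV. Y *v axis i (conv (P i) (coordinate g i) x))"
    by (rule ext) (simp only: vector_conv_def matrix_vector_sum_axis)
  have uc: "uniformly_continuous_on UNIV (vector_conv P g)"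
    unfolding eq
    by (intro uniformly_continuous_on_sum bounded_linear.uniformly_continuous_on[OF bounded_linear_axis_image]
        conv_uniformly_continuous[OF P coordinate_uniformly_continuous[OF gu] coordinate_bound[OF B]])
  have "norm (vector_conv P g x) \<le> spectral_norm Y * (\<Sum>i\<in>UNIV. spectral_norm (matrix_inv Y) * B * (\<integral>p. cmod (P i p) \<partial>N))" for x
  proof -
    have "norm (vector_conv P g x) \<le> spectral_norm Y * norm (\<chi> i. conv (P i) (coordinate g i) x)"
      unfolding vector_conv_def by (rule norm_matrix_vector_le)
    also have "norm (\<chi> i. conv (P i) (coordinate g i) x) \<le> (\<Sum>i\<in>UNIV. cmod (conv (P i) (coordinate g i) x))"
      unfolding norm_vec_def by (rule order.trans[OF L2_set_le_sum]) auto
    also have "\<dots> \<le> (\<Sum>i\<in>UNIV. spectral_norm (matrix_inv Y) * B * (\<integral>p. cmod (P i p) \<partial>N))"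
      by (intro sum_mono conv_bound[OF P gm coordinate_bound[OF B]])
    finally show ?thesis by (simp add: mult_left_mono spectral_norm_nonneg)
  qed
  hence "bounded (range (vector_conv P g))" unfolding bounded_iff by blast
  thus ?thesis unfolding C_ub_def bcontfun_def using uc uniformly_continuous_imp_continuous[OF uc] by auto
qed

text \<open>Estimating the coordinates one at a time would cost a factor depending on the number of
  components. Instead |u|^2 is written as the sum of |u_i| |u_i|, one factor is replaced by its
  integral, and Cauchy-Schwarz over the index is applied under the integral sign, as in Minkowski's
  integral inequality. Only the condition number \<open>kappa Y\<close> is lost.\<close>

lemma vector_conv_bound:
  assumes P: "\<And>i. integrable N (P i)" and w: "\<And>i p. cmod (P i p) \<le> w p"
    and g: "g \<in> C_ub" and int: "integrable N (\<lambda>p. w p * norm (g (E (fst p) x - snd p)))"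
  shows "norm (vector_conv P g x) \<le> kappa Y * (\<integral>p. w p * norm (g (E (fst p) x - snd p)) \<partial>N)"
proof -
  from g have gu: "uniformly_continuous_on UNIV g" and "g \<in> bcontfun" unfolding C_ub_def by auto
  then obtain B where B: "\<And>x. norm (g x) \<le> B"
    unfolding bcontfun_def bounded_iff by auto
  have gm: "coordinate g i \<in> borel_measurable borel" for i
    by (rule coordinate_measurable[OF uniformly_continuous_imp_continuous[OF gu]])
  have w0: "w p \<ge> 0" for p using w[of undefined p] norm_ge_zero order.trans by blast
  let ?y = "\<lambda>p. E (fst p) x - snd p"
  let ?J = "\<integral>p. w p * norm (g (?y p)) \<partial>N"
  define u where "u = (\<chi> i. conv (P i) (coordinate g i) x)"
  note crefl = conv_reflect[OF P gm coordinate_bound[OF B], of _ _ x]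
  have intc: "integrable N (\<lambda>p. cmod (u $ i) * (cmod (P i p) * cmod (coordinate g i (?y p))))" for i
    using integrable_norm[OF crefl(2), of i] by (intro integrable_mult_right) (simp add: norm_mult)
  have "(norm u)\<^sup>2 = (\<Sum>i\<in>UNIV. cmod (u $ i) * cmod (u $ i))"
    by (simp add: norm_vec_def L2_set_def sum_nonneg power2_eq_square)
  also have "\<dots> \<le> (\<Sum>i\<in>UNIV. \<integral>p. cmod (u $ i) * (cmod (P i p) * cmod (coordinate g i (?y p))) \<partial>N)"
  proof (intro sum_mono)
    fix i
    have "cmod (u $ i) \<le> (\<integral>p. cmod (P i p * coordinate g i (?y p)) \<partial>N)"
      unfolding u_def vec_lambda_beta crefl(1) by (rule integral_norm_bound)
    also have "\<dots> = (\<integral>p. cmod (P i p) * cmod (coordinate g i (?y p)) \<partial>N)" by (simp only: norm_mult)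
    finally have "cmod (u $ i) * cmod (u $ i) \<le> cmod (u $ i) * (\<integral>p. cmod (P i p) * cmod (coordinate g i (?y p)) \<partial>N)"
      by (rule mult_left_mono) simp
    thus "cmod (u $ i) * cmod (u $ i) \<le> (\<integral>p. cmod (u $ i) * (cmod (P i p) * cmod (coordinate g i (?y p))) \<partial>N)"
      by (simp only: integral_mult_right_zero)
  qed
  also have "\<dots> = (\<integral>p. (\<Sum>i\<in>UNIV. cmod (u $ i) * (cmod (P i p) * cmod (coordinate g i (?y p)))) \<partial>N)"
    by (rule Bochner_Integration.integral_sum[symmetric]) (rule intc)
  also have "\<dots> \<le> (\<integral>p. norm u * spectral_norm (matrix_inv Y) * (w p * norm (g (?y p))) \<partial>N)"
  proof (rule integral_mono)
    show "integrable N (\<lambda>p. \<Sum>i\<in>UNIV. cmod (u $ i) * (cmod (P i p) * cmod (coordinate g i (?y p))))"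
      by (intro Bochner_Integration.integrable_sum intc)
    show "integrable N (\<lambda>p. norm u * spectral_norm (matrix_inv Y) * (w p * norm (g (?y p))))"
      by (intro integrable_mult_right int)
    fix p :: "real \<times> (real^'d)"
    have "(\<Sum>i\<in>UNIV. cmod (u $ i) * (cmod (P i p) * cmod (coordinate g i (?y p))))
       \<le> (\<Sum>i\<in>UNIV. w p * (cmod (u $ i) * cmod (coordinate g i (?y p))))"
    proof (intro sum_mono)
      fix i
      have "cmod (P i p) * (cmod (u $ i) * cmod (coordinate g i (?y p))) \<le> w p * (cmod (u $ i) * cmod (coordinate g i (?y p)))"
        by (intro mult_right_mono w) simp
      thus "cmod (u $ i) * (cmod (P i p) * cmod (coordinate g i (?y p))) \<le> w p * (cmod (u $ i) * cmod (coordinate g i (?y p)))"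
        by (simp only: mult_ac)
    qed
    also have "\<dots> = w p * (\<Sum>i\<in>UNIV. \<bar>cmod (u $ i)\<bar> * \<bar>cmod (coordinate g i (?y p))\<bar>)"
      by (simp add: sum_distrib_left)
    also have "\<dots> \<le> w p * (L2_set (\<lambda>i. cmod (u $ i)) UNIV * L2_set (\<lambda>i. cmod (coordinate g i (?y p))) UNIV)"
      by (intro mult_left_mono L2_set_mult_ineq w0)
    also have "\<dots> = w p * (norm u * norm (matrix_inv Y *v g (?y p)))"
      unfolding norm_vec_def coordinate_def ..
    also have "\<dots> \<le> w p * (norm u * (spectral_norm (matrix_inv Y) * norm (g (?y p))))"
      by (intro mult_left_mono norm_matrix_vector_le w0 norm_ge_zero)
    also have "\<dots> = norm u * spectral_norm (matrix_inv Y) * (w p * norm (g (?y p)))" by (simp only: mult_ac)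
    finally show "(\<Sum>i\<in>UNIV. cmod (u $ i) * (cmod (P i p) * cmod (coordinate g i (?y p)))) \<le> \<dots>" .
  qed
  also have "\<dots> = norm u * spectral_norm (matrix_inv Y) * ?J" by (rule integral_mult_right_zero)
  finally have sq: "norm u * norm u \<le> norm u * (spectral_norm (matrix_inv Y) * ?J)"
    by (simp add: power2_eq_square mult.assoc)
  have J: "?J \<ge> 0" by (intro integral_nonneg_AE AE_I2 mult_nonneg_nonneg w0 norm_ge_zero)
  have "norm u \<le> spectral_norm (matrix_inv Y) * ?J"
  proof (cases "norm u = 0")
    case True
    thus ?thesis using mult_nonneg_nonneg[OF spectral_norm_nonneg J] by simp
  next
    case False
    thus ?thesis using sq by (simp add: mult_le_cancel_left)
  qed
  hence "spectral_norm Y * norm u \<le> spectral_norm Y * (spectral_norm (matrix_inv Y) * ?J)"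
    by (intro mult_left_mono spectral_norm_nonneg)
  moreover have "norm (vector_conv P g x) \<le> spectral_norm Y * norm u"
    unfolding vector_conv_def u_def by (rule norm_matrix_vector_le)
  ultimately show ?thesis unfolding kappa_def by (simp only: mult.assoc)
qed

definition resolvent_map :: "(real^'d \<Rightarrow> complex^'n) \<Rightarrow> real^'d \<Rightarrow> complex^'n" where
  "resolvent_map g = vector_conv (\<lambda>i. resolvent_kernel (l i) (b i) \<zeta>) g"

definition resolvent_deriv :: "real^'d \<Rightarrow> (real^'d \<Rightarrow> complex^'n) \<Rightarrow> real^'d \<Rightarrow> complex^'n" where
  "resolvent_deriv e g = vector_conv (\<lambda>i. resolvent_kernel_deriv (l i) (b i) \<zeta> e) g"

lemma resolvent_deriv_C_ub: "g \<in> C_ub \<Longrightarrow> resolvent_deriv e g \<in> C_ub"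
  unfolding resolvent_deriv_def by (rule vector_conv_C_ub[OF resolvent_kernel_integrable(2)[OF l \<mu>]])

lemma resolvent_map_has_vector_derivative:
  assumes g: "g \<in> C_ub"
  shows "((\<lambda>h. resolvent_map g (x + h *\<^sub>R e)) has_vector_derivative resolvent_deriv e g x) (at 0)"
proof -
  from g have gu: "uniformly_continuous_on UNIV g" and "g \<in> bcontfun" unfolding C_ub_def by auto
  then obtain B where B: "\<And>x. norm (g x) \<le> B"
    unfolding bcontfun_def bounded_iff by auto
  have "((\<lambda>h. \<Sum>i\<in>UNIV. Y *v axis i (conv (resolvent_kernel (l i) (b i) \<zeta>) (coordinate g i) (x + h *\<^sub>R e))) has_vector_derivative
     (\<Sum>i\<in>UNIV. Y *v axis i (conv (resolvent_kernel_deriv (l i) (b i) \<zeta> e) (coordinate g i) x))) (at 0)"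
  proof (intro has_vector_derivative_sum bounded_linear.has_vector_derivative[OF bounded_linear_axis_image])
    fix i
    show "((\<lambda>h. conv (resolvent_kernel (l i) (b i) \<zeta>) (coordinate g i) (x + h *\<^sub>R e)) has_vector_derivative
       conv (resolvent_kernel_deriv (l i) (b i) \<zeta> e) (coordinate g i) x) (at 0)"
      by (rule conv_has_vector_derivative[OF resolvent_kernel_integrable[OF l \<mu>]
            coordinate_uniformly_continuous[OF gu] coordinate_bound[OF B]
            resolvent_kernel_vector_derivative[OF l] resolvent_kernel_deriv_continuous])
  qed
  thus ?thesis unfolding resolvent_map_def resolvent_deriv_def vector_conv_def matrix_vector_sum_axis .
qed

text \<open>Radiality and the isometry give \<theta>(x) = \<theta>(E t x), so the growth condition
  compares \<theta>(x) with \<theta> at the shifted point at the price of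
  \<open>exp (\<eta> * norm z)\<close>. The Gaussian weight absorbs this exponential, and
  \<open>F\<close> sums the result.\<close>

lemma weighted_bound:
  fixes m :: nat
  assumes P: "\<And>i. integrable N (P i)" and w: "\<And>i p. cmod (P i p) \<le> c * gauss_weight m \<mu>' \<alpha> p" and c: "c \<ge> 0"
    and m: "m \<le> 1" and pos: "\<alpha> > 0" "\<mu>' > 0"
    and weight: "weight_function \<theta> \<eta> C\<theta>" "radial \<theta>"
    and \<eta>: "\<eta> \<le> 2 * sqrt \<delta> * sqrt (\<alpha> * \<mu>')"
    and F: "(\<lambda>k. (2 * sqrt \<delta>) ^ k / fact k * Gamma ((real CARD('d) + m + k) / 2) * Gamma (1 + (real k - m) / 2) / Gamma (real CARD('d) / 2)) sums F"
    and g: "g \<in> C_ub" and K: "\<And>x. \<theta> x * norm (g x) \<le> K"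
  shows "norm (vector_conv P g x) \<le> kappa Y * (c * (C\<theta> * K / \<theta> x) *
     (pi powr (real CARD('d) / 2) * \<alpha> powr (- ((real CARD('d) + m) / 2)) * \<mu>' powr (m / 2 - 1) * F))"
proof -
  have \<theta>: "\<theta> x > 0" for x using weight unfolding weight_function_def by auto
  have \<eta>0: "\<eta> \<ge> 0" and C\<theta>: "C\<theta> > 0" using weight unfolding weight_function_def by auto
  have K0: "K \<ge> 0" using K[of 0] \<theta>[of 0] by (smt (verit) mult_nonneg_nonneg norm_ge_zero)
  have gb: "norm (g (E t x - z)) \<le> C\<theta> * K / \<theta> x * exp (\<eta> * norm z)" for t z
  proof -
    have "\<theta> x = \<theta> (E t x)"
      using weight(2) flow_norm[of t x] unfolding radial_def by (metis)
    also have "\<dots> = \<theta> ((E t x - z) + z)" by simp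
    also have "\<dots> \<le> C\<theta> * \<theta> (E t x - z) * exp (\<eta> * norm z)"
      using weight(1) unfolding weight_function_def by blast
    finally have "\<theta> x * norm (g (E t x - z)) \<le> C\<theta> * \<theta> (E t x - z) * exp (\<eta> * norm z) * norm (g (E t x - z))"
      by (rule mult_right_mono) simp
    also have "\<dots> = C\<theta> * exp (\<eta> * norm z) * (\<theta> (E t x - z) * norm (g (E t x - z)))" by (simp only: mult_ac)
    also have "\<dots> \<le> C\<theta> * exp (\<eta> * norm z) * K" by (intro mult_left_mono K) (use C\<theta> in simp)
    finally show ?thesis using \<theta>[of x] by (simp add: field_simps)
  qed
  have dim: "DIM(real^'d) = CARD('d)" by simp
  note gw = gauss_weight_exp[OF m pos \<eta>0 \<eta> F[folded dim], unfolded dim]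
  let ?W = "\<lambda>p. gauss_weight m \<mu>' \<alpha> p * exp (\<eta> * norm (snd p))"
  let ?D = "C\<theta> * K / \<theta> x"
  have D0: "?D \<ge> 0" using C\<theta> K0 \<theta>[of x] by (simp add: less_imp_le)
  have le: "c * gauss_weight m \<mu>' \<alpha> p * norm (g (E (fst p) x - snd p)) \<le> c * ?D * ?W p" for p
  proof -
    have "c * gauss_weight m \<mu>' \<alpha> p * norm (g (E (fst p) x - snd p)) \<le> c * gauss_weight m \<mu>' \<alpha> p * (?D * exp (\<eta> * norm (snd p)))"
      by (intro mult_left_mono gb) (use c in simp)
    thus ?thesis by (simp only: mult_ac)
  qed
  have gm: "g \<in> borel_measurable borel"
    using g unfolding C_ub_def by (auto intro!: borel_measurable_continuous_onI uniformly_continuous_imp_continuous)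
  have intW: "integrable N (\<lambda>p. c * ?D * ?W p)" by (intro integrable_mult_right gw(1))
  have int: "integrable N (\<lambda>p. c * gauss_weight m \<mu>' \<alpha> p * norm (g (E (fst p) x - snd p)))"
  proof (rule Bochner_Integration.integrable_bound[OF intW])
    note [measurable] = gm
    show "(\<lambda>p. c * gauss_weight m \<mu>' \<alpha> p * norm (g (E (fst p) x - snd p))) \<in> borel_measurable N"
      by measurable
    show "AE p in N. norm (c * gauss_weight m \<mu>' \<alpha> p * norm (g (E (fst p) x - snd p))) \<le> norm (c * ?D * ?W p)"
    proof (rule AE_I2)
      fix p
      have "c * gauss_weight m \<mu>' \<alpha> p * norm (g (E (fst p) x - snd p)) \<ge> 0" using c by simp
      thus "norm (c * gauss_weight m \<mu>' \<alpha> p * norm (g (E (fst p) x - snd p))) \<le> norm (c * ?D * ?W p)"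
        using le[of p] unfolding real_norm_def by linarith
    qed
  qed
  have "norm (vector_conv P g x) \<le> kappa Y * (\<integral>p. c * gauss_weight m \<mu>' \<alpha> p * norm (g (E (fst p) x - snd p)) \<partial>N)"
    by (rule vector_conv_bound[OF P w g int])
  also have "\<dots> \<le> kappa Y * (\<integral>p. c * ?D * ?W p \<partial>N)"
    by (intro mult_left_mono integral_mono int intW le) (simp add: kappa_def spectral_norm_nonneg)
  also have "(\<integral>p. c * ?D * ?W p \<partial>N) = c * ?D * (\<integral>p. ?W p \<partial>N)" by (rule integral_mult_right_zero)
  also have "kappa Y * (c * ?D * (\<integral>p. ?W p \<partial>N)) \<le> kappa Y * (c * ?D * (pi powr (real CARD('d) / 2) * \<alpha> powr (- ((real CARD('d) + m) / 2)) * \<mu>' powr (m / 2 - 1) * F))"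
    by (intro mult_left_mono gw(2) mult_nonneg_nonneg c D0) (simp add: kappa_def spectral_norm_nonneg)
  finally show ?thesis .
qed

end

section \<open>Identification of the solution with the resolvent\<close>

lemma OU_semigroup_coordinates:
  fixes S :: "real^'d^'d" and Y :: "complex^'n^'n" and v :: "real^'d \<Rightarrow> complex^'n"
  assumes ou: "diagonal_ou Y (\<lambda>t x. matrix_exp (t *\<^sub>R S) *v x) l b \<zeta>"
    and t: "t > 0" and v: "v \<in> C_ub"
  shows "OU_semigroup Y (diagonalizing.similar_diag Y l) (diagonalizing.similar_diag Y b) S t v x =
    Y *v (\<chi> i. isometric_flow.ou_op (\<lambda>t x. matrix_exp (t *\<^sub>R S) *v x) (l i) (b i) t (diagonal_ou.coordinate Y v i) x)"
proof -
  interpret diagonal_ou Y "\<lambda>t x. matrix_exp (t *\<^sub>R S) *v x" l b \<zeta> by (rule ou)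
  from v have vu: "uniformly_continuous_on UNIV v" and "v \<in> bcontfun" unfolding C_ub_def by auto
  then obtain B where B: "\<And>x. norm (v x) \<le> B"
    unfolding bcontfun_def bounded_iff by auto
  let ?k = "\<lambda>i \<xi>. ou_scalar_kernel (l i) (b i) t (matrix_exp (t *\<^sub>R S) *v x - \<xi>) * coordinate v i \<xi>"
  have int: "integrable lborel (?k i)" for i
    by (rule ou_op_integrable(1)[OF l t coordinate_measurable[OF uniformly_continuous_imp_continuous[OF vu]] coordinate_bound[OF B]])
  have "OU_semigroup Y (similar_diag l) (similar_diag b) S t v x = (\<integral>\<xi>. (\<Sum>i\<in>UNIV. Y *v axis i (?k i \<xi>)) \<partial>lborel)"
  proof -
    have "OU_kernel Y (similar_diag l) (similar_diag b) S x \<xi> t *v v \<xi> = (\<Sum>i\<in>UNIV. Y *v axis i (?k i \<xi>))" for \<xi>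
      unfolding OU_kernel_similar_diag[OF t l] similar_diag_vector_mult matrix_vector_sum_axis coordinate_def ..
    thus ?thesis unfolding OU_semigroup_def using t by simp
  qed
  also have "\<dots> = (\<Sum>i\<in>UNIV. \<integral>\<xi>. Y *v axis i (?k i \<xi>) \<partial>lborel)"
    by (rule Bochner_Integration.integral_sum) (rule integrable_bounded_linear[OF bounded_linear_axis_image int])
  also have "\<dots> = (\<Sum>i\<in>UNIV. Y *v axis i (\<integral>\<xi>. ?k i \<xi> \<partial>lborel))"
    by (intro sum.cong refl integral_bounded_linear[OF bounded_linear_axis_image int])
  finally show ?thesis unfolding matrix_vector_sum_axis ou_op_def .
qed

text \<open>The coordinate functionals are bounded and linear, so the uniform generator limit passes
  to each coordinate and the scalar result applies there. Every solution is thereby forced to be the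
  resolvent of \<open>g\<close>, which includes uniqueness.\<close>

lemma generator_solution_eq_resolvent:
  fixes S :: "real^'d^'d" and Y :: "complex^'n^'n" and v g :: "real^'d \<Rightarrow> complex^'n"
  assumes ou: "diagonal_ou Y (\<lambda>t x. matrix_exp (t *\<^sub>R S) *v x) l b \<zeta>"
    and v: "v \<in> generator_domain Y (diagonalizing.similar_diag Y l) (diagonalizing.similar_diag Y b) S"
    and eq: "\<forall>x. \<zeta> *s v x - generator Y (diagonalizing.similar_diag Y l) (diagonalizing.similar_diag Y b) S v x = g x"
  shows "v = diagonal_ou.resolvent_map Y (\<lambda>t x. matrix_exp (t *\<^sub>R S) *v x) l b \<zeta> g"
proof
  fix x
  interpret diagonal_ou Y "\<lambda>t x. matrix_exp (t *\<^sub>R S) *v x" l b \<zeta> by (rule ou)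
  let ?A = "similar_diag l" and ?B = "similar_diag b"
  from v obtain w where w: "has_generator_value Y ?A ?B S v w" unfolding generator_domain_def by auto
  have lim_x: "((\<lambda>t. (1 / t) *\<^sub>R (OU_semigroup Y ?A ?B S t v x - v x)) \<longlongrightarrow> w' x) (at_right 0)"
    if "has_generator_value Y ?A ?B S v w'" for w' x
    using that unfolding has_generator_value_def by (auto intro: tendsto_uniform_limitI[where x = x])
  \<comment> \<open>The description in \<open>generator\<close> denotes \<open>w\<close>, because
    limits from the right at 0 are unique at every point.\<close>
  have gen: "generator Y ?A ?B S v = w"
    unfolding generator_def
  proof (rule the_equality)
    show "has_generator_value Y ?A ?B S v w" by (rule w)
    fix w' assume w': "has_generator_value Y ?A ?B S v w'"
    show "w' = w"
      by (rule ext, rule tendsto_unique[OF _ lim_x[OF w'] lim_x[OF w]]) simp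
  qed
  have vC: "v \<in> C_ub" and wC: "w \<in> C_ub"
    using w unfolding has_generator_value_def C_rub_def by auto
  have bnd: "\<exists>B. \<forall>x. norm (u x) \<le> B" and cont: "continuous_on UNIV u" if "u \<in> C_ub" for u :: "real^'d \<Rightarrow> complex^'n"
    using that unfolding C_ub_def bcontfun_def bounded_iff by auto
  from bnd[OF vC] obtain Bv where Bv: "\<And>x. norm (v x) \<le> Bv" by auto
  from bnd[OF wC] obtain Bw where Bw: "\<And>x. norm (w x) \<le> Bw" by auto
  have coord: "coordinate v i x = conv (resolvent_kernel (l i) (b i) \<zeta>) (coordinate g i) x" for i x
  proof -
    have "uniform_limit UNIV (\<lambda>h x. (matrix_inv Y *v ((1 / h) *\<^sub>R (OU_semigroup Y ?A ?B S h v x - v x))) $ i)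
        (\<lambda>x. (matrix_inv Y *v w x) $ i) (at_right 0)"
      using w unfolding has_generator_value_def
      by (intro bounded_linear.uniform_limit[OF bounded_linear_coordinate]) auto
    moreover have "\<forall>\<^sub>F h in at_right 0. \<forall>x\<in>UNIV. (matrix_inv Y *v ((1 / h) *\<^sub>R (OU_semigroup Y ?A ?B S h v x - v x))) $ i
        = (1 / of_real h) * (ou_op (l i) (b i) h (coordinate v i) x - coordinate v i x)"
      using eventually_at_right_less[of "0::real"]
    proof eventually_elim
      case (elim h)
      show ?case
      proof
        fix x
        have "OU_semigroup Y ?A ?B S h v x - v x = Y *v (\<chi> i. ou_op (l i) (b i) h (coordinate v i) x - coordinate v i x)"
        proof -
          have "OU_semigroup Y ?A ?B S h v x - v x = Y *v (\<chi> i. ou_op (l i) (b i) h (coordinate v i) x) - Y *v (\<chi> i. coordinate v i x)"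
            unfolding OU_semigroup_coordinates[OF ou elim vC] coordinate_inverse ..
          also have "\<dots> = Y *v ((\<chi> i. ou_op (l i) (b i) h (coordinate v i) x) - (\<chi> i. coordinate v i x))"
            by (simp only: matrix_vector_mult_diff_distrib)
          also have "(\<chi> i. ou_op (l i) (b i) h (coordinate v i) x) - (\<chi> i. coordinate v i x) = (\<chi> i. ou_op (l i) (b i) h (coordinate v i) x - coordinate v i x)"
            by (simp add: vec_eq_iff)
          finally show ?thesis .
        qed
        moreover have "matrix_inv Y *v (r *\<^sub>R (Y *v u)) = r *\<^sub>R u" for r and u :: "complex^'n"
        proof -
          have "matrix_inv Y *v (r *\<^sub>R (Y *v u)) = r *\<^sub>R (matrix_inv Y *v (Y *v u))"
            by (rule linear_cmul[OF matrix_vector_mul_linear])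
          thus ?thesis by (simp add: matrix_vector_mul_assoc inv_left)
        qed
        ultimately have "(matrix_inv Y *v ((1 / h) *\<^sub>R (OU_semigroup Y ?A ?B S h v x - v x))) $ i
          = (1 / h) *\<^sub>R (ou_op (l i) (b i) h (coordinate v i) x - coordinate v i x)"
          by (simp only: vector_scaleR_component vec_lambda_beta)
        thus "(matrix_inv Y *v ((1 / h) *\<^sub>R (OU_semigroup Y ?A ?B S h v x - v x))) $ i
          = (1 / of_real h) * (ou_op (l i) (b i) h (coordinate v i) x - coordinate v i x)"
          unfolding scaleR_conv_of_real[of "1 / h" "ou_op (l i) (b i) h (coordinate v i) x - coordinate v i x"] by simp
      qed
    qed
    ultimately have lim: "uniform_limit UNIV (\<lambda>h x. (1 / of_real h) * (ou_op (l i) (b i) h (coordinate v i) x - coordinate v i x))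
        (coordinate w i) (at_right 0)"
      unfolding coordinate_def[of w, abs_def, symmetric]
      by (rule uniform_limit_cong[THEN iffD1, rotated 2]) (simp add: coordinate_def)
    note cv = coordinate_measurable[OF cont[OF vC], where i = i] coordinate_bound[OF Bv, where i = i]
    note cw = coordinate_measurable[OF cont[OF wC], where i = i] coordinate_bound[OF Bw, where i = i]
    have "coordinate v i x = resolvent (l i) (b i) \<zeta> (\<lambda>x. \<zeta> * coordinate v i x - coordinate w i x) x"
      by (rule resolvent_generator[OF l \<mu> cv cw lim])
    \<comment> \<open>The equation \<open>g = \<zeta> v - w\<close> in coordinates; below it also
      supplies measurability and a bound for \<open>g\<close> from those of \<open>v\<close> and
      \<open>w\<close>.\<close>
    also have "(\<lambda>x. \<zeta> * coordinate v i x - coordinate w i x) = coordinate g i"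
    proof
      fix x
      have "g x = \<zeta> *s v x - w x" using eq unfolding gen by simp
      thus "\<zeta> * coordinate v i x - coordinate w i x = coordinate g i x"
        unfolding coordinate_def by (simp add: matrix_vector_mult_diff_distrib vector_scalar_commute)
    qed
    also have "resolvent (l i) (b i) \<zeta> (coordinate g i) x = conv (resolvent_kernel (l i) (b i) \<zeta>) (coordinate g i) x"
    proof (rule resolvent_eq_conv[OF l \<mu>])
      have gx: "g = (\<lambda>x. \<zeta> *s v x - w x)" using eq unfolding gen by auto
      show "coordinate g i \<in> borel_measurable borel"
        unfolding \<open>(\<lambda>x. \<zeta> * coordinate v i x - coordinate w i x) = coordinate g i\<close>[symmetric]
        using cv(1) cw(1) by measurable
      show "cmod (coordinate g i x) \<le> cmod \<zeta> * (spectral_norm (matrix_inv Y) * Bv) + spectral_norm (matrix_inv Y) * Bw" for x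
        unfolding \<open>(\<lambda>x. \<zeta> * coordinate v i x - coordinate w i x) = coordinate g i\<close>[symmetric]
        by (rule order.trans[OF norm_triangle_ineq4]) (intro add_mono cw(2), simp add: norm_mult mult_left_mono cv(2))
    qed
    finally show ?thesis .
  qed
  have "v x = Y *v (\<chi> i. coordinate v i x)" by (rule coordinate_inverse[symmetric])
  thus "v x = resolvent_map g x" unfolding resolvent_map_def vector_conv_def coord .
qed

section \<open>Evaluation of the constants\<close>

lemma C7_constant:
  fixes am a a0 \<mu> :: real and d :: nat
  assumes "am > 0" "a > 0" "a0 > 0" "\<mu> > 0"
  shows "(4 * pi * a) powr (- (real d / 2)) * (pi powr (real d / 2) * (a0 / (4 * am\<^sup>2)) powr (- ((real d + 0) / 2)) * \<mu> powr (0 / 2 - 1))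
     = (am\<^sup>2 / (a * a0)) powr (real d / 2) / \<mu>"
proof -
  \<comment> \<open>Up to sign all spatial factors carry the exponent d/2; their bases 1 / (4 pi a),
    pi and 1 / \<alpha> = 4 am^2 / a0 multiply to the ratio \<open>a_one\<close>.\<close>
  have "(am\<^sup>2 / (a * a0)) powr (real d / 2) = (inverse (4 * pi * a) * (pi * inverse (a0 / (4 * am\<^sup>2)))) powr (real d / 2)"
    using assms by (intro arg_cong[of _ _ "\<lambda>x. x powr (real d / 2)"]) (simp add: field_simps)
  also have "\<dots> = inverse (4 * pi * a) powr (real d / 2) * (pi powr (real d / 2) * inverse (a0 / (4 * am\<^sup>2)) powr (real d / 2))"
    using assms by (simp only: powr_mult)
  finally show ?thesis using assms
    unfolding inverse_powr powr_minus by (simp add: powr_minus_divide)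
qed

text \<open>Compared with the zeroth-order constant there is an extra factor
  \<open>?\<alpha> powr (- (1/2)) / (2 * a)\<close>. Since \<alpha>^(-1/2) = 2 am / sqrt a0, it
  equals the root of \<open>a_one\<close> divided by the root of \<open>a\<close>, the origin of
  \<open>a_min A powr (1/2)\<close> in the gradient constant.\<close>

lemma C8_constant:
  fixes am a a0 \<mu> :: real and d :: nat
  assumes "am > 0" "a > 0" "a0 > 0" "\<mu> > 0"
  shows "(4 * pi * a) powr (- (real d / 2)) / (2 * a) * (pi powr (real d / 2) * (a0 / (4 * am\<^sup>2)) powr (- ((real d + 1) / 2)) * \<mu> powr (1 / 2 - 1))
     = (am\<^sup>2 / (a * a0)) powr ((real d + 1) / 2) / a powr (1/2) / \<mu> powr (1/2)"
proof -
  let ?\<alpha> = "a0 / (4 * am\<^sup>2)"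
  have \<alpha>: "?\<alpha> > 0" using assms by simp
  have 1: "?\<alpha> powr (- ((real d + 1) / 2)) = ?\<alpha> powr (- ((real d + 0) / 2)) * ?\<alpha> powr (- (1/2))"
    unfolding powr_add [symmetric] by (rule arg_cong[of _ _ "\<lambda>x. ?\<alpha> powr x"]) (simp add: field_simps)
  have 2: "(am\<^sup>2 / (a * a0)) powr ((real d + 1) / 2) = (am\<^sup>2 / (a * a0)) powr (real d / 2) * (am\<^sup>2 / (a * a0)) powr (1/2)"
    unfolding powr_add [symmetric] by (rule arg_cong[of _ _ "\<lambda>x. (am\<^sup>2 / (a * a0)) powr x"]) (simp add: field_simps)
  have 3: "?\<alpha> powr (- (1/2)) / (2 * a) = (am\<^sup>2 / (a * a0)) powr (1/2) / a powr (1/2)"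
  proof -
    have A: "?\<alpha> powr (- (1/2)) = 2 * am / sqrt a0"
      using assms by (simp add: powr_minus_divide powr_half_sqrt real_sqrt_divide real_sqrt_mult)
    have B: "(am\<^sup>2 / (a * a0)) powr (1/2) = am / (sqrt a * sqrt a0)"
      using assms by (simp add: powr_half_sqrt real_sqrt_divide real_sqrt_mult)
    have "am / (sqrt a * sqrt a0) / sqrt a = am / ((sqrt a * sqrt a) * sqrt a0)" by simp
    also have "sqrt a * sqrt a = a" using assms by simp
    finally have C: "am / (sqrt a * sqrt a0) / sqrt a = am / (a * sqrt a0)" .
    have "a powr (1/2) = sqrt a" using assms by (simp add: powr_half_sqrt)
    thus ?thesis unfolding A B by (simp only: C) simp
  qed
  have "\<mu> powr (1/2 - 1) = \<mu> powr (0/2 - 1) * \<mu> powr (1/2)"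
    unfolding powr_add [symmetric] by simp
  moreover have "\<mu> powr (1/2) * \<mu> powr (1/2) = \<mu>"
    unfolding powr_add [symmetric] using assms by simp
  ultimately have 4: "\<mu> powr (1/2 - 1) = 1 / \<mu> powr (1/2)"
    using assms by (simp add: powr_minus_divide field_simps)
  have 5: "(4 * pi * a) powr (- (real d / 2)) * (pi powr (real d / 2) * ?\<alpha> powr (- ((real d + 0) / 2))) = (am\<^sup>2 / (a * a0)) powr (real d / 2)"
    using C7_constant[OF assms(1-3), of 1 d] by simp
  have "(4 * pi * a) powr (- (real d / 2)) / (2 * a) * (pi powr (real d / 2) * ?\<alpha> powr (- ((real d + 1) / 2)) * \<mu> powr (1 / 2 - 1))
    = ((4 * pi * a) powr (- (real d / 2)) * (pi powr (real d / 2) * ?\<alpha> powr (- ((real d + 0) / 2)))) * (?\<alpha> powr (- (1/2)) / (2 * a)) * (1 / \<mu> powr (1/2))"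
    unfolding 1 4 by (simp add: mult_ac)
  thus ?thesis unfolding 5 3 2 by (simp add: mult_ac)
qed

text \<open>That the minima are attained is what transfers positivity from the individual
  eigenvalues to the constants.\<close>

lemma spectral_constants:
  fixes Y :: "complex^'n^'n" and l :: "'n \<Rightarrow> complex"
  assumes Y: "diagonalizing Y"
  defines "M \<equiv> diagonalizing.similar_diag Y l"
  shows "min_Re_spectrum M \<le> Re (l i)" "a_min M \<le> cmod (l i)" "cmod (l i) \<le> a_max M"
    and "\<exists>i. min_Re_spectrum M = Re (l i)" "\<exists>i. a_min M = cmod (l i)"
proof -
  have sp: "spectrum M = range l" unfolding M_def by (rule diagonalizing.spectrum_similar_diag[OF Y])
  show "min_Re_spectrum M \<le> Re (l i)" "a_min M \<le> cmod (l i)" "cmod (l i) \<le> a_max M"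
    unfolding min_Re_spectrum_def a_min_def a_max_def sp by (auto intro!: Min_le Max_ge)
  have "Min (Re ` range l) \<in> Re ` range l" "Min (cmod ` range l) \<in> cmod ` range l"
    by (intro Min_in; simp)+
  thus "\<exists>i. min_Re_spectrum M = Re (l i)" "\<exists>i. a_min M = cmod (l i)"
    unfolding min_Re_spectrum_def a_min_def sp by blast+
qed

theorem theorem6p6:
  fixes A B Y :: "complex^'n^'n"
    and S :: "real^'d^'d"
    and \<delta> \<eta> C\<theta> C :: real
    and \<zeta> :: complex
    and \<theta> :: "real^'d \<Rightarrow> real"
    and g v :: "real^'d \<Rightarrow> complex^'n"
  assumes "CARD('d) \<ge> 2"
    and "simultaneously_diagonalizable_with Y A B"
    and "\<forall>\<mu>\<in>spectrum A. Re \<mu> > 0"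
    and "transpose S = - S"
    and "0 < \<delta>" and "\<delta> < 1"
    and "Re \<zeta> > omega_b B"
    and "weight_function \<theta> \<eta> C\<theta>" and "radial \<theta>"
    and "0 \<le> \<eta>\<^sup>2"
    and "\<eta>\<^sup>2 \<le> \<delta> * (min_Re_spectrum A * (Re \<zeta> - omega_b B) / (a_max A)\<^sup>2)"
    and "C > 0" and "\<forall>x. \<theta> x \<ge> C"
    and "g \<in> C_rub S"
    and "v \<in> generator_domain Y A B S"
    and "\<forall>x. \<zeta> *s v x - generator Y A B S v x = g x"
  shows "v \<in> C_rub S \<inter> C1_ub \<and>
    (g \<in> C_b_weighted \<theta> \<longrightarrow>
      v \<in> C_rub S \<inter> C1_ub \<inter> C1_b_weighted \<theta> \<and>
      weighted_norm \<theta> v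
        \<le> const_C7 CARD('d) Y A C\<theta> \<delta> / (Re \<zeta> - omega_b B) * weighted_norm \<theta> g \<and>
      (\<forall>i. weighted_norm \<theta> (partial i v)
        \<le> const_C8 CARD('d) Y A C\<theta> \<delta> / (Re \<zeta> - omega_b B) powr (1/2) * weighted_norm \<theta> g) \<and>
      (\<forall>x. norm (v x)
        \<le> const_C7 CARD('d) Y A C\<theta> \<delta> / (Re \<zeta> - omega_b B) * (1 / \<theta> x) * weighted_norm \<theta> g) \<and>
      (\<forall>x i. norm (partial i v x)
        \<le> const_C8 CARD('d) Y A C\<theta> \<delta> / (Re \<zeta> - omega_b B) powr (1/2) * (1 / \<theta> x) * weighted_norm \<theta> g))"
proof -
  let ?E = "\<lambda>t x. matrix_exp (t *\<^sub>R S) *v x"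
  have inv: "invertible Y" and dA: "diagonal_matrix (matrix_inv Y ** A ** Y)" and dB: "diagonal_matrix (matrix_inv Y ** B ** Y)"
    using assms(2) unfolding simultaneously_diagonalizable_with_def by auto
  have diagY: "diagonalizing Y" by (rule diagonalizing.intro[OF inv])
  define l where "l = (\<lambda>i. (matrix_inv Y ** A ** Y) $ i $ i)"
  define b where "b = (\<lambda>i. (matrix_inv Y ** B ** Y) $ i $ i)"
  have A: "A = diagonalizing.similar_diag Y l"
    unfolding l_def by (rule diagonalizing.diagonalizable_eq_similar_diag[OF diagY dA])
  have B: "B = diagonalizing.similar_diag Y b"
    unfolding b_def by (rule diagonalizing.diagonalizable_eq_similar_diag[OF diagY dB])
  have l_pos: "Re (l i) > 0" for i
    using assms(3) diagonalizing.spectrum_similar_diag[OF diagY, of l] unfolding A by blast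
  note sA = spectral_constants[OF diagY, of l, folded A]
  note sB = spectral_constants[OF diagY, of b, folded B]
  define \<mu> where "\<mu> = Re \<zeta> - omega_b B"
  have mu_pos: "\<mu> > 0" unfolding \<mu>_def using assms(7) by simp
  have \<mu>_le: "\<mu> \<le> Re \<zeta> + Re (b i)" for i
    unfolding \<mu>_def omega_b_def using sB(1)[of i] by simp
  have ou: "diagonal_ou Y ?E l b \<zeta>"
  proof (intro diagonal_ou.intro diagonal_ou_axioms.intro diagY isometric_flow_skew assms(4) l_pos)
    show "Re \<zeta> + Re (b i) > 0" for i using mu_pos \<mu>_le[of i] by linarith
  qed
  interpret diagonal_ou Y ?E l b \<zeta> by (rule ou)
  \<comment> \<open>\<alpha> is a lower bound for the Gaussian rates of all components: numerator
    and denominator of Re l / (4 |l|^2) are estimated separately.\<close>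
  define a a0 am \<alpha> where "a = a_min A" and "a0 = min_Re_spectrum A" and "am = a_max A" and "\<alpha> = a0 / (4 * am\<^sup>2)"
  have a0: "a0 > 0" unfolding a0_def using sA(4) l_pos by auto
  have a: "a > 0"
  proof -
    obtain i where "a = cmod (l i)" unfolding a_def using sA(5) by auto
    moreover have "l i \<noteq> 0" using l_pos[of i] by auto
    ultimately show ?thesis by simp
  qed
  have a_le: "a \<le> cmod (l i)" for i unfolding a_def by (rule sA(2))
  \<comment> \<open>\<open>undefined\<close> merely names some index; the index type is
    inhabited.\<close>
  have am: "am > 0" using a a_le[of undefined] sA(3)[of undefined] unfolding am_def by linarith
  have \<alpha>: "\<alpha> > 0" unfolding \<alpha>_def using a0 am by simp
  have \<alpha>_le: "\<alpha> \<le> Re (l i) / (4 * (cmod (l i))\<^sup>2)" for i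
  proof -
    have "cmod (l i) > 0" using a a_le[of i] by linarith
    moreover have "(cmod (l i))\<^sup>2 \<le> am\<^sup>2" unfolding am_def by (intro power_mono sA(3)) simp
    moreover have "a0 \<le> Re (l i)" unfolding a0_def by (rule sA(1))
    ultimately show ?thesis unfolding \<alpha>_def using a0 by (intro frac_le) auto
  qed
  \<comment> \<open>Squared, the right side is 4 \<delta> \<alpha> \<mu> = \<delta> a0 \<mu> / am^2,
    so this is the growth condition in the form that the series estimate takes.\<close>
  have \<eta>: "\<eta> \<le> 2 * sqrt \<delta> * sqrt (\<alpha> * \<mu>)"
  proof (rule power2_le_imp_le)
    have "\<eta>\<^sup>2 \<le> \<delta> * (a0 * \<mu> / am\<^sup>2)" using assms(11) unfolding a0_def \<mu>_def am_def .
    also have "\<dots> = (2 * sqrt \<delta> * sqrt (\<alpha> * \<mu>))\<^sup>2"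
    proof -
      have "(2 * sqrt \<delta> * sqrt (\<alpha> * \<mu>))\<^sup>2 = 4 * \<delta> * (\<alpha> * \<mu>)"
        using assms(5) \<alpha> mu_pos by (simp add: power_mult_distrib)
      thus ?thesis using am unfolding \<alpha>_def by simp
    qed
    finally show "\<eta>\<^sup>2 \<le> (2 * sqrt \<delta> * sqrt (\<alpha> * \<mu>))\<^sup>2" .
    show "2 * sqrt \<delta> * sqrt (\<alpha> * \<mu>) \<ge> 0" using assms(5) \<alpha> mu_pos by simp
  qed
  have gC: "g \<in> C_ub" using assms(14) unfolding C_rub_def by simp
  \<comment> \<open>Differentiability and decay of \<open>v\<close> are read off from this
    representation, whereas membership in \<open>C_rub\<close> comes with the domain of the
    generator.\<close>
  have v_eq: "v = resolvent_map g"
    by (rule generator_solution_eq_resolvent[OF ou]) (use assms(15,16) in \<open>simp_all only: A [symmetric] B [symmetric] simp_thms\<close>)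
  have v_rub: "v \<in> C_rub S"
    using assms(15) unfolding generator_domain_def has_generator_value_def by auto
  have deriv: "((\<lambda>h. v (x + h *\<^sub>R axis i 1)) has_vector_derivative resolvent_deriv (axis i 1) g x) (at 0)" for x i
    unfolding v_eq by (rule resolvent_map_has_vector_derivative[OF gC])
  have partial: "partial i v = resolvent_deriv (axis i 1) g" for i
    unfolding partial_def by (rule ext) (rule vector_derivative_at[OF deriv])
  have has_p: "has_partial i v x" for i x
    unfolding has_partial_def using deriv by (rule differentiableI_vector)
  have v1: "v \<in> C1_ub"
    unfolding C1_ub_def using has_p partial resolvent_deriv_C_ub[OF gC] v_rub unfolding C_rub_def by auto
  have main: "v \<in> C1_b_weighted \<theta> \<and>
      weighted_norm \<theta> v \<le> const_C7 CARD('d) Y A C\<theta> \<delta> / \<mu> * weighted_norm \<theta> g \<and>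
      (\<forall>i. weighted_norm \<theta> (partial i v) \<le> const_C8 CARD('d) Y A C\<theta> \<delta> / \<mu> powr (1/2) * weighted_norm \<theta> g) \<and>
      (\<forall>x. norm (v x) \<le> const_C7 CARD('d) Y A C\<theta> \<delta> / \<mu> * (1 / \<theta> x) * weighted_norm \<theta> g) \<and>
      (\<forall>x i. norm (partial i v x) \<le> const_C8 CARD('d) Y A C\<theta> \<delta> / \<mu> powr (1/2) * (1 / \<theta> x) * weighted_norm \<theta> g)"
    if gw: "g \<in> C_b_weighted \<theta>"
  proof -
    let ?d = "real CARD('d)" and ?K = "weighted_norm \<theta> g"
    let ?C7 = "const_C7 CARD('d) Y A C\<theta> \<delta>" and ?C8 = "const_C8 CARD('d) Y A C\<theta> \<delta>"
    have \<theta>: "\<theta> x > 0" for x using assms(8) unfolding weight_function_def by auto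
    have dpos: "CARD('d) > 0" by simp
    have K: "\<theta> x * norm (g x) \<le> ?K" for x
    proof -
      from gw obtain D where D: "\<And>x. norm (\<theta> x *\<^sub>R g x) \<le> D"
        unfolding C_b_weighted_def bounded_iff by auto
      have "norm (\<theta> x *\<^sub>R g x) \<le> ?K" unfolding weighted_norm_def
        by (rule cSUP_upper[OF UNIV_I bdd_aboveI2[OF D]])
      thus ?thesis using \<theta>[of x] by simp
    qed
    have pw7: "norm (v x) \<le> ?C7 / \<mu> * (1 / \<theta> x) * ?K" for x
    proof -
      define F where "F = 1 / (1 - \<delta>) *
        (hypergeo_real (- ((?d - 1) / 2)) 1 (1/2) (- (\<delta> / (1 - \<delta>)))
         + pi powr (1/2) * (Gamma ((?d + 1) / 2) / Gamma (?d / 2)) * (\<delta> / (1 - \<delta>)) powr (1/2)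
           * hypergeo_real (- ((?d - 2) / 2)) (3/2) (3/2) (- (\<delta> / (1 - \<delta>))))"
      have "(\<lambda>k. (2 * sqrt \<delta>) ^ k / fact k * Gamma ((?d + real k) / 2) * Gamma (real k / 2 + 1) / Gamma (?d / 2)) sums F"
        unfolding F_def by (rule gamma_series_C7[OF dpos assms(5,6)])
      hence Fs: "(\<lambda>k. (2 * sqrt \<delta>) ^ k / fact k * Gamma ((?d + real 0 + real k) / 2) * Gamma (1 + (real k - real 0) / 2) / Gamma (?d / 2)) sums F"
        by (simp only: of_nat_0 add_0_right diff_0_right add.commute[of 1])
      have "norm (v x) \<le> kappa Y * ((4 * pi * a) powr (- (?d / 2)) * (C\<theta> * ?K / \<theta> x) *
         (pi powr (?d / 2) * \<alpha> powr (- ((?d + real 0) / 2)) * \<mu> powr (real 0 / 2 - 1) * F))"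
        unfolding v_eq resolvent_map_def
      proof (rule weighted_bound[OF resolvent_kernel_integrable(1)[OF diagonal_ou.l[OF ou] diagonal_ou.\<mu>[OF ou]] _ _ _ \<alpha> mu_pos assms(8,9) \<eta> Fs gC K])
        show "cmod (resolvent_kernel (l i) (b i) \<zeta> p) \<le> (4 * pi * a) powr (- (?d / 2)) * gauss_weight 0 \<mu> \<alpha> p" for i p
          by (rule order.trans[OF resolvent_kernel_bound[OF l_pos a a_le \<mu>_le \<alpha>_le]]) simp
      qed simp_all
      also have "\<dots> = (C\<theta> * kappa Y * ((4 * pi * a) powr (- (?d / 2)) * (pi powr (?d / 2) * \<alpha> powr (- ((?d + 0) / 2)) * \<mu> powr (0 / 2 - 1)))) * F * (1 / \<theta> x) * ?K"
        by (simp only: of_nat_0 of_nat_1 divide_inverse mult_1_left mult_1_right mult_ac)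
      also have "(4 * pi * a) powr (- (?d / 2)) * (pi powr (?d / 2) * \<alpha> powr (- ((?d + 0) / 2)) * \<mu> powr (0 / 2 - 1)) = (am\<^sup>2 / (a * a0)) powr (?d / 2) / \<mu>"
        unfolding \<alpha>_def by (rule C7_constant[OF am a a0 mu_pos])
      also have "C\<theta> * kappa Y * ((am\<^sup>2 / (a * a0)) powr (?d / 2) / \<mu>) * F = ?C7 / \<mu>"
        unfolding const_C7_def a_one_def F_def a_def[symmetric] a0_def[symmetric] am_def[symmetric]
        by (simp only: divide_inverse mult_1_left mult_1_right mult_ac)
      finally show ?thesis .
    qed
    have pw8: "norm (partial i v x) \<le> ?C8 / \<mu> powr (1/2) * (1 / \<theta> x) * ?K" for x i
    proof -
      define F where "F = Gamma (1/2) * (1 / (1 - \<delta>)) powr (1/2) *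
        (Gamma ((?d + 1) / 2) / Gamma (?d / 2)
          * hypergeo_real (- (?d / 2)) (1/2) (1/2) (- (\<delta> / (1 - \<delta>)))
        + 2 * (Gamma ((?d + 2) / 2) / (Gamma (1/2) * Gamma (?d / 2))) * (\<delta> / (1 - \<delta>)) powr (1/2)
          * hypergeo_real (- ((?d - 1) / 2)) 1 (3/2) (- (\<delta> / (1 - \<delta>))))"
      have "(\<lambda>k. (2 * sqrt \<delta>) ^ k / fact k * Gamma ((?d + 1 + real k) / 2) * Gamma (real k / 2 + 1/2) / Gamma (?d / 2)) sums F"
        unfolding F_def by (rule gamma_series_C8[OF dpos assms(5,6)])
      moreover have "real k / 2 + 1/2 = 1 + (real k - real 1) / 2" for k by (simp add: field_simps)
      ultimately have Fs: "(\<lambda>k. (2 * sqrt \<delta>) ^ k / fact k * Gamma ((?d + real 1 + real k) / 2) * Gamma (1 + (real k - real 1) / 2) / Gamma (?d / 2)) sums F"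
        by (simp only: of_nat_1)
      have "norm (partial i v x) \<le> kappa Y * ((4 * pi * a) powr (- (?d / 2)) / (2 * a) * (C\<theta> * ?K / \<theta> x) *
         (pi powr (?d / 2) * \<alpha> powr (- ((?d + real 1) / 2)) * \<mu> powr (real 1 / 2 - 1) * F))"
        unfolding partial resolvent_deriv_def
      proof (rule weighted_bound[OF resolvent_kernel_integrable(2)[OF diagonal_ou.l[OF ou] diagonal_ou.\<mu>[OF ou]] _ _ _ \<alpha> mu_pos assms(8,9) \<eta> Fs gC K])
        show "cmod (resolvent_kernel_deriv (l j) (b j) \<zeta> (axis i 1) p) \<le> (4 * pi * a) powr (- (?d / 2)) / (2 * a) * gauss_weight 1 \<mu> \<alpha> p" for j p
          by (rule order.trans[OF resolvent_kernel_deriv_bound[OF l_pos a a_le \<mu>_le \<alpha>_le]]) (simp add: norm_axis_1)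
        show "(4 * pi * a) powr (- (?d / 2)) / (2 * a) \<ge> 0" using a by simp
      qed simp
      also have "\<dots> = (C\<theta> * kappa Y * ((4 * pi * a) powr (- (?d / 2)) / (2 * a) * (pi powr (?d / 2) * \<alpha> powr (- ((?d + 1) / 2)) * \<mu> powr (1 / 2 - 1)))) * F * (1 / \<theta> x) * ?K"
        by (simp only: of_nat_0 of_nat_1 divide_inverse mult_1_left mult_1_right mult_ac)
      also have "(4 * pi * a) powr (- (?d / 2)) / (2 * a) * (pi powr (?d / 2) * \<alpha> powr (- ((?d + 1) / 2)) * \<mu> powr (1 / 2 - 1)) = (am\<^sup>2 / (a * a0)) powr ((?d + 1) / 2) / a powr (1/2) / \<mu> powr (1/2)"
        unfolding \<alpha>_def by (rule C8_constant[OF am a a0 mu_pos])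
      also have "C\<theta> * kappa Y * ((am\<^sup>2 / (a * a0)) powr ((?d + 1) / 2) / a powr (1/2) / \<mu> powr (1/2)) * F = ?C8 / \<mu> powr (1/2)"
        unfolding const_C8_def a_one_def F_def a_def[symmetric] a0_def[symmetric] am_def[symmetric]
        by (simp only: divide_inverse mult_1_left mult_1_right mult_ac)
      finally show ?thesis .
    qed
    \<comment> \<open>Multiplying a pointwise bound by \<theta> removes
      \<open>1 / \<theta> x\<close>, so the norm bounds and membership in the weighted space follow
      from the pointwise estimates; \<open>C_ub\<close> supplies continuity.\<close>
    have weighted: "weighted_norm \<theta> u \<le> c * ?K \<and> u \<in> C_b_weighted \<theta>"
      if u: "\<And>x. norm (u x) \<le> c * (1 / \<theta> x) * ?K" and uc: "u \<in> C_ub" for u :: "real^'d \<Rightarrow> complex^'n" and c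
    proof -
      have le: "norm (\<theta> x *\<^sub>R u x) \<le> c * ?K" for x
      proof -
        have "norm (\<theta> x *\<^sub>R u x) = \<theta> x * norm (u x)" using \<theta>[of x] by simp
        also have "\<dots> \<le> \<theta> x * (c * (1 / \<theta> x) * ?K)" using u[of x] \<theta>[of x] by (intro mult_left_mono) auto
        also have "\<dots> = c * ?K" using \<theta>[of x] by simp
        finally show ?thesis .
      qed
      have "continuous_on UNIV u" using uc unfolding C_ub_def bcontfun_def by auto
      moreover have "weighted_norm \<theta> u \<le> c * ?K"
        unfolding weighted_norm_def[of \<theta> u] by (rule cSUP_least[OF UNIV_not_empty le])
      moreover have "bounded (range (\<lambda>x. \<theta> x *\<^sub>R u x))"
        unfolding bounded_iff using le by blast
      ultimately show ?thesis unfolding C_b_weighted_def by simp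
    qed
    have vC: "v \<in> C_ub" using v_rub unfolding C_rub_def by auto
    have pC: "partial i v \<in> C_ub" for i unfolding partial by (rule resolvent_deriv_C_ub[OF gC])
    note wv = weighted[OF pw7 vC]
    note wp = weighted[OF pw8 pC]
    show ?thesis unfolding C1_b_weighted_def using wv wp pw7 pw8 has_p by auto
  qed
  show ?thesis using v_rub v1 main unfolding \<mu>_def by auto
qed

end
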